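(* Let $n\ge 2$ and let $\mathcal{Q}$ be a regular $n$-polytope, with $E$ edges, circumscribed about a unit $n$-sphere. Let $t_1,\dots,t_k$ be the distinct lengths of the line segments whose endpoints are centers of two distinct facets of $\mathcal{Q}$ (so $k$ is the number of such distinct lengths). 1. If $\mathcal{Q}$ is a simplex of dimension $n\ge 3$, then $\sum_{i=1}^{k}t_i^2$ is a rational number that is not an integer. 2. If $\mathcal{Q}$ is not a simplex of dimension $n\ge 3$, then $\sum_{i=1}^{k}t_i^2$ is an integer. Specifically: (a) if $E$ is odd, then $\sum_{i=1}^{k}t_i^2=2k+1$; (b) if $E$ is even, then $\sum_{i=1}^{k}t_i^2=2k+2$.
   Context: An $n$-polytope is a finite convex polytope of full dimension $n$ in Euclidean space $\mathbb{R}^n$; its $1$-faces are its edges and its $(n-1)$-faces are its facets. An $n$-polytope is regular (the usual notion of regular convex polytope) if (1) whenever a $(j-2)$-face is incident with a $j$-face, exactly two $(j-1)$-faces are incident with both ($1\le j\le n$, counting the empty set as the unique $(-1)$-face), and (2) there is a point $\mathbf{O}$, the center, such that for each $j\in\{0,\dots,n\}$ the centers of all $j$-faces are at the same distance from $\mathbf{O}$. A unit $n$-sphere is a sphere of radius $1$ in $\mathbb{R}^n$ (so a "2-sphere" is a circle). A regular polytope is circumscribed about it if all its facets are tangent to the sphere (the facets touch the sphere at their centers, and the sphere's center is the center of the polytope). *)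

theory Defs
  imports "HOL-Analysis.Analysis"
begin

definition full_polytope :: "'a::euclidean_space set \<Rightarrow> bool" where
  "full_polytope P \<longleftrightarrow> polytope P \<and> aff_dim P = int DIM('a)"

(* Centers of faces are vertex centroids, so that they make sense before the polytope is known to
   be regular; on regular faces this is the usual center. *)
definition face_center :: "'a::euclidean_space set \<Rightarrow> 'a" where
  "face_center F = (\<Sum>v | v extreme_point_of F. v) /\<^sub>R real (card {v. v extreme_point_of F})"

(* The improper faces are {} and P itself; aff_dim {} = -1, so {} is the unique (-1)-face. *)
definition diamond_property :: "'a::euclidean_space set \<Rightarrow> bool" where
  "diamond_property P \<longleftrightarrow>
     (\<forall>j\<in>{1..int DIM('a)}. \<forall>F G.
        F face_of P \<and> aff_dim F = j - 2 \<and> G face_of P \<and> aff_dim G = j \<and> F \<subseteq> G \<longrightarrow>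
        card {H. H face_of P \<and> aff_dim H = j - 1 \<and> F \<subseteq> H \<and> H \<subseteq> G} = 2)"

definition is_center_of :: "'a::euclidean_space \<Rightarrow> 'a set \<Rightarrow> bool" where
  "is_center_of c P \<longleftrightarrow>
     (\<forall>j\<in>{0..int DIM('a)}. \<forall>F G.
        F face_of P \<and> aff_dim F = j \<and> G face_of P \<and> aff_dim G = j \<longrightarrow>
        dist c (face_center F) = dist c (face_center G))"

definition regular_polytope :: "'a::euclidean_space set \<Rightarrow> bool" where
  "regular_polytope P \<longleftrightarrow> full_polytope P \<and> diamond_property P \<and> (\<exists>c. is_center_of c P)"

(* Tangency of a facet means that its supporting hyperplane, and not merely the facet itself,
   meets the sphere in a single point. *)
definition circumscribed_about :: "'a::euclidean_space set \<Rightarrow> 'a \<Rightarrow> real \<Rightarrow> bool" where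
  "circumscribed_about P c r \<longleftrightarrow>
     is_center_of c P \<and>
     (\<forall>F. F facet_of P \<longrightarrow> affine hull F \<inter> sphere c r = {face_center F})"

definition facet_center_distances :: "'a::euclidean_space set \<Rightarrow> real set" where
  "facet_center_distances P =
     {dist (face_center F) (face_center G) | F G. F facet_of P \<and> G facet_of P \<and> F \<noteq> G}"

end

theory Submission
  imports Defs
begin

text \<open>Place the center of the polytope at the origin. The facet centers are then unit vectors, and two of them
  are at squared distance 2 - 2x, where x is their inner product. So the sum in question is 2k minus twice
  the sum of the distinct inner products x of different facet centers. If the facet centers are closed under
  negation, then these values are paired off by x and -x except for x = -1, and the sum is 2k + 2; moreover
  the antipodal map pairs off the edges, so their number is even. It remains to see that the only regular
  polytopes without this symmetry are the polygons with an odd number of edges and the simplices, for which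
  the sum is computed directly. This can be done without classifying the regular polytopes.

  The first step is to extract symmetry from the metric definition of regularity. By induction on the
  dimension, a polytope of which the centers of the faces of each dimension are equidistant from a point has
  that point as its centroid (balanced) and is determined by one of its facets (facet_rigid): its facets are
  tangent to a sphere, a facet and a ridge of it determine the neighbouring facet by a reflection, and any two
  facets are connected by such steps (tangential_facets_connected). Consequently, the reflection that
  exchanges two faces in adjacent flags is a symmetry of the polytope (flag_reflection).

  The second step is the theory of the resulting reflection group. The normals of the mirrors that bound the
  cone over a flag form a basis of simple roots whose Coxeter diagram is a path, and no mirror cuts through
  the cone (root_sign). The longest element of the group induces, up to sign, an automorphism of that path. If it
  is the identity, then the antipodal map is a symmetry. Otherwise the diagram is a palindrome, and positive
  definiteness leaves only the diagrams of type A, which belong to the simplices, and of the 24-cell, which is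
  antipodal nevertheless (antipodal_or_simplex, simplex_if_simply_laced). This conclusion is special to dimension at
  least 3; in the plane the inner products can be counted by means of a single reflection (polygon_odd).\<close>

section \<open>Reflections and rigid motions\<close>

definition reflect :: "'a::euclidean_space \<Rightarrow> 'a \<Rightarrow> 'a" where
  "reflect a x = x - (2 * (x \<bullet> a) / (a \<bullet> a)) *\<^sub>R a"

lemma linear_reflect: "linear (reflect a)"
  by (rule linearI) (auto simp: reflect_def algebra_simps add_divide_distrib inner_simps)

lemma reflect_inner: "reflect a x \<bullet> reflect a y = x \<bullet> y"
  by (cases "a = 0") (auto simp: reflect_def inner_simps algebra_simps inner_commute)

lemma orthogonal_transformation_reflect: "orthogonal_transformation (reflect a)"
  by (simp add: orthogonal_transformation_def linear_reflect reflect_inner)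

lemma reflect_fix: "x \<bullet> a = 0 \<Longrightarrow> reflect a x = x"
  by (simp add: reflect_def)

lemma reflect_self: "reflect a a = - a"
  by (cases "a = 0") (auto simp: reflect_def scaleR_2 algebra_simps)

lemma reflect_swap:
  assumes "norm x = norm y"
  shows "reflect (x - y) x = y"
proof (cases "x = y")
  case True then show ?thesis by (simp add: reflect_def)
next
  case False
  have "x \<bullet> x = y \<bullet> y" using assms by (simp add: norm_eq)
  then have "(x - y) \<bullet> (x - y) = 2 * (x \<bullet> (x - y))"
    by (simp add: inner_simps inner_commute)
  moreover have "(x - y) \<bullet> (x - y) \<noteq> 0" using False by (simp only: inner_eq_zero_iff) simp
  ultimately have "2 * (x \<bullet> (x - y)) / ((x - y) \<bullet> (x - y)) = 1" by (metis divide_self)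
  then have "reflect (x - y) x = x - 1 *\<^sub>R (x - y)" by (simp only: reflect_def)
  then show ?thesis by simp
qed

lemma reflect_reflect: "reflect a (reflect a x) = x"
proof -
  have l: "linear (reflect a)" by (rule linear_reflect)
  have "reflect a (reflect a x) = reflect a x - (2 * (x \<bullet> a) / (a \<bullet> a)) *\<^sub>R reflect a a"
    by (subst (2) reflect_def) (simp add: linear_diff[OF l] linear_scale[OF l])
  then show ?thesis by (simp add: reflect_self) (simp add: reflect_def)
qed

lemma reflect_conj:
  assumes g: "orthogonal_transformation g" and h: "\<And>x. g (h x) = x"
  shows "reflect (g a) = g \<circ> reflect a \<circ> h"
proof
  fix y
  have lg: "linear g" and gi: "\<And>x y. g x \<bullet> g y = x \<bullet> y" using g by (auto simp: orthogonal_transformation_def)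
  have "y \<bullet> g a = h y \<bullet> a" using gi[of "h y" a] h by simp
  then show "reflect (g a) y = (g \<circ> reflect a \<circ> h) y"
    using h gi by (simp add: reflect_def linear_diff[OF lg] linear_scale[OF lg])
qed

lemma reflect_unit: "norm a = 1 \<Longrightarrow> reflect a x = x - (2 * (x \<bullet> a)) *\<^sub>R a"
  by (simp add: reflect_def norm_eq_1)

text \<open>The regularity conditions only involve faces, dimensions and distances of centers, so they are
  carried along by every isometry of the space; the isometries that occur are reflections about
  hyperplanes through a center and elements of the symmetry group.\<close>

definition rigid_motion :: "('a::euclidean_space \<Rightarrow> 'a) \<Rightarrow> bool" where
  "rigid_motion T \<longleftrightarrow> (\<exists>b g. orthogonal_transformation g \<and> T = (\<lambda>x. b + g x))"

lemma rigid_motion_about: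
  assumes "orthogonal_transformation g" shows "rigid_motion (\<lambda>x. c + g (x - d))"
proof -
  have "(\<lambda>x. c + g (x - d)) = (\<lambda>x. (c - g d) + g x)"
    using assms by (auto simp: orthogonal_transformation_def linear_diff)
  then show ?thesis using assms unfolding rigid_motion_def by blast
qed

lemma rigid_motionE:
  assumes "rigid_motion T"
  obtains b g where "linear g" "inj g" "\<And>x. norm (g x) = norm x" "T = (\<lambda>x. b + g x)"
    "\<And>S. T ` S = (+) b ` g ` S"
proof -
  obtain b g where g: "orthogonal_transformation g" "T = (\<lambda>x. b + g x)"
    using assms rigid_motion_def by blast
  show ?thesis
  proof (rule that)
    show "linear g" using g by (simp add: orthogonal_transformation_def)
    show "inj g" using g(1) orthogonal_transformation_inj by blast
    show "norm (g x) = norm x" for x using g(1) orthogonal_transformation by blast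
  qed (use g in auto)
qed

context
  fixes T :: "'a::euclidean_space \<Rightarrow> 'a"
  assumes T: "rigid_motion T"
begin

lemma rigid_motion_inj: "inj T"
  by (rule rigid_motionE[OF T]) (auto simp: inj_on_def)

lemma rigid_motion_dist: "dist (T x) (T y) = dist x y"
  by (rule rigid_motionE[OF T]) (auto simp: dist_norm simp flip: linear_diff)

lemma rigid_motion_face_of: "T ` F face_of T ` P \<longleftrightarrow> F face_of P"
  by (rule rigid_motionE[OF T]) (simp add: face_of_linear_image del: image_add_0)

lemma rigid_motion_aff_dim: "aff_dim (T ` P) = aff_dim P"
  by (rule rigid_motionE[OF T]) (simp add: aff_dim_translation_eq)

lemma rigid_motion_affine_hull: "affine hull (T ` P) = T ` (affine hull P)"
  by (rule rigid_motionE[OF T]) (simp add: affine_hull_translation affine_hull_linear_image linear_conv_bounded_linear)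

lemma rigid_motion_polytope: "polytope P \<Longrightarrow> polytope (T ` P)"
  by (rule rigid_motionE[OF T]) (metis polytope_linear_image polytope_translation_eq)

lemma rigid_motion_faces_image:
  assumes "F' face_of T ` P" obtains F where "F face_of P" "F' = T ` F"
proof -
  have "F' \<subseteq> T ` P" using assms face_of_imp_subset by blast
  then obtain F where "F \<subseteq> P" "F' = T ` F" by (meson subset_imageE)
  then show ?thesis using that assms rigid_motion_face_of by metis
qed

lemma rigid_motion_facet_of: "T ` F facet_of T ` P \<longleftrightarrow> F facet_of P"
  by (simp add: facet_of_def rigid_motion_face_of rigid_motion_aff_dim)

lemma rigid_motion_extreme_points:
  "{v. v extreme_point_of T ` P} = T ` {v. v extreme_point_of P}"
proof -
  have "T v extreme_point_of T ` P \<longleftrightarrow> v extreme_point_of P" for v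
    using rigid_motion_face_of[of "{v}" P] by (simp add: face_of_singleton)
  then show ?thesis
    by (smt (verit) Collect_cong extreme_point_of_def image_iff setcompr_eq_image)
qed

end

lemma polytope_extreme_points:
  fixes P :: "'a::euclidean_space set"
  assumes "polytope P"
  shows "finite {v. v extreme_point_of P}" "P = convex hull {v. v extreme_point_of P}"
proof -
  obtain S where S: "finite S" "P = convex hull S" using assms polytope_def by blast
  show "P = convex hull {v. v extreme_point_of P}"
    using Krein_Milman_polytope[OF S(1)] S(2) by simp
  have "{v. v extreme_point_of P} \<subseteq> S" using S(2) extreme_point_of_convex_hull by blast
  then show "finite {v. v extreme_point_of P}" using S(1) finite_subset by blast
qed

text \<open>A centroid is an affine combination, so it commutes with affine maps. The face must be nonempty:
  the center of the empty face is the origin by convention, and a translation moves it.\<close>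

lemma face_center_rigid_motion:
  assumes T: "rigid_motion T" and P: "polytope P" "P \<noteq> {}"
  shows "face_center (T ` P) = T (face_center P)"
proof -
  obtain b g where g: "linear g" "T = (\<lambda>x. b + g x)" by (rule rigid_motionE[OF T])
  let ?X = "{v. v extreme_point_of P}"
  have fin: "finite ?X" using polytope_extreme_points(1)[OF P(1)] .
  have ne: "?X \<noteq> {}" using polytope_extreme_points(2)[OF P(1)] P(2) by (metis convex_hull_empty)
  have inj: "inj_on T ?X" using rigid_motion_inj[OF T] by (meson inj_on_subset subset_UNIV)
  have n: "real (card ?X) \<noteq> 0" using fin ne by simp
  have "(\<Sum>v\<in>T ` ?X. v) = (\<Sum>v\<in>?X. T v)" using inj by (simp add: sum.reindex)
  also have "\<dots> = real (card ?X) *\<^sub>R b + g (\<Sum>v\<in>?X. v)"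
    by (simp add: g(2) sum.distrib linear_sum[OF g(1)] scaleR_conv_of_real)
       (simp add: sum_constant_scaleR)
  finally have "face_center (T ` P) = (real (card ?X) *\<^sub>R b + g (\<Sum>v\<in>?X. v)) /\<^sub>R real (card ?X)"
    unfolding face_center_def rigid_motion_extreme_points[OF T] using inj by (simp add: card_image)
  also have "\<dots> = b + g ((\<Sum>v\<in>?X. v) /\<^sub>R real (card ?X))"
    using n by (simp add: linear_scale[OF g(1)] scaleR_add_right)
  finally show ?thesis by (simp add: g(2) face_center_def)
qed

text \<open>All vertices enter the centroid with the same positive weight. This is how centers identify
  faces: two faces with a common center have intersecting relative interiors and hence are equal.\<close>

lemma face_center_in_rel_interior:
  fixes P :: "'a::euclidean_space set"
  assumes "polytope P" "P \<noteq> {}" shows "face_center P \<in> rel_interior P"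
proof -
  let ?X = "{v. v extreme_point_of P}"
  have fin: "finite ?X" and PX: "P = convex hull ?X" using polytope_extreme_points[OF assms(1)] by auto
  then have ne: "?X \<noteq> {}" using assms(2) by (metis convex_hull_empty)
  show ?thesis
  proof (cases "card ?X = 1")
    case True
    then obtain a where a: "?X = {a}" using card_1_singletonE by blast
    then have "P = {a}" using PX by simp
    then show ?thesis by (simp add: face_center_def)
  next
    case False
    then have gt: "real (card ?X) > 1" using fin ne by (metis card_0_eq less_one nat_neq_iff of_nat_1 of_nat_less_iff)
    let ?u = "\<lambda>x::'a. 1 / real (card ?X)"
    have "(\<forall>x \<in> ?X. 0 < ?u x \<and> ?u x < 1) \<and> sum ?u ?X = 1 \<and> sum (\<lambda>x. ?u x *\<^sub>R x) ?X = face_center P"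
    proof -
      have "1 / real (card ?X) < 1" using gt by simp
      moreover have "sum (\<lambda>x. ?u x *\<^sub>R x) ?X = face_center P"
        by (simp add: face_center_def scaleR_right.sum divide_inverse)
      ultimately show ?thesis using gt by simp
    qed
    then have "face_center P \<in> rel_interior (convex hull ?X)"
      by (intro subsetD[OF explicit_subset_rel_interior_convex_hull[OF fin]] CollectI exI[of _ ?u])
    then show ?thesis using PX by simp
  qed
qed

section \<open>Equicentered polytopes\<close>

text \<open>A version of regularity that is inherited by faces. The polytope need not be full dimensional,
  the center is a point of its affine hull, the common distance of the centers of the j-faces is
  recorded as a function of j so that two polytopes can be compared, and of the diamond condition
  only the existence of a second face between two incident ones is kept.\<close>

definition equicentered :: "'a::euclidean_space set \<Rightarrow> 'a \<Rightarrow> (int \<Rightarrow> real) \<Rightarrow> bool" where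
  "equicentered P c \<rho> \<longleftrightarrow> polytope P \<and> c \<in> affine hull P \<and>
    (\<forall>F G H. F face_of P \<and> G face_of P \<and> H face_of P \<and> F \<subseteq> H \<and> H \<subseteq> G \<and>
        aff_dim H = aff_dim F + 1 \<and> aff_dim G = aff_dim H + 1 \<longrightarrow>
        (\<exists>H'. H' \<noteq> H \<and> H' face_of P \<and> F \<subseteq> H' \<and> H' \<subseteq> G \<and> aff_dim H' = aff_dim H)) \<and>
    (\<forall>F. F face_of P \<and> F \<noteq> {} \<longrightarrow> dist c (face_center F) = \<rho> (aff_dim F))"

lemma equicenteredD:
  assumes "equicentered P c \<rho>"
  shows "polytope P" "c \<in> affine hull P" "P \<noteq> {}"
    "\<And>F. F face_of P \<Longrightarrow> F \<noteq> {} \<Longrightarrow> dist c (face_center F) = \<rho> (aff_dim F)"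
  using assms by (auto simp: equicentered_def)

lemma equicentered_other_face:
  assumes "equicentered P c \<rho>" "F face_of P" "G face_of P" "H face_of P" "F \<subseteq> H" "H \<subseteq> G"
    "aff_dim H = aff_dim F + 1" "aff_dim G = aff_dim H + 1"
  obtains H' where "H' \<noteq> H" "H' face_of P" "F \<subseteq> H'" "H' \<subseteq> G" "aff_dim H' = aff_dim H"
  using assms unfolding equicentered_def by blast

lemma equicentered_rigid_motion:
  assumes T: "rigid_motion T" and P: "equicentered P c \<rho>"
  shows "equicentered (T ` P) (T c) \<rho>"
  unfolding equicentered_def
proof (intro conjI allI impI)
  show "polytope (T ` P)" using T P equicenteredD(1) rigid_motion_polytope by blast
  show "T c \<in> affine hull T ` P" using P equicenteredD(2) by (auto simp: rigid_motion_affine_hull[OF T])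
next
  fix F G H
  assume a: "F face_of T ` P \<and> G face_of T ` P \<and> H face_of T ` P \<and> F \<subseteq> H \<and> H \<subseteq> G \<and>
       aff_dim H = aff_dim F + 1 \<and> aff_dim G = aff_dim H + 1"
  then obtain F0 G0 H0 where F: "F0 face_of P" "F = T ` F0" and G: "G0 face_of P" "G = T ` G0"
    and H: "H0 face_of P" "H = T ` H0"
    using rigid_motion_faces_image[OF T] by metis
  note inj = rigid_motion_inj[OF T]
  have "F0 \<subseteq> H0" "H0 \<subseteq> G0" "aff_dim H0 = aff_dim F0 + 1" "aff_dim G0 = aff_dim H0 + 1"
    using a F G H inj by (auto simp: rigid_motion_aff_dim[OF T] inj_image_subset_iff)
  then obtain H' where H': "H' \<noteq> H0" "H' face_of P" "F0 \<subseteq> H'" "H' \<subseteq> G0" "aff_dim H' = aff_dim H0"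
    using equicentered_other_face[OF P F(1) G(1) H(1)] by metis
  show "\<exists>H'. H' \<noteq> H \<and> H' face_of T ` P \<and> F \<subseteq> H' \<and> H' \<subseteq> G \<and> aff_dim H' = aff_dim H"
    using H' F G H inj
    by (intro exI[of _ "T ` H'"]) (auto simp: rigid_motion_aff_dim[OF T] rigid_motion_face_of[OF T] inj_image_eq_iff)
next
  fix F assume "F face_of T ` P \<and> F \<noteq> {}"
  then obtain F0 where F: "F0 face_of P" "F = T ` F0" "F0 \<noteq> {}"
    using rigid_motion_faces_image[OF T] by (metis image_empty)
  then have "polytope F0" using P equicenteredD(1) face_of_polytope_polytope by blast
  then show "dist (T c) (face_center F) = \<rho> (aff_dim F)"
    using F P equicenteredD(4)
    by (simp add: face_center_rigid_motion[OF T] rigid_motion_dist[OF T] rigid_motion_aff_dim[OF T])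
qed

lemma foot_exists:
  fixes c :: "'a::euclidean_space"
  assumes "S \<noteq> {}"
  obtains y where "y \<in> affine hull S" "\<And>x. x \<in> affine hull S \<Longrightarrow> (x - y) \<bullet> (c - y) = 0"
proof -
  let ?A = "affine hull S"
  let ?y = "closest_point ?A c"
  have A: "closed ?A" "?A \<noteq> {}" "convex ?A" using assms by (auto simp: closed_affine_hull affine_imp_convex)
  have y: "?y \<in> ?A" using A closest_point_in_set by blast
  have le: "(c - ?y) \<bullet> (x - ?y) \<le> 0" if "x \<in> ?A" for x
    using closest_point_dot[OF A(3,1) that] .
  have "(x - ?y) \<bullet> (c - ?y) = 0" if x: "x \<in> ?A" for x
  proof -
    have "2 *\<^sub>R ?y - x \<in> ?A"
      using mem_affine[OF affine_affine_hull y x, of 2 "-1"] by simp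
    from le[OF this] have "(c - ?y) \<bullet> (?y - x) \<le> 0" by (simp add: scaleR_2 algebra_simps)
    then show ?thesis using le[OF x] by (simp add: inner_simps inner_commute)
  qed
  then show ?thesis using that y by blast
qed

text \<open>Pythagoras.\<close>

lemma foot_dist:
  assumes "(x - y) \<bullet> (c - y) = 0"
  shows "dist y x = sqrt ((dist c x)\<^sup>2 - (dist c y)\<^sup>2)"
proof -
  have "(dist c x)\<^sup>2 = (dist c y)\<^sup>2 + (dist y x)\<^sup>2"
    using assms by (simp add: dist_norm power2_norm_eq_inner inner_simps inner_commute)
  then show ?thesis by simp
qed

lemma face_center_in_affine_hull:
  fixes F :: "'a::euclidean_space set"
  assumes "polytope F" "F \<noteq> {}" shows "face_center F \<in> affine hull F"
  using face_center_in_rel_interior[OF assms] rel_interior_subset[of F] hull_subset[of F affine] by blast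

text \<open>Seen from the foot of the perpendicular from the center to the affine hull of a face, all
  centers of j-subfaces are still equidistant, because Pythagoras subtracts the same square from
  all the squared distances.\<close>

lemma equicentered_face:
  assumes P: "equicentered P c \<rho>" and F: "F face_of P" "F \<noteq> {}"
    and y: "y \<in> affine hull F" "\<And>x. x \<in> affine hull F \<Longrightarrow> (x - y) \<bullet> (c - y) = 0"
  shows "equicentered F y (\<lambda>j. sqrt ((\<rho> j)\<^sup>2 - (dist c y)\<^sup>2))"
  unfolding equicentered_def
proof (intro conjI allI impI)
  show "polytope F" using P F equicenteredD(1) face_of_polytope_polytope by blast
  show "y \<in> affine hull F" by fact
next
  fix F1 G H
  assume a: "F1 face_of F \<and> G face_of F \<and> H face_of F \<and> F1 \<subseteq> H \<and> H \<subseteq> G \<and>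
       aff_dim H = aff_dim F1 + 1 \<and> aff_dim G = aff_dim H + 1"
  then have "F1 face_of P" "G face_of P" "H face_of P" using F face_of_trans by blast+
  then obtain H' where "H' \<noteq> H" "H' face_of P" "F1 \<subseteq> H'" "H' \<subseteq> G" "aff_dim H' = aff_dim H"
    using equicentered_other_face[OF P, of F1 G H] a by metis
  moreover have "H' face_of F"
    using calculation a F face_of_face face_of_imp_subset by (metis dual_order.trans)
  ultimately show "\<exists>H'. H' \<noteq> H \<and> H' face_of F \<and> F1 \<subseteq> H' \<and> H' \<subseteq> G \<and> aff_dim H' = aff_dim H"
    by blast
next
  fix G assume a: "G face_of F \<and> G \<noteq> {}"
  then have G: "G face_of P" "polytope G" using F P face_of_trans equicenteredD(1) face_of_polytope_polytope by blast+
  then have "face_center G \<in> affine hull F"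
    using a face_center_in_affine_hull[of G] hull_mono[OF face_of_imp_subset, of G F affine] by blast
  then have "dist y (face_center G) = sqrt ((dist c (face_center G))\<^sup>2 - (dist c y)\<^sup>2)"
    by (intro foot_dist y)
  then show "dist y (face_center G) = sqrt ((\<rho> (aff_dim G))\<^sup>2 - (dist c y)\<^sup>2)"
    using equicenteredD(4)[OF P G(1)] a by simp
qed

section \<open>Polytopes with an inscribed sphere\<close>

lemma perp_affine_hull:
  assumes "\<And>x. x \<in> S \<Longrightarrow> (x - c) \<bullet> z = k" "x \<in> affine hull S"
  shows "(x - c) \<bullet> z = k"
proof -
  have "S \<subseteq> {x. z \<bullet> x = k + c \<bullet> z}" using assms(1) by (force simp: inner_simps inner_commute)
  then have "affine hull S \<subseteq> {x. z \<bullet> x = k + c \<bullet> z}" by (rule hull_minimal) (rule affine_hyperplane)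
  then have "z \<bullet> x = k + c \<bullet> z" using assms(2) by blast
  then show ?thesis by (simp add: inner_simps inner_commute)
qed

lemma affine_add_diff:
  assumes "affine A" "c \<in> A" "x \<in> A" "y \<in> A"
  shows "c + t *\<^sub>R (x - y) \<in> A"
  using mem_affine_3[OF assms, of 1 t "-t"] by (simp add: algebra_simps)

lemma affine_add_scale:
  assumes "affine A" "c \<in> A" "c + z \<in> A" "c + y \<in> A"
  shows "c + (z - t *\<^sub>R y) \<in> A"
  using mem_affine_3[OF assms(1,3,4,2), of 1 "-t" t] by (simp add: algebra_simps)

text \<open>Adding the center to a ridge leaves exactly one direction orthogonal to both within the affine
  hull, the direction along which a reflection exchanges the two facets at that ridge.\<close>

lemma parallel_if_perp_codim2:
  fixes c :: "'a::euclidean_space"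
  assumes c: "c \<in> affine hull P" and R: "R \<subseteq> affine hull P" "aff_dim R = aff_dim P - 2"
    "c \<notin> affine hull R"
    and y: "c + y \<in> affine hull P" "y \<noteq> 0" "\<And>x. x \<in> R \<Longrightarrow> (x - c) \<bullet> y = 0"
    and z: "c + z \<in> affine hull P" "\<And>x. x \<in> R \<Longrightarrow> (x - c) \<bullet> z = 0"
  shows "\<exists>k. z = k *\<^sub>R y"
proof -
  let ?A = "affine hull P"
  let ?B = "insert c R"
  let ?C = "insert (c + y) ?B"
  have "c + y \<notin> affine hull ?B"
  proof
    assume "c + y \<in> affine hull ?B"
    then have "(c + y - c) \<bullet> y = 0" by (rule perp_affine_hull[rotated]) (use y in auto)
    then show False using y by simp
  qed
  then have "aff_dim ?C = aff_dim P" using R by (simp add: aff_dim_insert)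
  moreover have "?C \<subseteq> ?A" using c R y by auto
  ultimately have eq: "affine hull ?C = ?A"
    by (metis aff_dim_affine_hull aff_dim_eq_full_gen hull_hull)
  define k where "k = (z \<bullet> y) / (y \<bullet> y)"
  define z' where "z' = z - k *\<^sub>R y"
  have "c + z' \<in> affine hull ?C"
    unfolding eq z'_def using affine_add_scale[OF affine_affine_hull c z(1) y(1)] .
  moreover have "(x - c) \<bullet> z' = 0" if "x \<in> ?C" for x
    using that y z by (auto simp: z'_def k_def inner_simps inner_commute)
  ultimately have "(c + z' - c) \<bullet> z' = 0" using perp_affine_hull by blast
  then have "z' = 0" by simp
  then show ?thesis unfolding z'_def by (metis eq_iff_diff_eq_0)
qed

lemma codim1_affine_hull:
  fixes c :: "'a::euclidean_space"
  assumes k: "k \<noteq> 0" and c: "c \<in> affine hull P"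
    and F: "F \<subseteq> P" "aff_dim F = aff_dim P - 1" "F \<noteq> {}"
    and eq: "\<And>x. x \<in> affine hull F \<Longrightarrow> (x - c) \<bullet> p = k"
  shows "affine hull F = {x \<in> affine hull P. (x - c) \<bullet> p = k}" (is "_ = ?B")
proof -
  have B: "?B = affine hull P \<inter> {x. p \<bullet> x = k + p \<bullet> c}"
    by (auto simp: inner_simps inner_commute)
  have sub: "affine hull F \<subseteq> ?B" using eq hull_mono[OF F(1), of affine] by blast
  have ne: "affine hull F \<noteq> {}" using F by auto
  have "c \<notin> {x. p \<bullet> x = k + p \<bullet> c}" using k by simp
  then have "\<not> affine hull P \<subseteq> {x. p \<bullet> x = k + p \<bullet> c}" using c by blast
  moreover have "affine hull P \<inter> {x. p \<bullet> x = k + p \<bullet> c} \<noteq> {}" using ne sub B by blast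
  ultimately have "aff_dim ?B = aff_dim P - 1"
    unfolding B by (subst aff_dim_affine_Int_hyperplane) auto
  moreover have "affine ?B" unfolding B by (intro affine_Int affine_affine_hull affine_hyperplane)
  ultimately show ?thesis
    using affine_dim_equal[OF affine_affine_hull _ ne sub] F(2) by simp
qed

text \<open>An inscribed sphere about c that touches every facet at its center, expressed by inner products.\<close>

definition tangential :: "'a::euclidean_space set \<Rightarrow> 'a \<Rightarrow> real \<Rightarrow> bool" where
  "tangential P c r \<longleftrightarrow> polytope P \<and> c \<in> affine hull P \<and> 0 < r \<and>
    (\<forall>F. F facet_of P \<longrightarrow> norm (face_center F - c) = r \<and>
       (\<forall>x\<in>affine hull F. (x - c) \<bullet> (face_center F - c) = r\<^sup>2) \<and>
       (\<forall>x\<in>P. (x - c) \<bullet> (face_center F - c) \<le> r\<^sup>2))"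

lemma facet_of_polytope:
  assumes "polytope P" "F facet_of P"
  shows "polytope F" "F \<noteq> {}" "F face_of P" "F \<subseteq> P" "aff_dim F = aff_dim P - 1"
    "face_center F \<in> rel_interior F" "face_center F \<in> F"  "face_center F \<in> affine hull F"
proof -
  show "polytope F" "F \<noteq> {}" using assms face_of_polytope_polytope facet_of_def by blast+
  then show "face_center F \<in> rel_interior F" "face_center F \<in> affine hull F"
    using face_center_in_rel_interior face_center_in_affine_hull by blast+
  then show "face_center F \<in> F" using rel_interior_subset by blast
qed (use assms in \<open>auto simp: facet_of_def dest: face_of_imp_subset\<close>)

lemma face_center_inj:
  assumes "polytope P" "F face_of P" "H face_of P" "F \<noteq> {}" "H \<noteq> {}" "face_center F = face_center H"
  shows "F = H"
proof -
  have "polytope F" "polytope H" using assms face_of_polytope_polytope by blast+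
  then have "face_center F \<in> rel_interior F \<inter> rel_interior H"
    using assms face_center_in_rel_interior by (metis IntI)
  then show ?thesis using face_of_eq assms by blast
qed

lemma equicentered_neighbour:
  assumes P: "equicentered P c \<rho>" and F: "F facet_of P" and R: "R face_of F" "aff_dim R = aff_dim P - 2"
  obtains H where "H facet_of P" "H \<noteq> F" "R \<subseteq> H"
proof -
  note f = facet_of_polytope[OF equicenteredD(1)[OF P] F]
  have cv: "convex P" using equicenteredD(1)[OF P] polytope_imp_convex by blast
  have RP: "R face_of P" "R \<subseteq> F" using R f face_of_trans face_of_imp_subset by blast+
  have d1: "aff_dim F = aff_dim R + 1" and d2: "aff_dim P = aff_dim F + 1" using f(5) R(2) by auto
  obtain H where H: "H \<noteq> F" "H face_of P" "R \<subseteq> H" "H \<subseteq> P" "aff_dim H = aff_dim F"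
    by (rule equicentered_other_face[OF P RP(1) face_of_refl[OF cv] f(3) RP(2) f(4) d1 d2])
  have "aff_dim F \<noteq> -1" using f(2) aff_dim_empty by blast
  then have "0 \<le> aff_dim F" using aff_dim_geq[of F] by linarith
  then have "H \<noteq> {}" using H(5) by auto
  then show ?thesis using that[of H] H f(5) by (auto simp: facet_of_def)
qed

lemma ridge_exists:
  assumes "polytope P" "1 \<le> aff_dim P" "F facet_of P"
  obtains R where "R face_of F" "aff_dim R = aff_dim P - 2"
proof (cases "aff_dim P = 1")
  case True then show ?thesis using that[of "{}"] by simp
next
  case False
  note f = facet_of_polytope[OF assms(1,3)]
  then obtain R where "R facet_of F" using polytope_facet_exists False assms by (metis int_one_le_iff_zero_less diff_gt_0_iff_gt order_less_le)
  then show ?thesis using that f by (auto simp: facet_of_def)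
qed

lemma face_of_diff_convex:
  assumes "F face_of P" "convex P"
  shows "convex (P - F)"
proof (unfold convex_contains_open_segment, intro ballI)
  fix a b assume ab: "a \<in> P - F" "b \<in> P - F"
  then have "open_segment a b \<subseteq> P" using assms(2) by (simp add: convex_contains_open_segment)
  moreover have "open_segment a b \<inter> F = {}"
    using ab assms(1) face_ofD[of F P _ a b] by blast
  ultimately show "open_segment a b \<subseteq> P - F" by blast
qed

text \<open>If every facet center is the foot of the perpendicular from c, then c and the facet centers
  behave as an inscribed sphere. The facets have distinct centers, so the common distance is
  positive; and the polytope cannot lie beyond the hyperplane of one of its facets, since then
  that facet's center would be the unique point of the polytope closest to c, whereas all the
  other facet centers are as close.\<close>

lemma tangentialI:
  assumes P: "equicentered P c \<rho>" and dim: "1 \<le> aff_dim P"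
    and foot: "\<And>F x. F facet_of P \<Longrightarrow> x \<in> affine hull F \<Longrightarrow> (x - face_center F) \<bullet> (c - face_center F) = 0"
  shows "tangential P c (\<rho> (aff_dim P - 1))"
proof -
  define r where "r = \<rho> (aff_dim P - 1)"
  have poly: "polytope P" and cv: "convex P" using equicenteredD(1)[OF P] polytope_imp_convex by blast+
  have nrm: "norm (face_center F - c) = r" if "F facet_of P" for F
    using equicenteredD(4)[OF P] facet_of_polytope[OF poly that] by (simp add: r_def dist_norm norm_minus_commute)
  have another: "\<exists>H. H facet_of P \<and> face_center H \<noteq> face_center F" if F: "F facet_of P" for F
  proof -
    obtain R where "R face_of F" "aff_dim R = aff_dim P - 2" using ridge_exists[OF poly dim F] .
    then obtain H where H: "H facet_of P" "H \<noteq> F" using equicentered_neighbour[OF P F] by metis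
    then show ?thesis using face_center_inj[OF poly] F facet_of_def by metis
  qed
  obtain F0 where F0: "F0 facet_of P" using polytope_facet_exists[OF poly] dim by auto
  have r: "0 < r"
  proof (rule ccontr)
    assume "\<not> 0 < r"
    then have "r = 0" using nrm[OF F0] norm_ge_zero by (metis less_eq_real_def)
    then show False using nrm another F0 by (metis eq_iff_diff_eq_0 norm_eq_zero)
  qed
  have eq: "(x - c) \<bullet> (face_center F - c) = r\<^sup>2" if F: "F facet_of P" "x \<in> affine hull F" for F x
  proof -
    have "(face_center F - c) \<bullet> (face_center F - c) = r\<^sup>2" using nrm[OF F(1)] by (metis power2_norm_eq_inner)
    moreover have "(x - face_center F) \<bullet> (face_center F - c) = 0"
      using foot[OF F] by (metis inner_minus_right minus_diff_eq neg_equal_0_iff_equal)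
    ultimately show ?thesis by (simp add: inner_simps)
  qed
  have le: "(x - c) \<bullet> (face_center F - c) \<le> r\<^sup>2" if F: "F facet_of P" and x: "x \<in> P" for F x
  proof (rule ccontr)
    assume gt: "\<not> ?thesis"
    let ?p = "face_center F - c"
    have f: "F face_of P" "aff_dim F = aff_dim P - 1" using facet_of_polytope[OF poly F] by auto
    have "r\<^sup>2 \<noteq> 0" using r by simp
    then have aff: "affine hull F = {x \<in> affine hull P. (x - c) \<bullet> ?p = r\<^sup>2}"
      by (intro codim1_affine_hull equicenteredD(2)[OF P] facet_of_polytope[OF poly F] eq F)
    have inF: "y \<in> F" if "y \<in> P" "(y - c) \<bullet> ?p = r\<^sup>2" for y
    proof -
      have "y \<in> affine hull F" unfolding aff using that hull_subset[of P affine] by auto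
      then show ?thesis using face_of_imp_eq_affine_Int[OF cv f(1)] that by blast
    qed
    \<comment> \<open>The rest of P is convex and avoids the hyperplane of F, so it lies on one side, the side
        of x.\<close>
    have ge: "r\<^sup>2 \<le> (y - c) \<bullet> ?p" if y: "y \<in> P" for y
    proof (rule ccontr)
      assume lt: "\<not> ?thesis"
      define a b where "a = (x - c) \<bullet> ?p - r\<^sup>2" and "b = r\<^sup>2 - (y - c) \<bullet> ?p"
      have ab: "0 < a" "0 < b" using gt lt by (auto simp: a_def b_def)
      define m where "m = (b / (a + b)) *\<^sub>R x + (a / (a + b)) *\<^sub>R y"
      have sum1: "b / (a + b) + a / (a + b) = 1"
        using ab by (simp add: add_divide_distrib[symmetric] add.commute)
      have xF: "x \<notin> F"  using gt eq[OF F] hull_subset[of F affine] by auto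
      have yF: "y \<notin> F" using lt eq[OF F] hull_subset[of F affine] by auto
      have "m \<in> P - F"
        unfolding m_def using face_of_diff_convex[OF f(1) cv] x y xF yF ab sum1
        by (intro convexD[of "P - F"]) auto
      moreover have "(m - c) = (b / (a + b)) *\<^sub>R (x - c) + (a / (a + b)) *\<^sub>R (y - c)"
      proof -
        have "c = (b / (a + b) + a / (a + b)) *\<^sub>R c" using sum1 by simp
        then have "m - c = m - (b / (a + b) + a / (a + b)) *\<^sub>R c" by simp
        then show ?thesis by (simp add: m_def algebra_simps)
      qed
      then have "(m - c) \<bullet> ?p = (b / (a + b)) * (a + r\<^sup>2) + (a / (a + b)) * (r\<^sup>2 - b)"
        by (simp add: inner_add_left a_def b_def)
      then have "(m - c) \<bullet> ?p = (b / (a + b) + a / (a + b)) * r\<^sup>2" by (simp add: algebra_simps)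
      then have "(m - c) \<bullet> ?p = r\<^sup>2" using sum1 by simp
      ultimately show False using inF by blast
    qed
    obtain H where H: "H facet_of P" "face_center H \<noteq> face_center F" using another[OF F] by blast
    let ?q = "face_center H - c"
    have "face_center H \<in> P" using facet_of_polytope[OF poly H(1)] by blast
    then have "r\<^sup>2 \<le> ?q \<bullet> ?p" using ge by blast
    moreover have "(?q - ?p) \<bullet> (?q - ?p) = 2 * r\<^sup>2 - 2 * (?q \<bullet> ?p)"
      using nrm[OF F] nrm[OF H(1)] power2_norm_eq_inner[of ?p] power2_norm_eq_inner[of ?q]
      unfolding inner_diff_left[of ?q ?p] inner_diff_right[of _ ?q ?p] by (simp add: inner_commute[of ?p ?q])
    ultimately have "(?q - ?p) \<bullet> (?q - ?p) \<le> 0" by simp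
    then have "?q - ?p = 0" by (metis inner_eq_zero_iff inner_ge_zero order_antisym)
    then show False using H(2) by simp
  qed
  show ?thesis
    unfolding tangential_def r_def[symmetric] using poly equicenteredD(2)[OF P] r nrm eq le by blast
qed

lemma tangentialD:
  assumes "tangential P c r"
  shows "polytope P" "c \<in> affine hull P" "0 < r"
    "\<And>F. F facet_of P \<Longrightarrow> norm (face_center F - c) = r"
    "\<And>F x. F facet_of P \<Longrightarrow> x \<in> affine hull F \<Longrightarrow> (x - c) \<bullet> (face_center F - c) = r\<^sup>2"
    "\<And>F x. F facet_of P \<Longrightarrow> x \<in> P \<Longrightarrow> (x - c) \<bullet> (face_center F - c) \<le> r\<^sup>2"
  using assms by (auto simp: tangential_def)

lemma tangential_facet_affine_hull:
  assumes t: "tangential P c r" and F: "F facet_of P"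
  shows "affine hull F = {x \<in> affine hull P. (x - c) \<bullet> (face_center F - c) = r\<^sup>2}"
proof -
  have "r\<^sup>2 \<noteq> 0" using tangentialD(3)[OF t] by simp
  then show ?thesis
    by (intro codim1_affine_hull tangentialD(2,5)[OF t] facet_of_polytope[OF tangentialD(1)[OF t] F] F)
qed

lemma tangential_center_interior:
  assumes t: "tangential P c r"
  shows "c \<in> rel_interior P"
proof (rule ccontr)
  assume nc: "c \<notin> rel_interior P"
  note poly = tangentialD(1)[OF t]
  have ph: "polyhedron P" and bd: "bounded P" using poly polytope_imp_polyhedron polytope_imp_bounded by blast+
  have "P \<noteq> {}" using tangentialD(2)[OF t] by auto
  then obtain x where x: "x \<in> rel_interior P"
    using face_center_in_rel_interior[OF poly] by blast
  have "x + (c - x) \<in> affine hull P" using tangentialD(2)[OF t] by simp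
  moreover have "c - x \<noteq> 0" using nc x by auto
  ultimately obtain d where d: "0 < d" "x + d *\<^sub>R (c - x) \<in> rel_frontier P"
    "\<And>e. \<lbrakk>0 \<le> e; e < d\<rbrakk> \<Longrightarrow> x + e *\<^sub>R (c - x) \<in> rel_interior P"
    using ray_to_rel_frontier[OF bd x] by metis
  have "d \<le> 1" using d(3)[of 1] nc by (cases "1 < d") auto
  obtain F where F: "F facet_of P" "x + d *\<^sub>R (c - x) \<in> F"
    using d(2) rel_frontier_of_polyhedron[OF ph] by auto
  let ?p = "face_center F - c"
  have xP: "x \<in> P" using x rel_interior_subset by blast
  have "(x + d *\<^sub>R (c - x) - c) \<bullet> ?p = r\<^sup>2"
    using F by (intro tangentialD(5)[OF t]) (auto intro: hull_inc)
  moreover have "x + d *\<^sub>R (c - x) - c = (1 - d) *\<^sub>R (x - c)" by (simp add: algebra_simps)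
  ultimately have "(1 - d) * ((x - c) \<bullet> ?p) = r\<^sup>2" by simp
  moreover have "(x - c) \<bullet> ?p \<le> r\<^sup>2" using tangentialD(6)[OF t F(1) xP] .
  then have "(1 - d) * ((x - c) \<bullet> ?p) \<le> (1 - d) * r\<^sup>2" using \<open>d \<le> 1\<close> by (intro mult_left_mono) auto
  moreover have "(1 - d) * r\<^sup>2 < 1 * r\<^sup>2" using d(1) tangentialD(3)[OF t] by (intro mult_strict_right_mono) auto
  ultimately show False by simp
qed

lemma tangential_exit:
  assumes t: "tangential P c r" and y: "y \<noteq> 0" "c + y \<in> affine hull P"
  obtains d F where "0 < d" "F facet_of P" "c + d *\<^sub>R y \<in> F" "d * (y \<bullet> (face_center F - c)) = r\<^sup>2"
    "\<And>e. 0 \<le> e \<Longrightarrow> e < d \<Longrightarrow> c + e *\<^sub>R y \<in> rel_interior P"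
proof -
  note poly = tangentialD(1)[OF t]
  obtain d where d: "0 < d" "c + d *\<^sub>R y \<in> rel_frontier P"
    "\<And>e. \<lbrakk>0 \<le> e; e < d\<rbrakk> \<Longrightarrow> c + e *\<^sub>R y \<in> rel_interior P"
    using ray_to_rel_frontier[OF polytope_imp_bounded[OF poly] tangential_center_interior[OF t] y(2,1)] by metis
  obtain F where F: "F facet_of P" "c + d *\<^sub>R y \<in> F"
    using d(2) rel_frontier_of_polyhedron[OF polytope_imp_polyhedron[OF poly]] by auto
  have "(c + d *\<^sub>R y - c) \<bullet> (face_center F - c) = r\<^sup>2"
    using F by (intro tangentialD(5)[OF t]) (auto intro: hull_inc)
  then have "d * (y \<bullet> (face_center F - c)) = r\<^sup>2" by simp
  then show ?thesis using that d(1,3) F by blast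
qed

lemma tangential_facet_in_direction:
  assumes t: "tangential P c r" and y: "y \<noteq> 0" "c + y \<in> affine hull P"
  obtains F where "F facet_of P" "0 < y \<bullet> (face_center F - c)"
proof (rule tangential_exit[OF assms])
  fix d F assume "0 < d" "F facet_of P" "d * (y \<bullet> (face_center F - c)) = r\<^sup>2"
  then show ?thesis using that tangentialD(3)[OF t] by (metis zero_less_mult_pos zero_less_power)
qed

text \<open>A point outside P is separated from c by the facet through which the segment from c to it leaves
  P.\<close>

lemma tangential_halfspaces:
  assumes t: "tangential P c r" and x: "x \<in> affine hull P"
    and le: "\<And>F. F facet_of P \<Longrightarrow> (x - c) \<bullet> (face_center F - c) \<le> r\<^sup>2"
  shows "x \<in> P"
proof (rule ccontr)
  assume xP: "x \<notin> P"
  have "x - c \<noteq> 0" using xP tangential_center_interior[OF t] rel_interior_subset by auto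
  moreover have "c + (x - c) \<in> affine hull P" using x by simp
  ultimately obtain d F where d: "0 < d" and F: "F facet_of P" "c + d *\<^sub>R (x - c) \<in> F"
    and eq: "d * ((x - c) \<bullet> (face_center F - c)) = r\<^sup>2"
    and int: "\<And>e. 0 \<le> e \<Longrightarrow> e < d \<Longrightarrow> c + e *\<^sub>R (x - c) \<in> rel_interior P"
    using tangential_exit[OF t] by blast
  have "d \<noteq> 1" using F(2) xP facet_of_imp_subset[OF F(1)] by auto
  moreover have "\<not> 1 < d" using int[of 1] xP rel_interior_subset by auto
  ultimately have "d < 1" by simp
  have "r\<^sup>2 \<le> d * r\<^sup>2" using mult_left_mono[OF le[OF F(1)], of d] d unfolding eq by simp
  also have "\<dots> < 1 * r\<^sup>2" using \<open>d < 1\<close> tangentialD(3)[OF t] by (intro mult_strict_right_mono) auto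
  finally show False by simp
qed

text \<open>The simplex algorithm on the polar polytope, whose vertices all lie on a sphere. If S does not
  contain the facet G, let F be a facet in S whose vector p F from c to its center has the largest
  inner product with q = p G. Moving from the center of F inside F in the direction of q one
  leaves F through a ridge, and the facet H on the other side of that ridge satisfies
  p H \<bullet> q > p F \<bullet> q.\<close>

lemma tangential_facets_connected:
  assumes P: "equicentered P c \<rho>" and t: "tangential P c r" and dim1: "1 \<le> aff_dim P"
    and F0: "F0 facet_of P" "F0 \<in> S"
    and step: "\<And>F R H. F \<in> S \<Longrightarrow> F facet_of P \<Longrightarrow> R face_of F \<Longrightarrow> aff_dim R = aff_dim P - 2 \<Longrightarrow>
        H facet_of P \<Longrightarrow> H \<noteq> F \<Longrightarrow> R \<subseteq> H \<Longrightarrow> H \<in> S"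
    and G: "G facet_of P"
  shows "G \<in> S"
proof (rule ccontr)
  assume GS: "G \<notin> S"
  have dim: "2 \<le> aff_dim P"
  proof (rule ccontr)
    assume "\<not> ?thesis"
    then have "aff_dim P = 1" using dim1 by simp
    then show False using step[OF F0(2,1), of "{}" G] G F0 GS by auto
  qed
  note poly = tangentialD(1)[OF t]
  define p where "p F = face_center F - c" for F
  let ?q = "p G"
  let ?S = "{F. F facet_of P \<and> F \<in> S}"
  have r: "0 < r" using tangentialD(3)[OF t] .
  have nrm: "norm (p F) = r" if "F facet_of P" for F
    unfolding p_def using tangentialD(4)[OF t that] .
  have self: "p F \<bullet> p F = r\<^sup>2" if "F facet_of P" for F
    using nrm[OF that] power2_norm_eq_inner[of "p F"] by simp
  have distinct: "p F \<noteq> p H" if "F facet_of P" "H facet_of P" "F \<noteq> H" for F H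
    using face_center_inj[OF poly, of F H] that unfolding p_def facet_of_def by auto
  have lt: "p F \<bullet> p H < r\<^sup>2" if "F facet_of P" "H facet_of P" "F \<noteq> H" for F H
  proof -
    have "0 < (p F - p H) \<bullet> (p F - p H)" using distinct[OF that] by simp
    then show ?thesis using self that by (simp add: inner_diff_left inner_diff_right inner_commute)
  qed
  have fin: "finite ?S" using finite_polytope_facets[OF poly] by (rule rev_finite_subset) auto
  have "?S \<noteq> {}" using F0 by blast
  then have "Max ((\<lambda>F. p F \<bullet> ?q) ` ?S) \<in> (\<lambda>F. p F \<bullet> ?q) ` ?S" using fin by (intro Max_in) auto
  then obtain F where F: "F facet_of P" "F \<in> S" and Fm: "p F \<bullet> ?q = Max ((\<lambda>F. p F \<bullet> ?q) ` ?S)" by auto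
  have max: "p H \<bullet> ?q \<le> p F \<bullet> ?q" if "H facet_of P" "H \<in> S" for H
    unfolding Fm using that fin by (intro Max_ge) auto
  have FG: "F \<noteq> G" using F GS by blast
  note f = facet_of_polytope[OF poly F(1)]
  define a where "a = p F \<bullet> ?q"
  \<comment> \<open>the component of q parallel to the hyperplane of F\<close>
  define e where "e = ?q - (a / r\<^sup>2) *\<^sub>R p F"
  have ep: "e \<bullet> p F = 0" 
    unfolding e_def inner_diff_left inner_scaleR_left self[OF F(1)] using r by (simp add: a_def inner_commute)
  have eq: "e \<bullet> ?q = r\<^sup>2 - a\<^sup>2 / r\<^sup>2"
    using self[OF G] by (simp add: e_def inner_diff_left power2_eq_square) (simp add: a_def)
  show False
  proof (cases "e = 0")
    case True
    \<comment> \<open>G is opposite to F, and every neighbour of F is closer to G\<close>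
    have "polytope F" "0 < aff_dim F" using f dim by auto
    then obtain R where R: "R facet_of F" by (rule polytope_facet_exists)
    have Rd: "R face_of F" "aff_dim R = aff_dim P - 2" using R f(5) by (auto simp: facet_of_def)
    then obtain H where H: "H facet_of P" "H \<noteq> F" "R \<subseteq> H" using equicentered_neighbour[OF P F(1)] by metis
    have q: "?q = (a / r\<^sup>2) *\<^sub>R p F" using True by (simp add: e_def)
    have "a\<^sup>2 / r\<^sup>2 = r\<^sup>2" using eq True by simp
    then have "a\<^sup>2 = (r\<^sup>2)\<^sup>2" using r by (simp add: field_simps power2_eq_square)
    then have "a = r\<^sup>2 \<or> a = - r\<^sup>2" by (rule power2_eq_iff[THEN iffD1])
    moreover have "a < r\<^sup>2" using lt[OF F(1) G FG] by (simp add: a_def)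
    ultimately have a: "a = - r\<^sup>2" by auto
    then have "?q = - p F" using q r by simp
    then have "p H \<bullet> ?q = - (p F \<bullet> p H)" by (simp add: inner_commute)
    moreover have "p F \<bullet> p H < r\<^sup>2" using lt[OF F(1) H(1)] H(2) by blast
    moreover have "p H \<bullet> ?q \<le> a" using max[OF H(1) step[OF F(2,1) Rd H]] by (simp add: a_def)
    ultimately show False using a by simp
  next
    case False
    have bd: "bounded F" using f(1) polytope_imp_bounded by blast
    have ph: "polyhedron F" using f(1) polytope_imp_polyhedron by blast
    have "face_center G \<in> affine hull P" "face_center F \<in> affine hull P"
      using facet_of_polytope[OF poly G] f hull_subset[of P affine] by blast+
    then have "c + (?q - (a / r\<^sup>2) *\<^sub>R p F) \<in> affine hull P"
      by (intro affine_add_scale) (auto simp: p_def tangentialD(2)[OF t])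
    then have "c + e \<in> affine hull P" by (simp add: e_def)
    then have "face_center F + 1 *\<^sub>R ((c + e) - c) \<in> affine hull P"
      by (intro affine_add_diff) (auto simp: tangentialD(2)[OF t] \<open>face_center F \<in> affine hull P\<close>)
    moreover have "(face_center F + e - c) \<bullet> p F = r\<^sup>2"
    proof -
      have x: "face_center F + e - c = p F + e" by (simp add: p_def)
      show ?thesis unfolding x inner_add_left self[OF F(1)] ep by simp
    qed
    ultimately have "face_center F + e \<in> affine hull F"
      unfolding tangential_facet_affine_hull[OF t F(1)] p_def by simp
    then obtain d where d: "0 < d" "face_center F + d *\<^sub>R e \<in> rel_frontier F"
      using ray_to_rel_frontier[OF bd f(6) _ False] by metis
    obtain R where R: "R facet_of F" "face_center F + d *\<^sub>R e \<in> R"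
      using d(2) rel_frontier_of_polyhedron[OF ph] by auto
    have Rd: "R face_of F" "aff_dim R = aff_dim P - 2" using R f(5) by (auto simp: facet_of_def)
    then obtain H where H: "H facet_of P" "H \<noteq> F" "R \<subseteq> H" using equicentered_neighbour[OF P F(1)] by metis
    \<comment> \<open>The step length d is bounded because the exit point lies below the hyperplane of G; the
        bound d (a / r^2) < 1 that results is what makes the neighbour better.\<close>
    define h where "h = p F \<bullet> p H"
    have h: "h < r\<^sup>2" unfolding h_def using lt[OF F(1) H(1)] H(2) by blast
    have x: "face_center F + d *\<^sub>R e - c = p F + d *\<^sub>R e" by (simp add: p_def)
    have "(face_center F + d *\<^sub>R e - c) \<bullet> p H = r\<^sup>2"
      unfolding p_def using R H by (intro tangentialD(5)[OF t H(1)] hull_inc) auto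
    then have eH: "h + d * (e \<bullet> p H) = r\<^sup>2" unfolding x by (simp add: inner_add_left h_def)
    have "face_center F + d *\<^sub>R e \<in> P" using R f facet_of_imp_subset by blast
    then have "(face_center F + d *\<^sub>R e - c) \<bullet> ?q \<le> r\<^sup>2"
      unfolding p_def by (rule tangentialD(6)[OF t G])
    then have le1: "a + d * (r\<^sup>2 - a\<^sup>2 / r\<^sup>2) \<le> r\<^sup>2"
      unfolding x eq[symmetric] by (simp add: inner_add_left a_def)
    have a_lt: "a < r\<^sup>2" using lt[OF F(1) G FG] by (simp add: a_def)
    have fac: "r\<^sup>2 - a\<^sup>2 / r\<^sup>2 = (r\<^sup>2 - a) * (1 + a / r\<^sup>2)" using r by (simp add: field_simps power2_eq_square)
    have "d * (r\<^sup>2 - a\<^sup>2 / r\<^sup>2) \<le> r\<^sup>2 - a" using le1 by simp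
    then have "(r\<^sup>2 - a) * (d * (1 + a / r\<^sup>2)) \<le> (r\<^sup>2 - a) * 1"
      unfolding fac by (metis mult.left_commute mult_1_right)
    then have "d * (1 + a / r\<^sup>2) \<le> 1" using a_lt by (subst (asm) mult_le_cancel_left_pos) auto
    then have dlt: "d * (a / r\<^sup>2) < 1" using d(1) by (simp add: algebra_simps)
    have "d * (p H \<bullet> ?q - a) = d * (e \<bullet> p H) + d * (a / r\<^sup>2) * h - d * a"
      by (simp add: e_def h_def inner_diff_left inner_commute algebra_simps)
    also have "\<dots> = (r\<^sup>2 - h) + d * (a / r\<^sup>2) * h - d * (a / r\<^sup>2) * r\<^sup>2"
      using eH r by simp
    also have "\<dots> = (r\<^sup>2 - h) * (1 - d * (a / r\<^sup>2))" by algebra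
    also have "\<dots> > 0" using h dlt by simp
    finally have "a < p H \<bullet> ?q" using d(1) by (simp add: zero_less_mult_iff)
    moreover have "p H \<bullet> ?q \<le> a" using max[OF H(1) step[OF F(2,1) Rd H]] by (simp add: a_def)
    ultimately show False by simp
  qed
qed

section \<open>Rigidity\<close>

lemma polytope_eq_hull_facets:
  fixes P :: "'a::euclidean_space set"
  assumes "polytope P" "1 \<le> aff_dim P"
  shows "P = convex hull (\<Union>{F. F facet_of P})"
proof
  have "v \<in> \<Union>{F. F facet_of P}" if v: "v extreme_point_of P" for v
  proof -
    have "{v} face_of P" using v by (simp add: face_of_singleton)
    moreover have "{v} \<noteq> P" using assms(2) by auto
    ultimately show ?thesis
      using face_of_polyhedron_subset_facet[OF polytope_imp_polyhedron[OF assms(1)], of "{v}"] by blast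
  qed
  then have "convex hull {v. v extreme_point_of P} \<subseteq> convex hull (\<Union>{F. F facet_of P})"
    by (intro hull_mono) auto
  then show "P \<subseteq> convex hull (\<Union>{F. F facet_of P})"
    using polytope_extreme_points(2)[OF assms(1)] by simp
  show "convex hull (\<Union>{F. F facet_of P}) \<subseteq> P"
    using polytope_imp_convex[OF assms(1)] by (intro hull_minimal) (auto dest: facet_of_imp_subset)
qed

text \<open>The reflection in the hyperplane through c orthogonal to a.\<close>

definition reflect_about :: "'a::euclidean_space \<Rightarrow> 'a \<Rightarrow> 'a \<Rightarrow> 'a" where
  "reflect_about c a x = c + reflect a (x - c)"

lemma rigid_motion_reflect_about: "rigid_motion (reflect_about c a)"
  unfolding reflect_about_def[abs_def]
  by (rule rigid_motion_about[OF orthogonal_transformation_reflect])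

lemma reflect_about_center: "reflect_about c a c = c"
  by (simp add: reflect_about_def reflect_def)

lemma reflect_about_involution: "reflect_about c a (reflect_about c a x) = x"
  by (simp add: reflect_about_def reflect_reflect)

lemma reflect_about_fix: "(x - c) \<bullet> a = 0 \<Longrightarrow> reflect_about c a x = x"
  by (simp add: reflect_about_def reflect_fix)

lemma reflect_about_affine:
  assumes "affine A" "x \<in> A" "y \<in> A" "z \<in> A"
  shows "reflect_about c (y - z) x \<in> A"
proof -
  have "reflect_about c (y - z) x
    = x + (- (2 * ((x - c) \<bullet> (y - z)) / ((y - z) \<bullet> (y - z)))) *\<^sub>R (y - z)"
    by (simp add: reflect_about_def reflect_def)
  then show ?thesis by (simp only: affine_add_diff[OF assms])
qed

lemma reflect_about_affine_image:
  assumes "affine A" "y \<in> A" "z \<in> A"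
  shows "reflect_about c (y - z) ` A = A"
proof
  show "reflect_about c (y - z) ` A \<subseteq> A" using reflect_about_affine[OF assms(1) _ assms(2,3)] by blast
  then show "A \<subseteq> reflect_about c (y - z) ` A" using reflect_about_involution by (metis image_eqI image_subset_iff subsetI)
qed

text \<open>Equality of an equicentered polytope with any other one that has the same center and radii and
  shares a facet with it. Together with the next property it is proved by induction on the
  dimension d: rigidity of the facets shows that a reflection carries a facet to its neighbour,
  which determines all facets from one of them, and this makes the same reflections symmetries of
  the whole polytope.\<close>

definition facet_rigid :: "'a::euclidean_space itself \<Rightarrow> int \<Rightarrow> bool" where
  "facet_rigid _ d \<longleftrightarrow> (\<forall>(P::'a set) P' G c \<rho>. equicentered P c \<rho> \<and> equicentered P' c \<rho> \<and>
      aff_dim P = d \<and> affine hull P = affine hull P' \<and> G facet_of P \<and> G facet_of P' \<longrightarrow> P = P')"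

text \<open>Coincidence of the center with the vertex centroid. It makes the centers of the facets of a
  polytope of dimension d + 1 the feet of the perpendiculars from its center, that is, points of
  tangency.\<close>

definition balanced :: "'a::euclidean_space itself \<Rightarrow> int \<Rightarrow> bool" where
  "balanced _ d \<longleftrightarrow> (\<forall>(P::'a set) c \<rho>. equicentered P c \<rho> \<and> aff_dim P = d \<longrightarrow> face_center P = c)"

text \<open>The radii that a face of dimension d inherits, as seen from its own center.\<close>

definition sub_radius :: "(int \<Rightarrow> real) \<Rightarrow> int \<Rightarrow> int \<Rightarrow> real" where
  "sub_radius \<rho> d j = sqrt ((\<rho> j)\<^sup>2 - (\<rho> d)\<^sup>2)"

lemma balanced_face:
  fixes P :: "'a::euclidean_space set"
  assumes bal: "balanced TYPE('a) (aff_dim F)" and P: "equicentered P c \<rho>" and F: "F face_of P" "F \<noteq> {}"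
  shows "\<And>x. x \<in> affine hull F \<Longrightarrow> (x - face_center F) \<bullet> (c - face_center F) = 0"
    and "equicentered F (face_center F) (sub_radius \<rho> (aff_dim F))"
proof -
  obtain y where y: "y \<in> affine hull F" "\<And>x. x \<in> affine hull F \<Longrightarrow> (x - y) \<bullet> (c - y) = 0"
    using foot_exists[OF F(2)] by metis
  have e: "equicentered F y (\<lambda>j. sqrt ((\<rho> j)\<^sup>2 - (dist c y)\<^sup>2))" using equicentered_face[OF P F y] .
  then have fc: "face_center F = y" using bal unfolding balanced_def by blast
  show "(x - face_center F) \<bullet> (c - face_center F) = 0" if "x \<in> affine hull F" for x
    using y(2)[OF that] fc by simp
  have "dist c y = \<rho> (aff_dim F)" using equicenteredD(4)[OF P F] fc by simp
  moreover have "(\<lambda>j. sqrt ((\<rho> j)\<^sup>2 - (dist c y)\<^sup>2)) = sub_radius \<rho> (aff_dim F)"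
    using calculation by (simp add: sub_radius_def fun_eq_iff)
  ultimately show "equicentered F (face_center F) (sub_radius \<rho> (aff_dim F))" using e fc by simp
qed

lemma balanced_tangential:
  fixes P :: "'a::euclidean_space set"
  assumes "balanced TYPE('a) (aff_dim P - 1)" "equicentered P c \<rho>" "1 \<le> aff_dim P"
  shows "tangential P c (\<rho> (aff_dim P - 1))"
  using assms(2,3)
proof (rule tangentialI)
  fix F x assume F: "F facet_of P" and x: "x \<in> affine hull F"
  note f = facet_of_polytope[OF equicenteredD(1)[OF assms(2)] F]
  have "balanced TYPE('a) (aff_dim F)" using assms(1) f(5) by simp
  then show "(x - face_center F) \<bullet> (c - face_center F) = 0"
    using balanced_face(1)[OF _ assms(2) f(3,2)] x by blast
qed

lemma reflect_about_facet_centers: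
  assumes t: "tangential P c r" and F: "F facet_of P" and H: "H facet_of P"
  shows "reflect_about c (face_center F - face_center H) (face_center F) = face_center H"
proof -
  have "norm (face_center F - c) = norm (face_center H - c)" using tangentialD(4)[OF t] F H by simp
  from reflect_swap[OF this] show ?thesis by (simp add: reflect_about_def)
qed

text \<open>The reflection that exchanges two facet centers fixes the common ridge R of the facets F and H
  pointwise and maps the hyperplane of F to that of H. The image of F and H itself are then
  equicentered polytopes of dimension one less, with the same radii and a common facet R, hence
  equal by rigidity. A segment has no ridges, but there a facet is determined by its center.\<close>

lemma neighbour_reflection:
  fixes P :: "'a::euclidean_space set"
  assumes bal: "balanced TYPE('a) (aff_dim P - 1)" and rigid: "facet_rigid TYPE('a) (aff_dim P - 1)"
    and P: "equicentered P c \<rho>" and dim: "1 \<le> aff_dim P"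
    and F: "F facet_of P" and H: "H facet_of P"
    and R: "R face_of F" "R \<subseteq> H" "aff_dim R = aff_dim P - 2"
  shows "reflect_about c (face_center F - face_center H) ` F = H"
proof -
  define r where "r = \<rho> (aff_dim P - 1)"
  have t: "tangential P c r" unfolding r_def using balanced_tangential[OF bal P dim] .
  note poly = tangentialD(1)[OF t]
  note f = facet_of_polytope[OF poly F] and h = facet_of_polytope[OF poly H]
  define T where "T = reflect_about c (face_center F - face_center H)"
  have T: "rigid_motion T" unfolding T_def by (rule rigid_motion_reflect_about)
  have Tc: "T c = c" unfolding T_def by (rule reflect_about_center)
  have TF: "T (face_center F) = face_center H" unfolding T_def by (rule reflect_about_facet_centers[OF t F H])
  show ?thesis
  proof (cases "aff_dim P = 1")
    case True
    then have "aff_dim F = 0" "aff_dim H = 0" using f h by auto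
    then have "F = {face_center F}" "H = {face_center H}" using f(7) h(7) aff_dim_eq_0 by (metis singletonD)+
    then show ?thesis using TF unfolding T_def by (metis image_empty image_insert)
  next
    case False
    have balF: "balanced TYPE('a) (aff_dim F)" "balanced TYPE('a) (aff_dim H)" using bal f h by auto
    have eF: "equicentered F (face_center F) (sub_radius \<rho> (aff_dim P - 1))"
      and eH: "equicentered H (face_center H) (sub_radius \<rho> (aff_dim P - 1))"
      using balanced_face(2)[OF balF(1) P f(3,2)] balanced_face(2)[OF balF(2) P h(3,2)] f(5) h(5) by auto
    have eTF: "equicentered (T ` F) (face_center H) (sub_radius \<rho> (aff_dim P - 1))"
      using equicentered_rigid_motion[OF T eF] TF by simp
    have fcA: "face_center F \<in> affine hull P" "face_center H \<in> affine hull P"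
      using f(4,7) h(4,7) hull_subset[of P affine] by auto
    have sub: "affine hull (T ` F) \<subseteq> affine hull H"
    proof
      fix y assume "y \<in> affine hull (T ` F)"
      then obtain x where x: "x \<in> affine hull F" "y = T x" using rigid_motion_affine_hull[OF T] by auto
      have "x \<in> affine hull P" "(x - c) \<bullet> (face_center F - c) = r\<^sup>2"
        using x(1) unfolding tangential_facet_affine_hull[OF t F] by auto
      then have "T x \<in> affine hull P"
        unfolding T_def using reflect_about_affine[OF affine_affine_hull _ fcA] by blast
      moreover have "(T x - c) \<bullet> (T (face_center F) - c) = r\<^sup>2"
        using \<open>(x - c) \<bullet> (face_center F - c) = r\<^sup>2\<close> by (simp add: T_def reflect_about_def reflect_inner)
      ultimately show "y \<in> affine hull H"
        unfolding tangential_facet_affine_hull[OF t H] x(2) TF by blast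
    qed
    have ne: "affine hull (T ` F) \<noteq> {}" using f(2) by auto
    have "aff_dim (T ` F) = aff_dim H" using rigid_motion_aff_dim[OF T] f h by simp
    then have aff: "affine hull (T ` F) = affine hull H"
      using affine_dim_equal[OF affine_affine_hull affine_affine_hull ne sub] by simp
    have "T x = x" if x: "x \<in> R" for x
    proof -
      have "x \<in> affine hull F" "x \<in> affine hull H"
        using x R face_of_imp_subset hull_subset[of F affine] hull_subset[of H affine] by blast+
      then have "(x - c) \<bullet> (face_center F - c) = (x - c) \<bullet> (face_center H - c)"
        using tangentialD(5)[OF t] F H by simp
      then have "(x - c) \<bullet> (face_center F - face_center H) = 0" by (simp add: inner_diff_right)
      then show ?thesis unfolding T_def by (rule reflect_about_fix)
    qed
    then have TR: "T ` R = R" by force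
    have Rne: "R \<noteq> {}" using R(3) False dim by auto
    have "R facet_of F" using R Rne f(5) by (simp add: facet_of_def)
    then have c1: "R facet_of T ` F" using rigid_motion_facet_of[OF T, of R F] TR by simp
    have "R face_of P" using R f face_of_trans by blast
    then have "R face_of H" using R h face_of_face by blast
    then have c2: "R facet_of H" using R Rne h(5) by (simp add: facet_of_def)
    have "aff_dim (T ` F) = aff_dim P - 1" using rigid_motion_aff_dim[OF T] f by simp
    then have "T ` F = H"
      using rigid eTF eH aff c1 c2 unfolding facet_rigid_def by blast
    then show ?thesis by (simp add: T_def)
  qed
qed

text \<open>The differences of the center of F and the centers of the two candidates for the neighbour are
  parallel, and a line through a point of the sphere meets the sphere in only one other point.
  Thus both candidates have the same center, and both are the image of F under the same
  reflection.\<close>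

lemma neighbours_agree:
  fixes P P' :: "'a::euclidean_space set"
  assumes bal: "balanced TYPE('a) (aff_dim P - 1)" and rigid: "facet_rigid TYPE('a) (aff_dim P - 1)"
    and P: "equicentered P c \<rho>" and P': "equicentered P' c \<rho>" and hull: "affine hull P = affine hull P'"
    and dim: "1 \<le> aff_dim P"
    and F: "F facet_of P" "F facet_of P'" and R: "R face_of F" "aff_dim R = aff_dim P - 2"
    and H: "H facet_of P" "H \<noteq> F" "R \<subseteq> H"
  shows "H facet_of P'"
proof -
  have dim': "aff_dim P' = aff_dim P" using hull aff_dim_affine_hull by metis
  define r where "r = \<rho> (aff_dim P - 1)"
  have t: "tangential P c r" unfolding r_def using balanced_tangential[OF bal P dim] .
  have t': "tangential P' c r"
    unfolding r_def using balanced_tangential[of P' c \<rho>] bal P' dim dim' by simp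
  obtain H' where H': "H' facet_of P'" "H' \<noteq> F" "R \<subseteq> H'"
    using equicentered_neighbour[OF P' F(2) R(1)] R(2) dim' by metis
  have A: "face_center F \<in> affine hull P" "face_center H \<in> affine hull P" "face_center H' \<in> affine hull P"
    using facet_of_polytope(4,7)[OF tangentialD(1)[OF t]] facet_of_polytope(4,7)[OF tangentialD(1)[OF t']]
      F H(1) H'(1) hull_subset[of P affine] hull_subset[of P' affine] hull by blast+
  define p where "p = face_center F - c"
  define y where "y = face_center F - face_center H"
  define z where "z = face_center F - face_center H'"
  have y0: "y \<noteq> 0" and z0: "z \<noteq> 0"
    using face_center_inj[OF tangentialD(1)[OF t], of F H] face_center_inj[OF tangentialD(1)[OF t'], of F H'] F H H'
    unfolding y_def z_def facet_of_def by auto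
  have RF: "x \<in> affine hull F" "x \<in> affine hull H" "x \<in> affine hull H'" if "x \<in> R" for x
    using that face_of_imp_subset[OF R(1)] H(3) H'(3) by (auto intro: hull_inc)
  have Ry: "(x - c) \<bullet> y = 0" if "x \<in> R" for x
  proof -
    have "(x - c) \<bullet> (face_center F - c) = (x - c) \<bullet> (face_center H - c)"
      using tangentialD(5)[OF t] F H RF[OF that] by simp
    then show ?thesis by (simp add: y_def inner_diff_right)
  qed
  have Rz: "(x - c) \<bullet> z = 0" if "x \<in> R" for x
  proof -
    have "(x - c) \<bullet> (face_center F - c) = (x - c) \<bullet> (face_center H' - c)"
      using tangentialD(5)[OF t'] F H' RF[OF that] by simp
    then show ?thesis by (simp add: z_def inner_diff_right)
  qed
  have cR: "c \<notin> affine hull R"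
  proof
    assume "c \<in> affine hull R"
    then have "c \<in> affine hull F" using hull_mono[OF face_of_imp_subset[OF R(1)]] by blast
    then show False using tangentialD(5)[OF t F(1)] tangentialD(3)[OF t] by fastforce
  qed
  have RP: "R \<subseteq> affine hull P"
    using R(1) F(1) face_of_imp_subset facet_of_imp_subset hull_subset[of P affine] by blast
  have cA: "c \<in> affine hull P" using tangentialD(2)[OF t] .
  have "c + 1 *\<^sub>R y \<in> affine hull P" "c + 1 *\<^sub>R z \<in> affine hull P"
    unfolding y_def z_def using A cA by (auto intro!: affine_add_diff simp del: scaleR_one)
  then obtain k where k: "z = k *\<^sub>R y"
    using parallel_if_perp_codim2[OF cA RP R(2) cR _ y0 Ry _ Rz] by auto
  have "p - y = face_center H - c" by (simp add: p_def y_def)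
  then have n1: "norm (p - y) = norm p"
    using tangentialD(4)[OF t F(1)] tangentialD(4)[OF t H(1)] by (metis p_def)
  have "p - k *\<^sub>R y = face_center H' - c" unfolding k[symmetric] p_def z_def by simp
  then have n2: "norm (p - k *\<^sub>R y) = norm p"
    using tangentialD(4)[OF t F(1)] tangentialD(4)[OF t' H'(1)] by (metis p_def)
  \<comment> \<open>p - y and p - k y lie on the sphere of radius norm p, so that k is 0 or 1\<close>
  have "2 * (p \<bullet> y) = y \<bullet> y" "2 * k * (p \<bullet> y) = k\<^sup>2 * (y \<bullet> y)"
    using n1 n2 by (auto simp: norm_eq inner_simps inner_commute power2_eq_square)
  then have "k * (y \<bullet> y) = k\<^sup>2 * (y \<bullet> y)" by (metis mult.assoc mult.commute)
  then have "k = k\<^sup>2" using y0 by simp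
  moreover have "k \<noteq> 0" using z0 k by auto
  ultimately have "k = 1" by (simp add: power2_eq_square)
  then have "face_center H' = face_center H" using k by (simp add: y_def z_def)
  moreover have "reflect_about c (face_center F - face_center H) ` F = H"
    using neighbour_reflection[OF bal rigid P dim F(1) H(1) R(1) H(3) R(2)] .
  moreover have "reflect_about c (face_center F - face_center H') ` F = H'"
    using neighbour_reflection[of P' c \<rho> F H' R] bal rigid P' dim dim' F(2) H' R by simp
  ultimately show ?thesis using H'(1) by simp
qed

lemma facet_rigid_step:
  assumes bal: "balanced TYPE('a) (d - 1)" and rigid: "facet_rigid TYPE('a) (d - 1)" and d: "1 \<le> d"
  shows "facet_rigid TYPE('a::euclidean_space) d"
  unfolding facet_rigid_def
proof (intro allI impI, elim conjE)
  fix P P' G :: "'a set" and c \<rho>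
  assume P: "equicentered P c \<rho>" and P': "equicentered P' c \<rho>" and dim: "aff_dim P = d"
    and hull: "affine hull P = affine hull P'" and G: "G facet_of P" "G facet_of P'"
  have dim': "aff_dim P' = d" using hull aff_dim_affine_hull dim by metis
  have *: "H facet_of B" if A: "equicentered A c \<rho>" and B: "equicentered B c \<rho>"
    and dims: "aff_dim A = d" and h: "affine hull A = affine hull B" and G: "G facet_of A" "G facet_of B"
    and H: "H facet_of A" for A B H :: "'a set"
  proof -
    have t: "tangential A c (\<rho> (aff_dim A - 1))" using balanced_tangential[of A c \<rho>] A bal d dims by simp
    have dA: "1 \<le> aff_dim A" using d dims by simp
    have "H \<in> {F. F facet_of B}"
    proof (rule tangential_facets_connected[OF A t dA G(1) _ _ H])
      fix F R H1
      assume "F \<in> {F. F facet_of B}" "F facet_of A" "R face_of F" "aff_dim R = aff_dim A - 2"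
        "H1 facet_of A" "H1 \<noteq> F" "R \<subseteq> H1"
      then show "H1 \<in> {F. F facet_of B}"
        using neighbours_agree[of A c \<rho> B F R H1] A B h bal rigid d dims by simp
    qed (use G in simp)
    then show ?thesis by simp
  qed
  have "{F. F facet_of P} = {F. F facet_of P'}"
    using *[OF P P' dim hull G] *[OF P' P dim' hull[symmetric] G(2,1)] by blast
  then show "P = P'"
    using polytope_eq_hull_facets[OF equicenteredD(1)[OF P]] polytope_eq_hull_facets[OF equicenteredD(1)[OF P']]
      d dim dim' by simp
qed

text \<open>The polytope and its mirror image have the common facet H, which is the image of F.\<close>

lemma neighbour_reflection_preserves:
  fixes P :: "'a::euclidean_space set"
  assumes bal: "balanced TYPE('a) (aff_dim P - 1)" and rigid: "facet_rigid TYPE('a) (aff_dim P - 1)"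
    and P: "equicentered P c \<rho>" and dim: "1 \<le> aff_dim P"
    and F: "F facet_of P" and H: "H facet_of P"
    and R: "R face_of F" "R \<subseteq> H" "aff_dim R = aff_dim P - 2"
  shows "reflect_about c (face_center F - face_center H) ` P = P"
proof -
  define T where "T = reflect_about c (face_center F - face_center H)"
  have T: "rigid_motion T" unfolding T_def by (rule rigid_motion_reflect_about)
  have Tc: "T c = c" unfolding T_def by (rule reflect_about_center)
  have TF: "T ` F = H" unfolding T_def by (rule neighbour_reflection[OF assms])
  have fcA: "face_center F \<in> affine hull P" "face_center H \<in> affine hull P"
    using facet_of_polytope(4,7)[OF equicenteredD(1)[OF P]] F H hull_subset[of P affine] by blast+
  have "facet_rigid TYPE('a) (aff_dim P)" using facet_rigid_step[OF bal rigid dim] .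
  moreover have "equicentered (T ` P) c \<rho>" using equicentered_rigid_motion[OF T P] Tc by simp
  moreover have "aff_dim (T ` P) = aff_dim P" using rigid_motion_aff_dim[OF T] .
  moreover have "affine hull (T ` P) = affine hull P"
    unfolding rigid_motion_affine_hull[OF T] unfolding T_def
    by (rule reflect_about_affine_image[OF affine_affine_hull fcA])
  moreover have "H facet_of T ` P" using rigid_motion_facet_of[OF T] F TF by metis
  ultimately have "T ` P = P" using P H unfolding facet_rigid_def by blast
  then show ?thesis by (simp add: T_def)
qed

text \<open>The centroid of P is fixed by the reflections that exchange neighbouring facets, so its inner
  products with the vectors from c to the facet centers are all equal. If it differed from c, the
  rays from c towards and away from it would leave P through facets for which this inner product
  is positive and negative.\<close>

lemma balanced_step:
  assumes bal: "balanced TYPE('a) (d - 1)" and rigid: "facet_rigid TYPE('a) (d - 1)" and d: "1 \<le> d"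
  shows "balanced TYPE('a::euclidean_space) d"
  unfolding balanced_def
proof (intro allI impI, elim conjE)
  fix P :: "'a set" and c \<rho>
  assume P: "equicentered P c \<rho>" and dim: "aff_dim P = d"
  have dP: "1 \<le> aff_dim P" using d dim by simp
  have t: "tangential P c (\<rho> (aff_dim P - 1))" using balanced_tangential[of P c \<rho>] P bal d dim by simp
  note poly = equicenteredD(1)[OF P]
  define y where "y = face_center P - c"
  obtain F0 where F0: "F0 facet_of P" using polytope_facet_exists[OF poly] dP by auto
  define S where "S = {F. y \<bullet> (face_center F - c) = y \<bullet> (face_center F0 - c)}"
  have S: "H \<in> S" if H: "H facet_of P" for H
  proof (rule tangential_facets_connected[OF P t dP F0 _ _ H])
    show "F0 \<in> S" by (simp add: S_def)
    fix F R H
    assume FS: "F \<in> S" and F: "F facet_of P" "R face_of F" "aff_dim R = aff_dim P - 2"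
        and H: "H facet_of P" "H \<noteq> F" "R \<subseteq> H"
    let ?T = "reflect_about c (face_center F - face_center H)"
    have "?T ` P = P"
      using neighbour_reflection_preserves[of P c \<rho> F H R] bal rigid dP dim P F H by simp
    then have fix1: "?T (face_center P) = face_center P"
      using face_center_rigid_motion[OF rigid_motion_reflect_about poly, of c "face_center F - face_center H"] equicenteredD(3)[OF P]
      by simp
    define a where "a = face_center F - face_center H"
    have "a \<noteq> 0" using face_center_inj[OF poly, of F H] F H unfolding a_def facet_of_def by auto
    have "reflect a y = y" using fix1 by (simp add: reflect_about_def y_def a_def algebra_simps)
    then have "y \<bullet> a = 0" using \<open>a \<noteq> 0\<close> by (simp add: reflect_def)
    then have "y \<bullet> (face_center F - c) = y \<bullet> (face_center H - c)" by (simp add: a_def inner_diff_right)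
    then show "H \<in> S" using FS by (simp add: S_def)
  qed
  have "y = 0"
  proof (rule ccontr)
    assume y: "y \<noteq> 0"
    have "face_center P \<in> affine hull P" using face_center_in_affine_hull[OF poly equicenteredD(3)[OF P]] .
    then have "c + t *\<^sub>R y \<in> affine hull P" for t
      unfolding y_def using affine_add_diff[OF affine_affine_hull] equicenteredD(2)[OF P] by blast
    from this[of 1] this[of "-1"] have "c + y \<in> affine hull P" "c + (-y) \<in> affine hull P" by auto
    then obtain F G where "F facet_of P" "0 < y \<bullet> (face_center F - c)" "G facet_of P" "0 < - y \<bullet> (face_center G - c)"
      using tangential_facet_in_direction[OF t, of y] tangential_facet_in_direction[OF t, of "-y"] y
      by (metis neg_equal_0_iff_equal)
    then show False using S[of F] S[of G] by (simp add: S_def)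
  qed
  then show "face_center P = c" by (simp add: y_def)
qed

lemma equicentered_rigid_and_balanced:
  "facet_rigid TYPE('a::euclidean_space) (int d) \<and> balanced TYPE('a) (int d)"
proof (induction d)
  case 0
  have "facet_rigid TYPE('a) 0"
    unfolding facet_rigid_def
    by (metis aff_dim_empty diff_0 facet_of_def)
  moreover have "face_center P = c" if "equicentered P c \<rho>" "aff_dim P = 0" for P :: "'a set" and c \<rho>
  proof -
    obtain a where "P = {a}" using \<open>aff_dim P = 0\<close> aff_dim_eq_0 by blast
    then show ?thesis using equicenteredD(2)[OF that(1)] by (simp add: face_center_def)
  qed
  ultimately show ?case by (auto simp: balanced_def)
next
  case (Suc d)
  then show ?case
    using facet_rigid_step[of "int (Suc d)", where 'a='a] balanced_step[of "int (Suc d)", where 'a='a] by simp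
qed

lemma facet_rigid: "0 \<le> d \<Longrightarrow> facet_rigid TYPE('a::euclidean_space) d"
  and balanced: "0 \<le> d \<Longrightarrow> balanced TYPE('a::euclidean_space) d"
  using equicentered_rigid_and_balanced[of "nat d"] by auto

section \<open>Symmetries that exchange faces\<close>

text \<open>Symmetries are represented by their linear parts with respect to the center c, so that they act
  on the vectors from c to the centers of faces.\<close>

definition symmetries :: "'a::euclidean_space set \<Rightarrow> 'a \<Rightarrow> ('a \<Rightarrow> 'a) set" where
  "symmetries P c = {g. orthogonal_transformation g \<and> (\<lambda>x. c + g (x - c)) ` P = P}"

lemma symmetriesD:
  assumes "g \<in> symmetries P c"
  shows "orthogonal_transformation g" "linear g" "rigid_motion (\<lambda>x. c + g (x - c))"
    "(\<lambda>x. c + g (x - c)) ` P = P"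
  using assms rigid_motion_about by (auto simp: symmetries_def orthogonal_transformation_def)

lemma symmetries_reflect: "reflect a \<in> symmetries P c \<longleftrightarrow> reflect_about c a ` P = P"
  by (simp add: symmetries_def orthogonal_transformation_reflect reflect_about_def[abs_def])

lemma symmetries_comp:
  assumes g: "g \<in> symmetries P c" and h: "h \<in> symmetries P c"
  shows "g \<circ> h \<in> symmetries P c"
proof -
  have "(\<lambda>x. c + (g \<circ> h) (x - c)) ` P = (\<lambda>x. c + g (x - c)) ` ((\<lambda>x. c + h (x - c)) ` P)"
    by (simp add: image_image)
  then show ?thesis
    using g h by (simp add: symmetries_def orthogonal_transformation_compose)
qed

lemma symmetries_inverse:
  assumes g: "g \<in> symmetries P c"
  obtains h where "h \<in> symmetries P c" "\<And>x. h (g x) = x" "\<And>x. g (h x) = x"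
proof -
  have og: "orthogonal_transformation g" using symmetriesD[OF g] by blast
  then have bij: "bij g" using orthogonal_transformation_bij by blast
  have inv: "inv g (g x) = x" "g (inv g x) = x" for x
    using bij by (simp_all add: bij_is_inj bij_is_surj surj_f_inv_f)
  have "(\<lambda>x. c + inv g (x - c)) ` P = (\<lambda>x. c + inv g (x - c)) ` ((\<lambda>x. c + g (x - c)) ` P)"
    using symmetriesD(4)[OF g] by simp
  also have "\<dots> = P" by (simp add: image_image inv)
  finally have "inv g \<in> symmetries P c"
    using orthogonal_transformation_inv[OF og] by (simp add: symmetries_def)
  then show ?thesis using that inv by blast
qed

lemma symmetry_face_center:
  assumes g: "g \<in> symmetries P c" and P: "polytope P" and F: "F face_of P" "F \<noteq> {}"
  defines "T \<equiv> \<lambda>x. c + g (x - c)"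
  shows "T ` F face_of P" "face_center (T ` F) - c = g (face_center F - c)" "aff_dim (T ` F) = aff_dim F"
proof -
  have T: "rigid_motion T" "T ` P = P" unfolding T_def using symmetriesD[OF g] by auto
  show "T ` F face_of P" using rigid_motion_face_of[OF T(1), of F P] T(2) F(1) by simp
  have "polytope F" using P F face_of_polytope_polytope by blast
  then show "face_center (T ` F) - c = g (face_center F - c)"
    using face_center_rigid_motion[OF T(1)] F(2) by (simp add: T_def)
  show "aff_dim (T ` F) = aff_dim F" using rigid_motion_aff_dim[OF T(1)] .
qed

lemma rigid_motion_rel_interior:
  assumes "rigid_motion T" shows "rel_interior (T ` S) = T ` rel_interior S"
  by (rule rigid_motionE[OF assms])
     (simp add: rel_interior_translation rel_interior_injective_linear_image linear_conv_bounded_linear)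

text \<open>The consequences of the induction for an arbitrary face, no longer only for facets.\<close>

lemma equicentered_face_foot:
  fixes P :: "'a::euclidean_space set"
  assumes P: "equicentered P c \<rho>" and F: "F face_of P" "F \<noteq> {}"
  shows "\<And>x y. x \<in> F \<Longrightarrow> y \<in> F \<Longrightarrow> (x - y) \<bullet> (face_center F - c) = 0"
    and "\<exists>\<rho>'. equicentered F (face_center F) \<rho>'"
    and "1 \<le> aff_dim F \<Longrightarrow> \<exists>r. tangential F (face_center F) r"
proof -
  have "aff_dim F \<noteq> -1" using F(2) aff_dim_empty by blast
  then have "0 \<le> aff_dim F" using aff_dim_geq[of F] by linarith
  then have bal: "balanced TYPE('a) (aff_dim F)" by (rule balanced)
  show "(x - y) \<bullet> (face_center F - c) = 0" if "x \<in> F" "y \<in> F" for x y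
  proof -
    have "(x - face_center F) \<bullet> (c - face_center F) = 0" "(y - face_center F) \<bullet> (c - face_center F) = 0"
      using that balanced_face(1)[OF bal P F] hull_inc by metis+
    then show ?thesis by (simp add: inner_simps inner_commute)
  qed
  show e: "\<exists>\<rho>'. equicentered F (face_center F) \<rho>'" using balanced_face(2)[OF bal P F] by blast
  show "\<exists>r. tangential F (face_center F) r" if d: "1 \<le> aff_dim F"
  proof -
    have "balanced TYPE('a) (aff_dim F - 1)" using d by (intro balanced) simp
    then show ?thesis using e d balanced_tangential by blast
  qed
qed

text \<open>As a symmetry of Z, the reflection that exchanges X and X' is known; rigidity extends it step by
  step to the larger faces. The direction from X' to X is orthogonal to the perpendicular dropped
  from the center of a larger face to a smaller one, so the reflections about the two centers
  coincide, and the larger face and its image share the smaller one as a facet.\<close>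

lemma flag_reflection:
  fixes P Z X X' Y :: "'a::euclidean_space set"
  assumes Z: "1 \<le> aff_dim Z" and X: "X facet_of Z" "X' facet_of Z"
    and Y: "Y face_of X" "Y \<subseteq> X'" "aff_dim Y = aff_dim Z - 2"
    and P: "equicentered P c \<rho>" "Z face_of P"
  shows "reflect_about c (face_center X - face_center X') ` P = P"
  using P
proof (induction "nat (aff_dim P)" arbitrary: P c \<rho> rule: less_induct)
  case less
  note P = less.prems(1) and ZP = less.prems(2)
  have poly: "polytope P" and cv: "convex P" using equicenteredD(1)[OF P] polytope_imp_convex by blast+
  have Zne: "Z \<noteq> {}" using Z by auto
  have dP: "1 \<le> aff_dim P" using Z aff_dim_subset[OF face_of_imp_subset[OF ZP]] by linarith
  then have bal: "balanced TYPE('a) (aff_dim P - 1)" and rigid: "facet_rigid TYPE('a) (aff_dim P - 1)"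
    by (auto intro!: balanced facet_rigid)
  define T where "T = reflect_about c (face_center X - face_center X')"
  show ?case
  proof (cases "Z = P")
    case True
    then show ?thesis using neighbour_reflection_preserves[OF bal rigid P dP] X Y by simp
  next
    case False
    then obtain F where F: "F facet_of P" "Z \<subseteq> F"
      using face_of_polyhedron_subset_facet[OF polytope_imp_polyhedron[OF poly] ZP Zne] by blast
    note f = facet_of_polytope[OF poly F(1)]
    have ZF: "Z face_of F" using f(3) ZP F(2) face_of_face by blast
    obtain \<rho>' where eF: "equicentered F (face_center F) \<rho>'"
      using equicentered_face_foot(2)[OF P f(3,2)] by blast
    have "nat (aff_dim F) < nat (aff_dim P)" using f(5) dP by simp
    then have TF: "reflect_about (face_center F) (face_center X - face_center X') ` F = F"
      using less.hyps[OF _ eF ZF] by simp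
    have pZ: "polytope Z" using poly ZP face_of_polytope_polytope by blast
    have XZ: "face_center X \<in> Z" "face_center X' \<in> Z"
      using facet_of_polytope(4,7)[OF pZ] X by blast+
    have "(face_center X - face_center X') \<bullet> (face_center F - c) = 0"
      using equicentered_face_foot(1)[OF P f(3,2)] XZ F(2) by blast
    then have "(x - c) \<bullet> (face_center X - face_center X')
        = (x - face_center F) \<bullet> (face_center X - face_center X')" for x
      by (simp add: inner_diff_left inner_diff_right inner_commute)
    then have "reflect_about (face_center F) (face_center X - face_center X') = T"
      by (simp add: T_def reflect_about_def reflect_def fun_eq_iff)
    then have TF: "T ` F = F" using TF by simp
    have T: "rigid_motion T" unfolding T_def by (rule rigid_motion_reflect_about)
    have "facet_rigid TYPE('a) (aff_dim P)" using dP by (intro facet_rigid) simp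
    moreover have "equicentered (T ` P) c \<rho>"
      using equicentered_rigid_motion[OF T P] reflect_about_center[of c] by (simp add: T_def)
    moreover have "aff_dim (T ` P) = aff_dim P" using rigid_motion_aff_dim[OF T] .
    moreover have "affine hull (T ` P) = affine hull P"
      unfolding rigid_motion_affine_hull[OF T] unfolding T_def
      using XZ F(2) f(4) hull_subset[of P affine]
      by (intro reflect_about_affine_image[OF affine_affine_hull]) auto
    moreover have "F facet_of T ` P" using rigid_motion_facet_of[OF T, of F P] F(1) TF by simp
    ultimately have "T ` P = P" using P F(1) unfolding facet_rigid_def by blast
    then show ?thesis by (simp add: T_def)
  qed
qed

lemma flag_exists:
  fixes P :: "'a::euclidean_space set"
  assumes "polytope P" "aff_dim P = int n"
  obtains F where "F n = P" "\<And>i. i < n \<Longrightarrow> F i facet_of F (Suc i)"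
  using assms
proof (induction n arbitrary: P thesis)
  case 0
  show ?case by (rule "0.prems"(1)[of "\<lambda>_. P"]) auto
next
  case (Suc n)
  obtain G where G: "G facet_of P" using polytope_facet_exists[OF Suc.prems(2)] Suc.prems(3) by auto
  have "polytope G" "aff_dim G = int n" using facet_of_polytope[OF Suc.prems(2) G] Suc.prems(3) by auto
  then obtain F where F: "F n = G" "\<And>i. i < n \<Longrightarrow> F i facet_of F (Suc i)" using Suc.IH by blast
  show ?case
    by (rule Suc.prems(1)[of "F(Suc n := P)"]) (use F G in \<open>auto simp: less_Suc_eq\<close>)
qed

section \<open>Flags and their root systems\<close>

text \<open>The vectors w j span the rays of a simplicial cone, and the vectors \<alpha> i are the inward
  normals of its walls. The two families are dual bases up to positive factors.\<close>

locale dual_bases =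
  fixes n :: nat and \<alpha> w :: "nat \<Rightarrow> 'a::euclidean_space"
  assumes dim: "DIM('a) = n"
    and dual: "\<And>i j. i < n \<Longrightarrow> j < n \<Longrightarrow> i \<noteq> j \<Longrightarrow> \<alpha> i \<bullet> w j = 0"
    and dual_pos: "\<And>i. i < n \<Longrightarrow> 0 < \<alpha> i \<bullet> w i"
begin

lemma dual_swap: "dual_bases n w \<alpha>"
  using dim dual dual_pos by unfold_locales (auto simp: inner_commute)

lemma sum_dual:
  assumes "j < n"
  shows "(\<Sum>i<n. t i *\<^sub>R \<alpha> i) \<bullet> w j = t j * (\<alpha> j \<bullet> w j)"
proof -
  have "(\<Sum>i<n. t i *\<^sub>R \<alpha> i) \<bullet> w j = (\<Sum>i<n. if i = j then t j * (\<alpha> j \<bullet> w j) else 0)"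
    unfolding inner_sum_left using dual assms by (intro sum.cong) auto
  then show ?thesis using assms by simp
qed

lemma span_basis: "span (\<alpha> ` {..<n}) = UNIV"
proof -
  have inj: "inj_on \<alpha> {..<n}"
    using dual dual_pos by (intro inj_onI) (metis lessThan_iff order_less_irrefl)
  have "independent (\<alpha> ` {..<n})"
  proof (subst independent_explicit, intro conjI allI impI ballI)
    show "finite (\<alpha> ` {..<n})" by simp
    fix u v assume u: "(\<Sum>v\<in>\<alpha> ` {..<n}. u v *\<^sub>R v) = 0" and "v \<in> \<alpha> ` {..<n}"
    then obtain j where j: "j < n" "v = \<alpha> j" by auto
    have "(\<Sum>i<n. u (\<alpha> i) *\<^sub>R \<alpha> i) = 0" using u by (simp add: sum.reindex[OF inj])
    then have "u (\<alpha> j) * (\<alpha> j \<bullet> w j) = 0" using sum_dual[OF j(1), of "\<lambda>i. u (\<alpha> i)"] by simp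
    then show "u v = 0" using dual_pos[OF j(1)] j(2) by simp
  qed
  then have "dim (\<alpha> ` {..<n}) = n" by (simp add: dim_eq_card_independent card_image[OF inj])
  then show ?thesis using dim by (metis dim_eq_full)
qed

lemma eq_0_if_perp:
  assumes "\<And>i. i < n \<Longrightarrow> v \<bullet> \<alpha> i = 0"
  shows "v = 0"
proof -
  have "orthogonal v x" if "x \<in> span (\<alpha> ` {..<n})" for x
    by (rule orthogonal_to_span[OF that]) (use assms in \<open>auto simp: orthogonal_def\<close>)
  then have "orthogonal v v" using span_basis by blast
  then show ?thesis by (simp add: orthogonal_def)
qed

lemma expansion: "v = (\<Sum>i<n. ((v \<bullet> w i) / (\<alpha> i \<bullet> w i)) *\<^sub>R \<alpha> i)"
proof -
  have "v - (\<Sum>i<n. ((v \<bullet> w i) / (\<alpha> i \<bullet> w i)) *\<^sub>R \<alpha> i) = 0"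
  proof (rule dual_bases.eq_0_if_perp[OF dual_swap])
    fix j assume j: "j < n"
    then show "(v - (\<Sum>i<n. ((v \<bullet> w i) / (\<alpha> i \<bullet> w i)) *\<^sub>R \<alpha> i)) \<bullet> w j = 0"
      unfolding inner_diff_left sum_dual[OF j] using dual_pos[OF j] by simp
  qed
  then show ?thesis by simp
qed

end

text \<open>The data left over from a flag of a regular polytope: a group G of isometries that contains the
  reflections in the walls of the cone, whose Gram matrix is that of a path (the Coxeter diagram
  is a string). The condition called sign says that no mirror of G cuts through the interior of
  the cone: a root g (\<alpha> i) has coordinates of only one sign in the basis \<alpha>.\<close>

locale string_roots = dual_bases n \<alpha> w for n and \<alpha> w :: "nat \<Rightarrow> 'a::euclidean_space" +
  fixes G :: "('a \<Rightarrow> 'a) set"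
  assumes orth: "\<And>g. g \<in> G \<Longrightarrow> orthogonal_transformation g"
    and comp: "\<And>g h. g \<in> G \<Longrightarrow> h \<in> G \<Longrightarrow> g \<circ> h \<in> G"
    and inverse: "\<And>g. g \<in> G \<Longrightarrow> \<exists>h\<in>G. (\<forall>x. h (g x) = x) \<and> (\<forall>x. g (h x) = x)"
    and refl: "\<And>i. i < n \<Longrightarrow> reflect (\<alpha> i) \<in> G"
    and unit: "\<And>i. i < n \<Longrightarrow> norm (\<alpha> i) = 1"
    and far: "\<And>i j. i + 2 \<le> j \<Longrightarrow> j < n \<Longrightarrow> \<alpha> i \<bullet> \<alpha> j = 0"
    and linked: "\<And>i. Suc i < n \<Longrightarrow> \<alpha> i \<bullet> \<alpha> (Suc i) \<noteq> 0"
    and sign: "\<And>g i. g \<in> G \<Longrightarrow> i < n \<Longrightarrow> (\<forall>j<n. 0 \<le> g (\<alpha> i) \<bullet> w j) \<or> (\<forall>j<n. g (\<alpha> i) \<bullet> w j \<le> 0)"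
    and finite_orbit: "\<And>j. j < n \<Longrightarrow> finite ((\<lambda>g. g (w j)) ` G)"

locale flag =
  fixes Q :: "'a::euclidean_space set" and c :: 'a and \<rho> :: "int \<Rightarrow> real" and n :: nat and F :: "nat \<Rightarrow> 'a set"
  assumes Q: "equicentered Q c \<rho>" and dimQ: "aff_dim Q = int n" and full: "DIM('a) = n" and n: "1 \<le> n"
    and top: "F n = Q" and chain: "\<And>i. i < n \<Longrightarrow> F i facet_of F (Suc i)"
begin

lemma poly: "polytope Q" using equicenteredD(1)[OF Q] .

lemma flag_mono: "i \<le> j \<Longrightarrow> j \<le> n \<Longrightarrow> F i \<subseteq> F j"
proof (induction j rule: dec_induct)
  case (step j) then show ?case using chain[of j] facet_of_imp_subset by fastforce
qed simp

lemma flag_face: "i \<le> n \<Longrightarrow> F i face_of Q"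
proof (induction i rule: inc_induct)
  case base then show ?case using poly polytope_imp_convex face_of_refl top by auto
next
  case (step i) then show ?case using chain[of i] facet_of_imp_face_of face_of_trans by fastforce
qed

lemma flag_ne: "i \<le> n \<Longrightarrow> F i \<noteq> {}"
  using chain[of i] top equicenteredD(3)[OF Q] by (cases "i = n") (auto simp: facet_of_def)

lemma flag_poly: "i \<le> n \<Longrightarrow> polytope (F i)"
  using flag_face poly face_of_polytope_polytope by blast

lemma flag_dim: "i \<le> n \<Longrightarrow> aff_dim (F i) = int i"
proof (induction i rule: inc_induct)
  case base then show ?case using dimQ top by simp
next
  case (step i) then show ?case using chain[of i] by (auto simp: facet_of_def)
qed

lemma flag_center: "i \<le> n \<Longrightarrow> face_center (F i) \<in> rel_interior (F i)"
  using face_center_in_rel_interior flag_poly flag_ne by blast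

lemma flag_center_in: "i \<le> j \<Longrightarrow> j \<le> n \<Longrightarrow> face_center (F i) \<in> F j"
  using flag_center[of i] rel_interior_subset[of "F i"] flag_mono[of i j] by auto

definition w :: "nat \<Rightarrow> 'a" where "w j = face_center (F j) - c"

lemma w_perp: "x \<in> F j \<Longrightarrow> y \<in> F j \<Longrightarrow> j \<le> n \<Longrightarrow> (x - y) \<bullet> w j = 0"
  unfolding w_def using equicentered_face_foot(1)[OF Q flag_face flag_ne] by blast

text \<open>The face of the flag below F i; for i = 0 it is the empty face of dimension -1.\<close>

definition ridge :: "nat \<Rightarrow> 'a set" where "ridge i = (if i = 0 then {} else F (i - 1))"

definition other :: "nat \<Rightarrow> 'a set" where
  "other i = (SOME X. X facet_of F (Suc i) \<and> X \<noteq> F i \<and> ridge i \<subseteq> X)"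

lemma ridge:
  assumes "i < n" shows "ridge i face_of F i" "aff_dim (ridge i) = aff_dim (F (Suc i)) - 2"
  using assms chain[of "i - 1"] flag_dim[of "i - 1"] flag_dim[of "Suc i"]
  by (auto simp: ridge_def facet_of_def)

lemma other:
  assumes i: "i < n" shows "other i facet_of F (Suc i)" "other i \<noteq> F i" "ridge i \<subseteq> other i"
proof -
  have "Suc i \<le> n" using i by simp
  then obtain \<rho>' where e: "equicentered (F (Suc i)) (face_center (F (Suc i))) \<rho>'"
    using equicentered_face_foot(2)[OF Q flag_face flag_ne] by blast
  obtain X where "X facet_of F (Suc i) \<and> X \<noteq> F i \<and> ridge i \<subseteq> X"
    using equicentered_neighbour[OF e chain[OF i] ridge[OF i]] by metis
  then have "other i facet_of F (Suc i) \<and> other i \<noteq> F i \<and> ridge i \<subseteq> other i"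
    unfolding other_def by (rule someI)
  then show "other i facet_of F (Suc i)" "other i \<noteq> F i" "ridge i \<subseteq> other i" by auto
qed

text \<open>The vector along which F i is reflected to the other face in the same position between its
  neighbours in the flag.\<close>

definition a :: "nat \<Rightarrow> 'a" where "a i = face_center (F i) - face_center (other i)"

lemma other_center: "i < n \<Longrightarrow> face_center (other i) \<in> F (Suc i)"
  using facet_of_polytope(4,7)[OF flag_poly other(1)] by (meson Suc_leI subsetD)

lemma a_nz: assumes "i < n" shows "a i \<noteq> 0"
proof -
  have "polytope (F (Suc i))" using assms flag_poly by simp
  then show ?thesis using face_center_inj[of "F (Suc i)" "F i" "other i"] other[OF assms] chain[OF assms]
    unfolding a_def facet_of_def by auto
qed

text \<open>Both centers lie in F j, and w j is perpendicular to F j.\<close>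

lemma a_perp_above: assumes "i < j" "j \<le> n" shows "a i \<bullet> w j = 0"
  unfolding a_def
  by (rule w_perp[OF _ _ assms(2)])
     (use assms flag_center_in[of i j] other_center[of i] flag_mono[of "Suc i" j] in auto)

lemma a_tangential:
  assumes i: "i < n"
  obtains r where "0 < r" "norm (face_center (F i) - face_center (F (Suc i))) = r"
    "norm (face_center (other i) - face_center (F (Suc i))) = r"
    "\<And>x. x \<in> F i \<Longrightarrow> (x - face_center (F (Suc i))) \<bullet> (face_center (F i) - face_center (F (Suc i))) = r\<^sup>2"
    "\<And>x. x \<in> other i \<Longrightarrow> (x - face_center (F (Suc i))) \<bullet> (face_center (other i) - face_center (F (Suc i))) = r\<^sup>2"
proof -
  have i': "Suc i \<le> n" using i by simp
  then obtain r where t: "tangential (F (Suc i)) (face_center (F (Suc i))) r"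
    using equicentered_face_foot(3)[OF Q flag_face flag_ne, of "Suc i"] flag_dim[OF i'] by auto
  show ?thesis
    by (rule that[of r]) (auto intro!: tangentialD[OF t] chain other i hull_inc)
qed

lemma a_perp_ridge:
  assumes i: "i < n" and x: "x \<in> ridge i" shows "(x - face_center (F (Suc i))) \<bullet> a i = 0"
proof -
  have "x \<in> F i" "x \<in> other i" using x other(3)[OF i] face_of_imp_subset[OF ridge(1)[OF i]] by auto
  then have "(x - face_center (F (Suc i))) \<bullet> (face_center (F i) - face_center (F (Suc i)))
    = (x - face_center (F (Suc i))) \<bullet> (face_center (other i) - face_center (F (Suc i)))"
    by (rule_tac a_tangential[OF i]) simp
  then show ?thesis by (simp add: a_def inner_diff_right)
qed

text \<open>The center of F j lies in the ridge shared by F i and the other face, hence on the mirror that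
  exchanges them.\<close>

lemma a_perp_below: assumes "j < i" "i < n" shows "a i \<bullet> w j = 0"
proof -
  have "face_center (F j) \<in> ridge i" using assms flag_center_in[of j "i - 1"] by (auto simp: ridge_def)
  then have "(face_center (F j) - face_center (F (Suc i))) \<bullet> a i = 0" using a_perp_ridge assms by blast
  moreover have "a i \<bullet> w (Suc i) = 0" using assms by (intro a_perp_above) auto
  ultimately show ?thesis by (simp add: w_def inner_diff_left inner_diff_right inner_commute)
qed

lemma a_pos: assumes i: "i < n" shows "0 < a i \<bullet> w i"
proof -
  define p q where "p = face_center (F i) - face_center (F (Suc i))"
    and "q = face_center (other i) - face_center (F (Suc i))"
  have a: "a i = p - q" by (simp add: a_def p_def q_def)
  have "norm p = norm q" unfolding p_def q_def by (rule a_tangential[OF i]) simp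
  then have pq: "p \<bullet> p = q \<bullet> q" by (simp add: norm_eq)
  have "0 < (p - q) \<bullet> (p - q)" using a_nz[OF i] a by simp
  then have "0 < (p - q) \<bullet> p" using pq by (simp add: inner_diff_left inner_diff_right inner_commute)
  moreover have "a i \<bullet> w (Suc i) = 0" using i by (intro a_perp_above) auto
  moreover have "w i = p + w (Suc i)" by (simp add: w_def p_def)
  ultimately show ?thesis by (simp add: a inner_add_right)
qed

text \<open>The direction a i runs inside a face that is contained in the ridge belonging to j, and the
  mirror of a j contains that ridge.\<close>

lemma a_far: assumes "i + 2 \<le> j" "j < n" shows "a i \<bullet> a j = 0"
proof -
  have "F (Suc i) \<subseteq> ridge j" using assms flag_mono[of "Suc i" "j - 1"] by (auto simp: ridge_def)
  then have "face_center (F i) \<in> ridge j" "face_center (other i) \<in> ridge j"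
    using assms flag_center_in[of i "Suc i"] other_center[of i] by auto
  then have "(face_center (F i) - face_center (F (Suc j))) \<bullet> a j = 0"
    "(face_center (other i) - face_center (F (Suc j))) \<bullet> a j = 0"
    using a_perp_ridge assms by blast+
  then show ?thesis by (simp add: a_def inner_diff_left)
qed

lemma a_reflection: assumes i: "i < n" shows "reflect (a i) \<in> symmetries Q c"
proof -
  have "1 \<le> aff_dim (F (Suc i))" using flag_dim[of "Suc i"] i by simp
  then have "reflect_about c (face_center (F i) - face_center (other i)) ` Q = Q"
    by (rule flag_reflection[OF _ chain[OF i] other(1)[OF i] ridge(1)[OF i] other(3)[OF i] ridge(2)[OF i] Q])
       (use flag_face i in simp)
  then show ?thesis by (simp add: symmetries_reflect a_def)
qed

definition \<alpha> :: "nat \<Rightarrow> 'a" where "\<alpha> i = a i /\<^sub>R norm (a i)"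

lemma reflect_\<alpha>: assumes i: "i < n" shows "reflect (\<alpha> i) = reflect (a i)"
proof -
  have "norm (a i) * norm (a i) = a i \<bullet> a i" by (simp add: power2_norm_eq_inner[symmetric] power2_eq_square)
  then show ?thesis
    using a_nz[OF i] by (simp add: \<alpha>_def reflect_def fun_eq_iff field_simps)
qed

sublocale dual_bases n \<alpha> w
proof
  show "DIM('a) = n" by (rule full)
  fix i j assume "i < n" "j < n" "i \<noteq> j"
  then show "\<alpha> i \<bullet> w j = 0" using a_perp_above[of i j] a_perp_below[of j i] by (cases "i < j") (auto simp: \<alpha>_def)
next
  fix i assume "i < n" then show "0 < \<alpha> i \<bullet> w i" using a_pos a_nz by (simp add: \<alpha>_def)
qed

text \<open>If \<alpha> i and \<alpha> (i + 1) were orthogonal, then the vector from the center of F (i + 1)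
  to that of F i, which is a combination of \<alpha> 0, ..., \<alpha> i, would be orthogonal to
  \<alpha> (i + 1). But this vector is w i - w (i + 1), where w i is orthogonal to \<alpha>
  (i + 1) and w (i + 1) is not.\<close>

lemma \<alpha>_linked: assumes i: "Suc i < n" shows "\<alpha> i \<bullet> \<alpha> (Suc i) \<noteq> 0"
proof
  assume z: "\<alpha> i \<bullet> \<alpha> (Suc i) = 0"
  define v where "v = face_center (F i) - face_center (F (Suc i))"
  have vw: "v \<bullet> w k = 0" if "i < k" "k < n" for k
    unfolding v_def by (rule w_perp) (use that flag_center_in in auto)
  have "v \<bullet> \<alpha> (Suc i) = (\<Sum>k<n. (v \<bullet> w k) / (\<alpha> k \<bullet> w k) * (\<alpha> k \<bullet> \<alpha> (Suc i)))"
    by (subst (1) expansion[of v]) (simp add: inner_sum_left)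
  also have "\<dots> = 0"
  proof (rule sum.neutral, rule ballI)
    fix k assume k: "k \<in> {..<n}"
    consider "i < k" | "k = i" | "k < i" by linarith
    then show "(v \<bullet> w k) / (\<alpha> k \<bullet> w k) * (\<alpha> k \<bullet> \<alpha> (Suc i)) = 0"
    proof cases
      case 3 then have "a k \<bullet> a (Suc i) = 0" using i by (intro a_far) auto
      then show ?thesis by (simp add: \<alpha>_def)
    qed (use vw k z in auto)
  qed
  finally have "v \<bullet> \<alpha> (Suc i) = 0" .
  moreover have "v = w i - w (Suc i)" by (simp add: v_def w_def)
  moreover have "\<alpha> (Suc i) \<bullet> w i = 0" using dual i by simp
  ultimately have "\<alpha> (Suc i) \<bullet> w (Suc i) = 0" by (simp add: inner_diff_right inner_commute)
  then show False using dual_pos[OF i] by simp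
qed

lemma flag_point_rel_interior:
  assumes "m < n" "\<And>j. j \<le> m \<Longrightarrow> 0 < t j"
  shows "c + (\<Sum>j\<le>m. t j *\<^sub>R w j) /\<^sub>R (\<Sum>j\<le>m. t j) \<in> rel_interior (F m)"
  using assms
proof (induction m)
  case 0 then show ?case using flag_center[of 0] by (simp add: w_def)
next
  case (Suc m)
  define s where "s = (\<Sum>j\<le>m. t j)"
  define y where "y = (\<Sum>j\<le>m. t j *\<^sub>R w j)"
  have s: "0 < s" unfolding s_def using Suc.prems by (intro sum_pos) auto
  have tp: "0 < t (Suc m)" using Suc.prems by simp
  have "c + y /\<^sub>R s \<in> rel_interior (F m)" unfolding s_def y_def using Suc by simp
  then have q: "c + y /\<^sub>R s \<in> F (Suc m)"
    using rel_interior_subset[of "F m"] flag_mono[of m "Suc m"] Suc.prems(1) by auto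
  define e where "e = t (Suc m) / (s + t (Suc m))"
  have e: "0 < e" "e \<le> 1" "1 - e = s / (s + t (Suc m))" using s tp by (auto simp: e_def field_simps)
  have "convex (F (Suc m))" using flag_poly[of "Suc m"] polytope_imp_convex Suc.prems(1) by auto
  then have "(c + y /\<^sub>R s) - e *\<^sub>R ((c + y /\<^sub>R s) - face_center (F (Suc m))) \<in> rel_interior (F (Suc m))"
    using flag_center[of "Suc m"] Suc.prems(1) q e by (intro rel_interior_convex_shrink) auto
  moreover have "(c + y /\<^sub>R s) - e *\<^sub>R ((c + y /\<^sub>R s) - face_center (F (Suc m)))
     = c + ((1 - e) * inverse s) *\<^sub>R y + e *\<^sub>R w (Suc m)"
    by (simp add: w_def algebra_simps)
  moreover have "(1 - e) * inverse s = inverse (s + t (Suc m))" unfolding e(3) using s tp by (simp add: field_simps)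
  moreover have "e = inverse (s + t (Suc m)) * t (Suc m)" by (simp add: e_def divide_inverse)
  ultimately have "c + inverse (s + t (Suc m)) *\<^sub>R y + (inverse (s + t (Suc m)) * t (Suc m)) *\<^sub>R w (Suc m)
      \<in> rel_interior (F (Suc m))" by metis
  then have "c + (y + t (Suc m) *\<^sub>R w (Suc m)) /\<^sub>R (s + t (Suc m)) \<in> rel_interior (F (Suc m))"
    by (simp add: scaleR_add_right add.assoc)
  then show ?case by (simp add: s_def y_def)
qed

text \<open>A point in the interior of the flag cone determines the flag: scaled to a convex combination of
  the centers of F 0, ..., F m, it lies in the relative interior of F m. A symmetry that fixes it
  therefore preserves F m and fixes its center. Subtracting the contribution of that center leaves
  a fixed point of the cone of the shorter flag.\<close>

lemma symmetry_fixing_flag_point: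
  assumes h: "h \<in> symmetries Q c" and t: "\<And>j. j < n \<Longrightarrow> 0 < t j"
    and "m \<le> n" "h (\<Sum>j<m. t j *\<^sub>R w j) = (\<Sum>j<m. t j *\<^sub>R w j)" "j < m"
  shows "h (w j) = w j"
  using assms(3-)
proof (induction m)
  case (Suc m)
  define T where "T = (\<lambda>x. c + h (x - c))"
  have T: "rigid_motion T" "linear h" "T ` Q = Q" unfolding T_def using symmetriesD[OF h] by auto
  have m: "m < n" using Suc.prems by simp
  define x where "x = c + (\<Sum>j\<le>m. t j *\<^sub>R w j) /\<^sub>R (\<Sum>j\<le>m. t j)"
  have xF: "x \<in> rel_interior (F m)" unfolding x_def using m t by (intro flag_point_rel_interior) auto
  have Tx: "T x = x"
    using Suc.prems(2) by (simp add: T_def x_def linear_scale[OF T(2)] lessThan_Suc_atMost)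
  have ff: "F m face_of Q" "F m \<noteq> {}" using flag_face[of m] flag_ne[of m] m by auto
  have "T ` F m face_of Q" using symmetry_face_center(1)[OF h poly ff] by (simp add: T_def)
  moreover have "T x \<in> rel_interior (T ` F m)" using rigid_motion_rel_interior[OF T(1)] xF by blast
  ultimately have "T ` F m = F m" using face_of_eq[OF _ ff(1)] xF Tx by (metis IntI empty_iff)
  then have hw: "h (w m) = w m" using symmetry_face_center(2)[OF h poly ff] by (simp add: T_def w_def)
  show ?case
  proof (cases "j = m")
    case True then show ?thesis using hw by simp
  next
    case False
    have "h (\<Sum>j<m. t j *\<^sub>R w j) = (\<Sum>j<m. t j *\<^sub>R w j)"
      using Suc.prems(2) hw by (simp add: linear_add[OF T(2)] linear_scale[OF T(2)])
    then show ?thesis using Suc.IH Suc.prems False by simp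
  qed
qed simp

text \<open>A mirror that separated two of the vectors w j would contain an interior point of the flag cone,
  and its reflection, being a symmetry that fixes this point, would fix all of w.\<close>

lemma root_sign:
  assumes g: "g \<in> symmetries Q c" and i: "i < n"
  shows "(\<forall>j<n. 0 \<le> g (\<alpha> i) \<bullet> w j) \<or> (\<forall>j<n. g (\<alpha> i) \<bullet> w j \<le> 0)"
proof (rule ccontr)
  assume neg: "\<not> ?thesis"
  define b where "b = g (\<alpha> i)"
  define x where "x j = b \<bullet> w j" for j
  obtain h where h: "h \<in> symmetries Q c" "\<And>x. h (g x) = x" "\<And>x. g (h x) = x"
    using symmetries_inverse[OF g] by blast
  have "reflect b = g \<circ> reflect (\<alpha> i) \<circ> h"
    unfolding b_def by (rule reflect_conj[OF symmetriesD(1)[OF g] h(3)])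
  then have rb: "reflect b \<in> symmetries Q c"
    using g h(1) a_reflection[OF i] reflect_\<alpha>[OF i] by (simp add: symmetries_comp)
  define N where "N = {j. j < n \<and> x j < 0}"
  define M where "M = {j. j < n \<and> 0 < x j}"
  have "N \<noteq> {}" "M \<noteq> {}" using neg unfolding N_def M_def x_def b_def by (auto simp: not_le)
  define u where "u = - (\<Sum>j\<in>N. x j)"
  define v where "v = (\<Sum>j\<in>M. x j)"
  have v: "0 < v" unfolding v_def using \<open>M \<noteq> {}\<close> by (intro sum_pos) (auto simp: M_def)
  have u: "0 < u" unfolding u_def sum_negf[symmetric] using \<open>N \<noteq> {}\<close> by (intro sum_pos) (auto simp: N_def)
  \<comment> \<open>positive weights for which the contributions of both sides of the mirror cancel\<close>
  define t where "t j = (if x j < 0 then v else if 0 < x j then u else 1)" for j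
  have t: "0 < t j" for j using u v by (simp add: t_def)
  have "(\<Sum>j<n. t j * x j) = (\<Sum>j<n. (if j \<in> N then v * x j else 0) + (if j \<in> M then u * x j else 0))"
    by (intro sum.cong) (auto simp: t_def N_def M_def)
  also have "\<dots> = (\<Sum>j\<in>N. v * x j) + (\<Sum>j\<in>M. u * x j)"
  proof -
    have "{..<n} \<inter> N = N" "{..<n} \<inter> M = M" by (auto simp: N_def M_def)
    then show ?thesis by (simp add: sum.distrib sum.inter_restrict[symmetric])
  qed
  also have "\<dots> = 0" by (simp only: sum_distrib_left[symmetric]) (simp add: u_def v_def)
  finally have "(\<Sum>j<n. t j *\<^sub>R w j) \<bullet> b = 0" by (simp add: inner_sum_left x_def inner_commute[of b])
  then have "reflect b (\<Sum>j<n. t j *\<^sub>R w j) = (\<Sum>j<n. t j *\<^sub>R w j)" by (rule reflect_fix)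
  then have fix_w: "reflect b (w j) = w j" if "j < n" for j
    using symmetry_fixing_flag_point[OF rb, of t n] t that by simp
  obtain j where j: "j < n" "x j < 0" using \<open>N \<noteq> {}\<close> by (auto simp: N_def)
  then have "b \<noteq> 0" by (auto simp: x_def)
  then have "w j \<bullet> b = 0" using fix_w[OF j(1)] by (simp add: reflect_def)
  then show False using j(2) by (simp add: x_def inner_commute)
qed

sublocale string_roots n \<alpha> w "symmetries Q c"
proof
  show "orthogonal_transformation g" if "g \<in> symmetries Q c" for g using symmetriesD(1)[OF that] .
  show "g \<circ> h \<in> symmetries Q c" if "g \<in> symmetries Q c" "h \<in> symmetries Q c" for g h
    using symmetries_comp[OF that] .
  show "\<exists>h\<in>symmetries Q c. (\<forall>x. h (g x) = x) \<and> (\<forall>x. g (h x) = x)" if "g \<in> symmetries Q c" for g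
    using symmetries_inverse[OF that] by metis
  show "reflect (\<alpha> i) \<in> symmetries Q c" if "i < n" for i
    using that a_reflection reflect_\<alpha> by simp
  show "norm (\<alpha> i) = 1" if "i < n" for i using a_nz[OF that] by (simp add: \<alpha>_def)
  show "\<alpha> i \<bullet> \<alpha> j = 0" if "i + 2 \<le> j" "j < n" for i j using a_far[OF that] by (simp add: \<alpha>_def)
  show "\<alpha> i \<bullet> \<alpha> (Suc i) \<noteq> 0" if "Suc i < n" for i using \<alpha>_linked[OF that] .
  show "(\<forall>j<n. 0 \<le> g (\<alpha> i) \<bullet> w j) \<or> (\<forall>j<n. g (\<alpha> i) \<bullet> w j \<le> 0)"
    if "g \<in> symmetries Q c" "i < n" for g i using root_sign[OF that] .
  fix j assume j: "j < n"
  have "(\<lambda>g. g (w j)) ` symmetries Q c \<subseteq> (\<lambda>F. face_center F - c) ` {F. F face_of Q}"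
  proof clarsimp
    fix g assume g: "g \<in> symmetries Q c"
    have "F j face_of Q" "F j \<noteq> {}" using flag_face[of j] flag_ne[of j] j by auto
    note s = symmetry_face_center[OF g poly this]
    show "g (w j) \<in> (\<lambda>F. face_center F - c) ` {F. F face_of Q}"
      unfolding w_def s(2)[symmetric] using s(1) by blast
  qed
  then show "finite ((\<lambda>g. g (w j)) ` symmetries Q c)"
    using finite_polytope_faces[OF poly] finite_surj by blast
qed

end

section \<open>The longest element and the Coxeter diagram\<close>

text \<open>A path has no automorphisms other than the identity and the reversal: injectivity prevents a
  walk along the path from turning back.\<close>

lemma path_automorphism:
  fixes f :: "nat \<Rightarrow> nat"
  assumes range: "\<And>i. i < n \<Longrightarrow> f i < n" and inj: "inj_on f {..<n}"
    and step: "\<And>i. Suc i < n \<Longrightarrow> f (Suc i) = Suc (f i) \<or> f i = Suc (f (Suc i))"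
  shows "(\<forall>i<n. f i = i) \<or> (\<forall>i<n. f i + i = n - 1)"
proof (cases "n < 2")
  case True
  then show ?thesis using range[of 0] by (cases n) (auto simp: less_Suc_eq)
next
  case False
  have ne: "f (Suc (Suc i)) \<noteq> f i" if "Suc (Suc i) < n" for i
    using inj_onD[OF inj, of "Suc (Suc i)" i] that by auto
  from step[of 0] False consider "f 1 = Suc (f 0)" | "f 0 = Suc (f 1)" by auto
  then show ?thesis
  proof cases
    case 1
    have "f (Suc i) = Suc (f i)" if "Suc i < n" for i
      using that
    proof (induction i)
      case (Suc i) then show ?case using step[of "Suc i"] ne[of i] by auto
    qed (use 1 in simp)
    then have step_up: "f (Suc i) = Suc (f i)" if "Suc i < n" for i using that by blast
    have up: "f i = f 0 + i" if "i < n" for i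
      using that
    proof (induction i)
      case (Suc i) then show ?case using step_up[of i] by linarith
    qed simp
    have "f (n - 1) = f 0 + (n - 1)" by (rule up) (use False in simp)
    moreover have "f (n - 1) < n" by (rule range) (use False in simp)
    ultimately have "f 0 = 0" by linarith
    then have "f i = i" if "i < n" for i using up[OF that] by linarith
    then show ?thesis by blast
  next
    case 2
    have dn: "f i = Suc (f (Suc i))" if "Suc i < n" for i
      using that
    proof (induction i)
      case (Suc i) then show ?case using step[of "Suc i"] ne[of i] by auto
    qed (use 2 in simp)
    have down: "f i + i = f 0" if "i < n" for i
      using that
    proof (induction i)
      case (Suc i) then show ?case using dn[of i] by simp
    qed simp
    have "f (n - 1) + (n - 1) = f 0" by (rule down) (use False in simp)
    moreover have "f 0 < n" by (rule range) (use False in simp)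
    ultimately have "f 0 = n - 1" by linarith
    then have "f i + i = n - 1" if "i < n" for i using down[OF that] by linarith
    then show ?thesis by blast
  qed
qed

context string_roots
begin

lemma finite_flag_orbit: "finite ((\<lambda>g. g (\<Sum>j<n. w j)) ` G)"
proof -
  let ?O = "\<lambda>j. (\<lambda>g. g (w j)) ` G"
  have "(\<lambda>g. g (\<Sum>j<n. w j)) ` G \<subseteq> (\<lambda>f. \<Sum>j<n. f j) ` (Pi\<^sub>E {..<n} ?O)"
  proof
    fix y assume "y \<in> (\<lambda>g. g (\<Sum>j<n. w j)) ` G"
    then obtain g where g: "g \<in> G" "y = g (\<Sum>j<n. w j)" by blast
    have "linear g" using orth[OF g(1)] by (simp add: orthogonal_transformation_def)
    then have "y = (\<Sum>j<n. (\<lambda>j\<in>{..<n}. g (w j)) j)" using g(2) by (simp add: linear_sum)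
    moreover have "(\<lambda>j\<in>{..<n}. g (w j)) \<in> Pi\<^sub>E {..<n} ?O" using g(1) by auto
    ultimately show "y \<in> (\<lambda>f. \<Sum>j<n. f j) ` (Pi\<^sub>E {..<n} ?O)" by (rule image_eqI)
  qed
  moreover have "finite (Pi\<^sub>E {..<n} ?O)" using finite_orbit by (intro finite_PiE) auto
  ultimately show ?thesis using finite_surj by blast
qed

lemma inner_orth: "g \<in> G \<Longrightarrow> g x \<bullet> g y = x \<bullet> y"
  and linear_G: "g \<in> G \<Longrightarrow> linear g"
  using orth by (auto simp: orthogonal_transformation_def)

lemma \<alpha>_nz: "i < n \<Longrightarrow> \<alpha> i \<noteq> 0"
  using unit by force

lemma dual_sum_w: "i < n \<Longrightarrow> \<alpha> i \<bullet> (\<Sum>j<n. w j) = \<alpha> i \<bullet> w i"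
  using dual_bases.sum_dual[OF dual_swap, of i "\<lambda>_. 1"] by (simp add: inner_commute)

text \<open>Among the finitely many images of the cone's interior point v = w 0 + ... + w (n - 1) choose the
  one, g v, with the least inner product with v. A reflection in a wall cannot decrease it
  further, so g v has nonpositive inner product with all \<alpha> i, and the inverse of g sends
  every simple root to a negative one.\<close>

lemma longest_element:
  obtains h where "h \<in> G" "\<And>i j. i < n \<Longrightarrow> j < n \<Longrightarrow> h (\<alpha> i) \<bullet> w j \<le> 0"
proof (cases "n = 0")
  case True
  then show ?thesis using dim by simp
next
  case False
  define v where "v = (\<Sum>j<n. w j)"
  define X where "X = (\<lambda>g. g v \<bullet> v) ` G"
  have "X = (\<lambda>x. x \<bullet> v) ` ((\<lambda>g. g v) ` G)" by (auto simp: X_def)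
  then have fin: "finite X" using finite_flag_orbit by (simp add: v_def)
  have "reflect (\<alpha> 0) \<in> G" using False refl by simp
  then have "X \<noteq> {}" by (auto simp: X_def)
  then have "Min X \<in> X" using fin by simp
  then obtain g where g: "g \<in> G" "g v \<bullet> v = Min X" by (auto simp: X_def)
  have min: "g v \<bullet> v \<le> g' v \<bullet> v" if "g' \<in> G" for g'
    unfolding g(2) using fin that by (intro Min_le) (auto simp: X_def)
  have le: "g v \<bullet> \<alpha> i \<le> 0" if i: "i < n" for i
  proof -
    have "g v \<bullet> v \<le> (reflect (\<alpha> i) \<circ> g) v \<bullet> v" using min comp refl i g by blast
    then have "2 * (g v \<bullet> \<alpha> i) * (\<alpha> i \<bullet> v) \<le> 0"
      by (simp add: reflect_unit[OF unit[OF i]] inner_diff_left)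
    moreover have "0 < \<alpha> i \<bullet> v" using dual_sum_w[OF i] dual_pos[OF i] by (simp add: v_def)
    ultimately show ?thesis by (simp add: mult_le_0_iff)
  qed
  obtain h where h: "h \<in> G" "\<And>x. h (g x) = x" "\<And>x. g (h x) = x" using inverse[OF g(1)] by blast
  have "h (\<alpha> i) \<bullet> w j \<le> 0" if ij: "i < n" "j < n" for i j
  proof (cases "\<forall>j<n. h (\<alpha> i) \<bullet> w j \<le> 0")
    case False
    then have nn: "\<And>j. j < n \<Longrightarrow> 0 \<le> h (\<alpha> i) \<bullet> w j" using sign[OF h(1) ij(1)] by blast
    have "h (\<alpha> i) \<bullet> v = \<alpha> i \<bullet> g v" using inner_orth[OF g(1), of "h (\<alpha> i)" v] h by simp
    then have "(\<Sum>j<n. h (\<alpha> i) \<bullet> w j) \<le> 0" using le[OF ij(1)] by (simp add: v_def inner_sum_right inner_commute)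
    moreover have "0 \<le> (\<Sum>j<n. h (\<alpha> i) \<bullet> w j)" using nn by (intro sum_nonneg) auto
    ultimately have "(\<Sum>j<n. h (\<alpha> i) \<bullet> w j) = 0" by simp
    then have "\<forall>j\<in>{..<n}. h (\<alpha> i) \<bullet> w j = 0" using nn by (subst (asm) sum_nonneg_eq_0_iff) auto
    then show ?thesis using ij by simp
  qed (use ij in auto)
  then show ?thesis using that h(1) by blast
qed

text \<open>Both h and its inverse have, up to sign, matrices with nonnegative entries in the basis
  \<alpha>. Two nonnegative matrices that are inverse to each other have exactly one nonzero entry
  in each row, and that entry is 1 here because all the roots are unit vectors.\<close>

lemma longest_element_permutes:
  assumes h: "h \<in> G" and neg: "\<And>i j. i < n \<Longrightarrow> j < n \<Longrightarrow> h (\<alpha> i) \<bullet> w j \<le> 0" and i: "i < n"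
  shows "\<exists>j<n. h (\<alpha> j) = - \<alpha> i"
proof -
  obtain k where k: "k \<in> G" "\<And>x. k (h x) = x" "\<And>x. h (k x) = x" using inverse[OF h] by blast
  define b where "b j = (k (\<alpha> i) \<bullet> w j) / (\<alpha> j \<bullet> w j)" for j
  have kex: "k (\<alpha> i) = (\<Sum>j<n. b j *\<^sub>R \<alpha> j)" unfolding b_def by (rule expansion)
  have "\<alpha> i = h (k (\<alpha> i))" using k by simp
  also have "\<dots> = (\<Sum>j<n. b j *\<^sub>R h (\<alpha> j))"
    by (subst kex) (simp add: linear_sum[OF linear_G[OF h]] linear_scale[OF linear_G[OF h]])
  finally have hex: "\<alpha> i = (\<Sum>j<n. b j *\<^sub>R h (\<alpha> j))" .
  have ex: "\<alpha> i \<bullet> w m = (\<Sum>j<n. b j * (h (\<alpha> j) \<bullet> w m))" for m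
    by (subst hex) (simp add: inner_sum_left)
  have bsign: "b j \<le> 0" if j: "j < n" for j
  proof (cases "\<forall>j<n. k (\<alpha> i) \<bullet> w j \<le> 0")
    case True
    then show ?thesis using j dual_pos[OF j] by (simp add: b_def divide_le_0_iff)
  next
    case False
    then have "0 \<le> b j" if "j < n" for j
      using sign[OF k(1) i] dual_pos that by (auto simp: b_def intro!: divide_nonneg_pos)
    then have "(\<Sum>j<n. b j * (h (\<alpha> j) \<bullet> w i)) \<le> 0"
      using neg i by (intro sum_nonpos mult_nonneg_nonpos) auto
    then show ?thesis using ex[of i] dual_pos[OF i] by simp
  qed
  have "\<exists>j<n. b j \<noteq> 0"
  proof (rule ccontr)
    assume "\<not> ?thesis"
    then have "k (\<alpha> i) = 0" using kex by simp
    then have "\<alpha> i = 0" using k(3)[of "\<alpha> i"] linear_0[OF linear_G[OF h]] by simp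
    then show False using \<alpha>_nz i by simp
  qed
  then obtain j where j: "j < n" "b j \<noteq> 0" by blast
  have zero: "h (\<alpha> j) \<bullet> w m = 0" if m: "m < n" "m \<noteq> i" for m
  proof -
    have "(\<Sum>j<n. b j * (h (\<alpha> j) \<bullet> w m)) = 0" using ex[of m] dual[OF i m(1)] m(2) by simp
    moreover have "0 \<le> b j * (h (\<alpha> j) \<bullet> w m)" if "j \<in> {..<n}" for j
      using bsign neg m that by (intro mult_nonpos_nonpos) auto
    ultimately have "b j * (h (\<alpha> j) \<bullet> w m) = 0"
      using j(1) by (subst (asm) sum_nonneg_eq_0_iff) auto
    then show ?thesis using j by simp
  qed
  define t where "t = (h (\<alpha> j) \<bullet> w i) / (\<alpha> i \<bullet> w i)"
  have "h (\<alpha> j) = (\<Sum>m<n. ((h (\<alpha> j) \<bullet> w m) / (\<alpha> m \<bullet> w m)) *\<^sub>R \<alpha> m)" by (rule expansion)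
  also have "\<dots> = (\<Sum>m<n. if m = i then t *\<^sub>R \<alpha> i else 0)"
    by (intro sum.cong) (auto simp: zero t_def)
  finally have hj: "h (\<alpha> j) = t *\<^sub>R \<alpha> i" using i by simp
  have "t \<le> 0" using neg[OF j(1) i] dual_pos[OF i] by (simp add: t_def divide_le_0_iff)
  moreover have "norm (h (\<alpha> j)) = 1"
    using inner_orth[OF h, of "\<alpha> j" "\<alpha> j"] unit[OF j(1)] by (simp add: norm_eq_1)
  then have "\<bar>t\<bar> = 1" using hj unit[OF i] by simp
  ultimately have "t = -1" by simp
  then show ?thesis using hj j(1) by auto
qed

lemma linear_determined:
  assumes "linear f" "\<And>i. i < n \<Longrightarrow> f (\<alpha> i) = - \<alpha> i" shows "f = uminus"
proof
  fix x
  have "f x = (\<Sum>i<n. ((x \<bullet> w i) / (\<alpha> i \<bullet> w i)) *\<^sub>R f (\<alpha> i))"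
    by (subst expansion[of x]) (simp add: linear_sum[OF assms(1)] linear_scale[OF assms(1)])
  also have "\<dots> = - (\<Sum>i<n. ((x \<bullet> w i) / (\<alpha> i \<bullet> w i)) *\<^sub>R \<alpha> i)"
    using assms(2) by (simp add: sum_negf)
  finally show "f x = - x" using expansion[of x] by simp
qed

text \<open>The longest element induces, up to sign, an automorphism of the Coxeter diagram. If it is the
  identity, the longest element is the antipodal map; if it is the reversal, the diagram is a
  palindrome.\<close>

lemma antipodal_or_palindrome:
  "uminus \<in> G \<or> (\<forall>i j. i < n \<longrightarrow> j < n \<longrightarrow> \<alpha> (n - 1 - i) \<bullet> \<alpha> (n - 1 - j) = \<alpha> i \<bullet> \<alpha> j)"
proof -
  obtain h where h: "h \<in> G" "\<And>i j. i < n \<Longrightarrow> j < n \<Longrightarrow> h (\<alpha> i) \<bullet> w j \<le> 0" by (rule longest_element) blast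
  then have "\<forall>i\<in>{..<n}. \<exists>j<n. h (\<alpha> j) = - \<alpha> i" using longest_element_permutes by simp
  then obtain p where p: "\<And>i. i < n \<Longrightarrow> p i < n" "\<And>i. i < n \<Longrightarrow> h (\<alpha> (p i)) = - \<alpha> i"
    by (metis lessThan_iff)
  have gram: "\<alpha> (p i) \<bullet> \<alpha> (p j) = \<alpha> i \<bullet> \<alpha> j" if "i < n" "j < n" for i j
    using inner_orth[OF h(1), of "\<alpha> (p i)" "\<alpha> (p j)"] p(2) that by simp
  have inj\<alpha>: "i = j" if "\<alpha> i = \<alpha> j" "i < n" "j < n" for i j
    using dual[of i j] dual_pos[of j] that by force
  have inj: "inj_on p {..<n}"
  proof (rule inj_onI)
    fix i j assume "i \<in> {..<n}" "j \<in> {..<n}" "p i = p j"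
    then show "i = j" using p(2)[of i] p(2)[of j] inj\<alpha> by simp
  qed
  have step: "p (Suc i) = Suc (p i) \<or> p i = Suc (p (Suc i))" if i: "Suc i < n" for i
  proof -
    have ne: "p (Suc i) \<noteq> p i" using inj_onD[OF inj, of "Suc i" i] i by auto
    have "\<alpha> (p i) \<bullet> \<alpha> (p (Suc i)) \<noteq> 0" using gram[of i "Suc i"] linked i by simp
    then have "\<not> p i + 2 \<le> p (Suc i)" "\<not> p (Suc i) + 2 \<le> p i"
      using far[of "p i" "p (Suc i)"] far[of "p (Suc i)" "p i"] p(1) i by (auto simp: inner_commute)
    then show ?thesis using ne by linarith
  qed
  from path_automorphism[OF p(1) inj step] consider "\<forall>i<n. p i = i" | "\<forall>i<n. p i + i = n - 1" by blast
  then show ?thesis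
  proof cases
    case 1
    then have "h = uminus" using linear_determined[OF linear_G[OF h(1)]] p(2) by simp
    then show ?thesis using h(1) by simp
  next
    case 2
    then have "p i = n - 1 - i" if "i < n" for i using that by (metis add_diff_cancel_right')
    then show ?thesis using gram by metis
  qed
qed

definition root :: "'a \<Rightarrow> bool" where "root v \<longleftrightarrow> (\<exists>g\<in>G. \<exists>i<n. v = g (\<alpha> i))"

lemma root_image: "g \<in> G \<Longrightarrow> root v \<Longrightarrow> root (g v)"
  unfolding root_def by (metis comp comp_apply)

lemma root_\<alpha>: assumes "i < n" shows "root (\<alpha> i)"
proof -
  have "reflect (\<alpha> i) \<circ> reflect (\<alpha> i) \<in> G" using assms comp refl by blast
  moreover have "(reflect (\<alpha> i) \<circ> reflect (\<alpha> i)) (\<alpha> i) = \<alpha> i" by (simp add: reflect_reflect)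
  ultimately show ?thesis unfolding root_def using assms by metis
qed

lemma root_norm: "root v \<Longrightarrow> v \<bullet> v = 1"
  unfolding root_def using inner_orth unit norm_eq_1 by metis

lemma root_reflect_in: assumes "root v" shows "reflect v \<in> G"
proof -
  obtain g i where g: "g \<in> G" "i < n" "v = g (\<alpha> i)" using assms root_def by blast
  obtain h where h: "h \<in> G" "\<And>x. g (h x) = x" using inverse[OF g(1)] by blast
  show ?thesis unfolding g(3) reflect_conj[OF orth[OF g(1)] h(2)] using g h refl comp by blast
qed

lemma root_reflect: assumes "root u" "root v" shows "root (v - (2 * (v \<bullet> u)) *\<^sub>R u)"
proof -
  have "reflect u v = v - (2 * (v \<bullet> u)) *\<^sub>R u"
    using root_norm[OF assms(1)] by (simp add: reflect_def)
  then show ?thesis using root_image[OF root_reflect_in[OF assms(1)] assms(2)] by simp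
qed

lemma root_pair_sign:
  assumes r: "root (x *\<^sub>R \<alpha> i + y *\<^sub>R \<alpha> (Suc i))" and i: "Suc i < n"
  shows "(0 \<le> x \<and> 0 \<le> y) \<or> (x \<le> 0 \<and> y \<le> 0)"
proof -
  let ?v = "x *\<^sub>R \<alpha> i + y *\<^sub>R \<alpha> (Suc i)"
  have "?v \<bullet> w i = x * (\<alpha> i \<bullet> w i)" "?v \<bullet> w (Suc i) = y * (\<alpha> (Suc i) \<bullet> w (Suc i))"
    using dual[of i "Suc i"] dual[of "Suc i" i] i by (auto simp: inner_add_left)
  moreover have "(\<forall>j<n. 0 \<le> ?v \<bullet> w j) \<or> (\<forall>j<n. ?v \<bullet> w j \<le> 0)" using r sign unfolding root_def by metis
  moreover have "i < n" using i by simp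
  ultimately show ?thesis
    using i dual_pos[of i] dual_pos[of "Suc i"] by (metis mult_le_0_iff not_less zero_le_mult_iff)
qed

text \<open>Reflecting alternately in \<alpha> i and \<alpha> (i + 1) produces roots whose coordinates are
  polynomials in c, and the coordinates of each root have one sign. This is the part that is
  needed of the fact that c = cos (\<pi> / p) for an integer p \<ge> 3: the values for p = 3 and
  p = 4 are isolated, and the last condition excludes what lies between p = 4 and p = 5.\<close>

lemma bond_values:
  assumes i: "Suc i < n"
  defines "c \<equiv> - (\<alpha> i \<bullet> \<alpha> (Suc i))"
  shows "0 < c" "c = 1/2 \<or> 1/2 \<le> c\<^sup>2" "c = 1/2 \<or> c\<^sup>2 = 1/2 \<or> 0 \<le> 16 * (c\<^sup>2)\<^sup>2 - 12 * c\<^sup>2 + 1"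
proof -
  let ?b = "\<alpha> i" and ?g = "\<alpha> (Suc i)"
  have n: "?b \<bullet> ?b = 1" "?g \<bullet> ?g = 1" "?b \<bullet> ?g = - c" "?g \<bullet> ?b = - c"
    using unit i by (auto simp: norm_eq_1 c_def inner_commute)
  have rb: "root ?b" and rg: "root ?g" using root_\<alpha> i by auto
  \<comment> \<open>the two reflections in coordinates with respect to \<alpha> i and \<alpha> (i + 1)\<close>
  have sb: "root ((2 * c * y - x) *\<^sub>R ?b + y *\<^sub>R ?g)" if "root (x *\<^sub>R ?b + y *\<^sub>R ?g)" for x y
  proof -
    have "(x *\<^sub>R ?b + y *\<^sub>R ?g) \<bullet> ?b = x - c * y" using n by (simp add: inner_add_left)
    moreover have "x *\<^sub>R ?b + y *\<^sub>R ?g - k *\<^sub>R ?b = (x - k) *\<^sub>R ?b + y *\<^sub>R ?g" for k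
      by (simp add: scaleR_diff_left)
    moreover have "x - 2 * (x - c * y) = 2 * c * y - x" by simp
    ultimately show ?thesis using root_reflect[OF rb that] by metis
  qed
  have sg: "root (x *\<^sub>R ?b + (2 * c * x - y) *\<^sub>R ?g)" if "root (x *\<^sub>R ?b + y *\<^sub>R ?g)" for x y
  proof -
    have "(x *\<^sub>R ?b + y *\<^sub>R ?g) \<bullet> ?g = y - c * x" using n by (simp add: inner_add_left)
    moreover have "x *\<^sub>R ?b + y *\<^sub>R ?g - k *\<^sub>R ?g = x *\<^sub>R ?b + (y - k) *\<^sub>R ?g" for k
      by (simp add: scaleR_diff_left)
    moreover have "y - 2 * (y - c * x) = 2 * c * x - y" by simp
    ultimately show ?thesis using root_reflect[OF rg that] by metis
  qed
  have r1: "root ((2 * c) *\<^sub>R ?b + 1 *\<^sub>R ?g)" using sb[of 0 1] rg by simp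
  have c0: "c \<noteq> 0" using linked[OF i] by (simp add: c_def)
  show c: "0 < c" using root_pair_sign[OF r1 i] c0 by auto
  have r2: "root ((2 * c) *\<^sub>R ?b + (4 * c\<^sup>2 - 1) *\<^sub>R ?g)"
    using sg[OF r1] by (simp add: power2_eq_square)
  have c1: "0 \<le> 4 * c\<^sup>2 - 1" using root_pair_sign[OF r2 i] c by auto
  have "2 * c * (4 * c\<^sup>2 - 1) - 2 * c = 8 * c * c\<^sup>2 - 4 * c" by algebra
  then have r3: "root ((8 * c * c\<^sup>2 - 4 * c) *\<^sub>R ?b + (4 * c\<^sup>2 - 1) *\<^sub>R ?g)" using sb[OF r2] by metis
  have "2 * c * (8 * c * c\<^sup>2 - 4 * c) - (4 * c\<^sup>2 - 1) = 16 * (c\<^sup>2)\<^sup>2 - 12 * c\<^sup>2 + 1" by algebra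
  then have r4: "root ((8 * c * c\<^sup>2 - 4 * c) *\<^sub>R ?b + (16 * (c\<^sup>2)\<^sup>2 - 12 * c\<^sup>2 + 1) *\<^sub>R ?g)"
    using sg[OF r3] by metis
  have half: "c = 1/2" if "4 * c\<^sup>2 - 1 = 0"
  proof -
    have "(2 * c)\<^sup>2 = 1\<^sup>2" using that by (simp add: power_mult_distrib)
    then have "2 * c = 1" using c by (subst (asm) power2_eq_iff_nonneg) auto
    then show ?thesis by simp
  qed
  have fac: "8 * c * c\<^sup>2 - 4 * c = 8 * c * (c\<^sup>2 - 1/2)" by (simp add: algebra_simps)
  show two: "c = 1/2 \<or> 1/2 \<le> c\<^sup>2"
  proof (cases "4 * c\<^sup>2 - 1 = 0")
    case False
    then have "0 \<le> 8 * c * (c\<^sup>2 - 1/2)" using root_pair_sign[OF r3 i] c1 unfolding fac by linarith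
    then show ?thesis using c by (simp add: zero_le_mult_iff)
  qed (use half in simp)
  show "c = 1/2 \<or> c\<^sup>2 = 1/2 \<or> 0 \<le> 16 * (c\<^sup>2)\<^sup>2 - 12 * c\<^sup>2 + 1"
  proof (rule ccontr)
    assume neg: "\<not> ?thesis"
    then have "0 < 8 * c * (c\<^sup>2 - 1/2)" using two c by simp
    then show False using root_pair_sign[OF r4 i] neg unfolding fac by linarith
  qed
qed

text \<open>The cosine of the dihedral angle between consecutive walls.\<close>

definition bond :: "nat \<Rightarrow> real" where "bond i = - (\<alpha> i \<bullet> \<alpha> (Suc i))"

lemma gram:
  assumes "i < n" "j < n"
  shows "\<alpha> i \<bullet> \<alpha> j = (if i = j then 1 else if j = Suc i then - bond i else if i = Suc j then - bond j else 0)"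
proof -
  consider "i = j" | "j = Suc i" | "i = Suc j" | "i + 2 \<le> j" | "j + 2 \<le> i" by linarith
  then show ?thesis
    using assms unit[of i] far[of i j] far[of j i]
    by cases (auto simp: norm_eq_1 bond_def inner_commute)
qed

lemma bond_ge_half: assumes "Suc i < n" shows "1/2 \<le> bond i"
proof -
  have "(1/2)\<^sup>2 \<le> (bond i)\<^sup>2" if "1/2 \<le> (bond i)\<^sup>2"
    using that by (simp add: power2_eq_square)
  then show ?thesis using bond_values[OF assms] unfolding bond_def[symmetric]
    by (metis less_eq_real_def power2_le_imp_le)
qed

text \<open>For two bonds at least cos (\<pi> / 4), the null vector of an affine diagram of type C, with
  coefficients 1, \<surd>2, ..., \<surd>2, 1, would have norm at most 0.\<close>

lemma large_bond_unique:
  assumes ij: "i < j" "Suc j < n" and c: "1/2 \<le> (bond i)\<^sup>2" "1/2 \<le> (bond j)\<^sup>2"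
  shows False
proof -
  define z where "z m = (\<Sum>k=Suc i..m. \<alpha> k)" for m
  have zw: "z m \<bullet> \<alpha> (Suc m) = - bond m" if "i < m" "Suc m < n" for m
  proof -
    have "z m \<bullet> \<alpha> (Suc m) = (\<Sum>k=Suc i..m. if k = m then - bond m else 0)"
      unfolding z_def inner_sum_left using that by (intro sum.cong) (auto simp: gram)
    then show ?thesis using that by simp
  qed
  have zz: "z m \<bullet> z m \<le> 1" if "Suc i \<le> m" "m < n" for m
    using that
  proof (induction m rule: dec_induct)
    case base then show ?case using gram[of "Suc i" "Suc i"] by (simp add: z_def)
  next
    case (step m)
    have z: "z (Suc m) = z m + \<alpha> (Suc m)" using step by (simp add: z_def)
    have "z (Suc m) \<bullet> z (Suc m) = z m \<bullet> z m - 2 * bond m + 1"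
      unfolding z using zw[of m] step gram[of "Suc m" "Suc m"]
      by (simp add: inner_add_left inner_add_right inner_commute)
    then show ?case using step bond_ge_half[of m] by simp
  qed
  have zi: "z j \<bullet> \<alpha> i = - bond i"
  proof -
    have "z j \<bullet> \<alpha> i = (\<Sum>k=Suc i..j. if k = Suc i then - bond i else 0)"
      unfolding z_def inner_sum_left using ij by (intro sum.cong) (auto simp: gram)
    then show ?thesis using ij by simp
  qed
  have big: "1 \<le> sqrt 2 * bond k" if "1/2 \<le> (bond k)\<^sup>2" "Suc k < n" for k
  proof (rule power2_le_imp_le)
    show "1\<^sup>2 \<le> (sqrt 2 * bond k)\<^sup>2" using that by (simp add: power_mult_distrib)
    show "0 \<le> sqrt 2 * bond k" using bond_ge_half[of k] that by simp
  qed
  define v where "v = \<alpha> i + \<alpha> (Suc j) + sqrt 2 *\<^sub>R z j"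
  have s: "\<alpha> i \<bullet> \<alpha> i = 1" "\<alpha> (Suc j) \<bullet> \<alpha> (Suc j) = 1" "\<alpha> i \<bullet> \<alpha> (Suc j) = 0"
    using ij by (auto simp: gram)
  have "v \<bullet> v = 2 + 2 * (z j \<bullet> z j) - 2 * (sqrt 2 * bond i) - 2 * (sqrt 2 * bond j)"
    unfolding v_def using s zi zw[OF ij] by (simp add: inner_add_left inner_add_right inner_commute algebra_simps)
  also have "\<dots> \<le> 0" using big[OF c(1)] big[OF c(2)] zz[of j] ij by simp
  finally have "v = 0" by (metis inner_eq_zero_iff inner_ge_zero order_antisym)
  moreover have "v \<bullet> w i = \<alpha> i \<bullet> w i"
    using ij dual by (simp add: v_def z_def inner_add_left inner_sum_left)
  ultimately show False using dual_pos[of i] ij by simp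
qed

text \<open>The exceptional palindrome, the symmetry group of the 24-cell. Four of its roots are mutually
  orthogonal, and the product of the reflections in an orthogonal basis is the antipodal map.\<close>

lemma F4_antipodal:
  assumes n: "n = 4" and b: "bond 0 = 1/2" "(bond 1)\<^sup>2 = 1/2" "bond 2 = 1/2"
  shows "uminus \<in> G"
proof -
  define q where "q = 2 * bond 1"
  have qq: "q * q = 2" "q \<noteq> 0" using b(2) by (auto simp: q_def power2_eq_square)
  have r: "root (\<alpha> 0)" "root (\<alpha> 1)" "root (\<alpha> 2)" "root (\<alpha> 3)" using n root_\<alpha> by auto
  have "bond 1 = q / 2" by (simp add: q_def)
  then have g: "\<alpha> 0 \<bullet> \<alpha> 0 = 1" "\<alpha> 1 \<bullet> \<alpha> 1 = 1" "\<alpha> 2 \<bullet> \<alpha> 2 = 1" "\<alpha> 3 \<bullet> \<alpha> 3 = 1"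
    "\<alpha> 0 \<bullet> \<alpha> 1 = -1/2" "\<alpha> 1 \<bullet> \<alpha> 2 = - q / 2" "\<alpha> 2 \<bullet> \<alpha> 3 = -1/2"
    "\<alpha> 1 \<bullet> \<alpha> 0 = -1/2" "\<alpha> 2 \<bullet> \<alpha> 1 = - q / 2" "\<alpha> 3 \<bullet> \<alpha> 2 = -1/2"
    "\<alpha> 0 \<bullet> \<alpha> 2 = 0" "\<alpha> 0 \<bullet> \<alpha> 3 = 0" "\<alpha> 1 \<bullet> \<alpha> 3 = 0"
    "\<alpha> 2 \<bullet> \<alpha> 0 = 0" "\<alpha> 3 \<bullet> \<alpha> 0 = 0" "\<alpha> 3 \<bullet> \<alpha> 1 = 0"
    using n b by (auto simp: gram numeral_3_eq_3 numeral_2_eq_2)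
  note ip = inner_add_left inner_add_right inner_diff_left inner_diff_right
  \<comment> \<open>Realise \<alpha> 0, ..., \<alpha> 3 as (e2 - e3) / q, (e3 - e4) / q, e4 and
      (e1 - e2 - e3 - e4) / 2 with q = \<surd>2; then the standard basis vectors e1, ..., e4 are
      roots.\<close>
  define e4 where "e4 = \<alpha> 2"
  define e3 where "e3 = \<alpha> 2 + q *\<^sub>R \<alpha> 1"
  define e2 where "e2 = e3 + q *\<^sub>R \<alpha> 0"
  define e1 where "e1 = 2 *\<^sub>R \<alpha> 3 + e2 + e3 + e4"
  have r4: "root e4" using r by (simp add: e4_def)
  have r3: "root e3" using root_reflect[OF r(2) r(3)] g by (simp add: e3_def)
  have r2: "root e2" using root_reflect[OF r(1) r3] g by (simp add: e2_def e3_def ip)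
  have o: "e4 \<bullet> e4 = 1" "e3 \<bullet> e3 = 1" "e2 \<bullet> e2 = 1"
    "e3 \<bullet> e4 = 0" "e2 \<bullet> e4 = 0" "e2 \<bullet> e3 = 0" "e4 \<bullet> e3 = 0" "e4 \<bullet> e2 = 0" "e3 \<bullet> e2 = 0"
    "\<alpha> 3 \<bullet> e4 = -1/2" "\<alpha> 3 \<bullet> e3 = -1/2" "\<alpha> 3 \<bullet> e2 = -1/2"
    "e4 \<bullet> \<alpha> 3 = -1/2" "e3 \<bullet> \<alpha> 3 = -1/2" "e2 \<bullet> \<alpha> 3 = -1/2"
    using g qq by (auto simp: e2_def e3_def e4_def ip algebra_simps)
  have "root (\<alpha> 3 + e4)" using root_reflect[OF r4 r(4)] o by simp
  then have "root (\<alpha> 3 + e4 + e3)" using root_reflect[OF r3, of "\<alpha> 3 + e4"] o by (simp add: ip)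
  then have "root (\<alpha> 3 + e4 + e3 + e2)" using root_reflect[OF r2, of "\<alpha> 3 + e4 + e3"] o by (simp add: ip)
  from root_reflect[OF r(4) this] have "root (\<alpha> 3 + e4 + e3 + e2 + \<alpha> 3)" using o g by (simp add: ip)
  moreover have "\<alpha> 3 + e4 + e3 + e2 + \<alpha> 3 = e1" by (simp add: e1_def scaleR_2)
  ultimately have r1: "root e1" by simp
  have o1: "e1 \<bullet> e2 = 0" "e1 \<bullet> e3 = 0" "e1 \<bullet> e4 = 0" using o by (auto simp: e1_def ip)
  have refl_e: "reflect e x = x - (2 * (x \<bullet> e)) *\<^sub>R e" if "root e" for e x
    using root_norm[OF that] by (simp add: reflect_def)
  define h where "h = reflect e1 \<circ> reflect e2 \<circ> reflect e3 \<circ> reflect e4"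
  have hG: "h \<in> G" unfolding h_def using r1 r2 r3 r4 root_reflect_in comp by simp
  have hx: "h x = x - (2 * (x \<bullet> e4)) *\<^sub>R e4 - (2 * (x \<bullet> e3)) *\<^sub>R e3 - (2 * (x \<bullet> e2)) *\<^sub>R e2 - (2 * (x \<bullet> e1)) *\<^sub>R e1" for x
    using o o1 by (simp add: h_def refl_e r1 r2 r3 r4 ip inner_commute)
  have he: "h e4 = - e4" "h e3 = - e3" "h e2 = - e2" "h e1 = - e1"
    using o o1 root_norm[OF r1] by (auto simp: hx inner_commute scaleR_2)
  have lh: "linear h" using linear_G[OF hG] .
  have "h (\<alpha> i) = - \<alpha> i" if "i < n" for i
  proof -
    have "\<alpha> 1 = (1 / q) *\<^sub>R (e3 - e4)" "\<alpha> 0 = (1 / q) *\<^sub>R (e2 - e3)"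
      "\<alpha> 3 = (1 / 2) *\<^sub>R (e1 - e2 - e3 - e4)"
      using qq by (auto simp: e1_def e2_def e3_def e4_def)
    then have "h (\<alpha> 0) = - \<alpha> 0" "h (\<alpha> 1) = - \<alpha> 1" "h (\<alpha> 3) = - \<alpha> 3"
      using he by (auto simp: linear_scale[OF lh] linear_diff[OF lh] scaleR_minus_right[symmetric] simp del: scaleR_minus_right)
    moreover have "h (\<alpha> 2) = - \<alpha> 2" using he by (simp add: e4_def)
    moreover have "i = 0 \<or> i = 1 \<or> i = 2 \<or> i = 3" using that n by auto
    ultimately show ?thesis by auto
  qed
  then have "h = uminus" using linear_determined[OF lh] by blast
  then show ?thesis using hG by simp
qed

text \<open>In a palindromic diagram a bond other than 1/2 is unique and therefore sits in the middle.
  Positive definiteness leaves room for it only in rank 4, where it is the bond of the 24-cell.\<close>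

theorem antipodal_or_simplex:
  assumes n3: "3 \<le> n" and no: "uminus \<notin> G"
  shows "\<And>i. Suc i < n \<Longrightarrow> \<alpha> i \<bullet> \<alpha> (Suc i) = - 1/2"
proof (rule ccontr)
  fix i assume i: "Suc i < n" and "\<alpha> i \<bullet> \<alpha> (Suc i) \<noteq> - 1/2"
  then have nh: "bond i \<noteq> 1/2" by (auto simp: bond_def)
  have large: "1/2 \<le> (bond k)\<^sup>2" if "Suc k < n" "bond k \<noteq> 1/2" for k
    using bond_values(2)[OF that(1)] that(2) unfolding bond_def by auto
  have "bond (n - 2 - i) = bond i"
  proof -
    have "\<alpha> (n - 1 - i) \<bullet> \<alpha> (n - 1 - Suc i) = \<alpha> i \<bullet> \<alpha> (Suc i)"
      using antipodal_or_palindrome no i by (metis Suc_lessD)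
    moreover have "n - 1 - i = Suc (n - 2 - i)" "n - 1 - Suc i = n - 2 - i" using i by auto
    ultimately show ?thesis by (simp add: bond_def inner_commute)
  qed
  then have bj: "1/2 \<le> (bond (n - 2 - i))\<^sup>2" using large[OF i nh] by simp
  have "n - 2 - i = i"
  proof (rule ccontr)
    assume "n - 2 - i \<noteq> i"
    then consider "i < n - 2 - i" | "n - 2 - i < i" by linarith
    moreover have "Suc (n - 2 - i) < n" using i by arith
    ultimately show False
      using large_bond_unique[of i "n - 2 - i"] large_bond_unique[of "n - 2 - i" i] large[OF i nh] bj i
      by cases auto
  qed
  then have ni: "n = 2 * i + 2" using i by linarith
  have half: "bond k = 1/2" if "Suc k < n" "k \<noteq> i" for k
    using large_bond_unique[of i k] large_bond_unique[of k i] large[OF i nh] large[of k] that i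
    by (metis linorder_neqE_nat)
  define b where "b = bond i"
  have b: "0 < b" "1/2 \<le> b\<^sup>2" using bond_values(1)[OF i] large[OF i nh] by (auto simp: b_def bond_def)
  have bl: "2/3 < b"
    by (rule power2_less_imp_less) (use b in \<open>auto simp: power2_eq_square\<close>)
  show False
  proof (cases "i = 1")
    case True
    then have n: "n = 4" using ni by simp
    have hb: "bond 0 = 1/2" "bond 2 = 1/2" "bond 1 = b" using half[of 0] half[of 2] n True by (auto simp: b_def)
    \<comment> \<open>a vector whose norm would not be positive for b \<ge> 3/4\<close>
    define v where "v = \<alpha> 0 + 2 *\<^sub>R \<alpha> 1 + 2 *\<^sub>R \<alpha> 2 + \<alpha> 3"
    have "v \<bullet> w 0 = \<alpha> 0 \<bullet> w 0" using dual n by (simp add: v_def inner_add_left)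
    then have "v \<noteq> 0" using dual_pos[of 0] n by auto
    then have "0 < v \<bullet> v" by simp
    moreover have "v \<bullet> v = 6 - 8 * b"
      using n hb by (simp add: v_def inner_add_left inner_add_right gram numeral_3_eq_3 numeral_2_eq_2)
    ultimately have "b < 3/4" by simp
    then have "b\<^sup>2 < (3/4)\<^sup>2" using b by (intro power_strict_mono) auto
    then have b2: "b\<^sup>2 < 9/16" by (simp add: power2_eq_square)
    have "b\<^sup>2 = 1/2"
    proof (rule ccontr)
      assume "b\<^sup>2 \<noteq> 1/2"
      then have "1/2 < b\<^sup>2" using b by simp
      have "0 \<le> 16 * (b\<^sup>2)\<^sup>2 - 12 * b\<^sup>2 + 1"
        using bond_values(3)[OF i] nh \<open>b\<^sup>2 \<noteq> 1/2\<close> by (simp add: b_def bond_def)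
      have "0 < (b\<^sup>2 - 1/2) * (9/16 - b\<^sup>2)" using \<open>1/2 < b\<^sup>2\<close> b2 by simp
      moreover have "(t - 1/2) * (9/16 - t) = (17 * t - 9/2 - 16 * t\<^sup>2) / 16" for t :: real
        by (simp add: field_simps power2_eq_square)
      ultimately have "0 < 17 * b\<^sup>2 - 9/2 - 16 * (b\<^sup>2)\<^sup>2" by simp
      then show False using \<open>0 \<le> 16 * (b\<^sup>2)\<^sup>2 - 12 * b\<^sup>2 + 1\<close> b2 by linarith
    qed
    then show False using F4_antipodal[OF n hb(1) _ hb(2)] hb(3) no by simp
  next
    case False
    then have "2 \<le> i" using ni n3 by simp
    then obtain m where m: "i = m + 2" by (metis add.commute le_Suc_ex)
    have n6: "m + 6 \<le> n" using ni m by simp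
    define a where "a k = \<alpha> (m + k)" for k
    have hb: "bond m = 1/2" "bond (m + 1) = 1/2" "bond (m + 2) = b" "bond (m + 3) = 1/2" "bond (m + 4) = 1/2"
      using half n6 m by (auto simp: b_def)
    have ga: "a j \<bullet> a k = (if j = k then 1 else if k = Suc j then - bond (m + j) else if j = Suc k then - bond (m + k) else 0)"
      if "j < 6" "k < 6" for j k
      using gram[of "m + j" "m + k"] that n6 by (simp add: a_def)
    \<comment> \<open>The middle bond with two bonds 1/2 on either side is less than 2/3, by the norm of this
        vector.\<close>
    define v where "v = a 0 + 2 *\<^sub>R a 1 + 3 *\<^sub>R a 2 + 3 *\<^sub>R a 3 + 2 *\<^sub>R a 4 + a 5"
    have "v \<bullet> w m = \<alpha> m \<bullet> w m" using dual n6 by (simp add: v_def a_def inner_add_left)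
    then have "v \<noteq> 0" using dual_pos[of m] n6 by auto
    then have "0 < v \<bullet> v" by simp
    moreover have "v \<bullet> v = 12 - 18 * b"
      unfolding v_def inner_add_left inner_add_right inner_scaleR_left inner_scaleR_right
      using hb by (simp add: ga)
    ultimately have "b < 2/3" by simp
    then show False using bl by simp
  qed
qed

end

section \<open>Distances between unit vectors\<close>

text \<open>The orbits of a fixed point free involution are pairs.\<close>

lemma even_card_involution:
  assumes "finite A" "\<And>x. x \<in> A \<Longrightarrow> f x \<in> A" "\<And>x. x \<in> A \<Longrightarrow> f (f x) = x" "\<And>x. x \<in> A \<Longrightarrow> f x \<noteq> x"
  shows "even (card A)"
  using assms
proof (induction "card A" arbitrary: A rule: less_induct)
  case less
  show ?case
  proof (cases "A = {}")
    case False
    then obtain x where x: "x \<in> A" by blast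
    let ?B = "A - {x, f x}"
    have sub: "{x, f x} \<subseteq> A" using x less.prems by auto
    have two: "card {x, f x} = 2" using less.prems(4)[OF x] by auto
    have card: "card A = card ?B + 2"
      using card_Diff_subset[of "{x, f x}" A] sub two card_mono[OF less.prems(1) sub] by simp
    have "even (card ?B)"
    proof (rule less.hyps)
      show "card ?B < card A" using card by simp
      fix y assume y: "y \<in> ?B"
      show "f y \<in> ?B"
        using y less.prems(2)[of y] less.prems(3)[of y] less.prems(3)[OF x] by auto
    qed (use less.prems in auto)
    then show ?thesis using card by simp
  qed simp
qed

lemma sum_symmetric_set:
  fixes A :: "real set"
  assumes "\<And>x. x \<in> A \<Longrightarrow> - x \<in> A" shows "\<Sum>A = 0"
proof -
  have "uminus ` A = A"
  proof
    show "uminus ` A \<subseteq> A" using assms by blast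
    show "A \<subseteq> uminus ` A" using assms by (metis image_eqI minus_minus subsetI)
  qed
  moreover have "\<Sum>(uminus ` A) = (\<Sum>x\<in>A. - x)" by (subst sum.reindex) (auto simp: inj_on_def)
  ultimately have "\<Sum>A = - \<Sum>A" by (simp add: sum_negf)
  then show ?thesis by simp
qed

text \<open>For unit vectors the squared distance is 2 - 2 u \<bullet> v, so the sum over the distinct
  distances is determined by the number and the sum of the distinct inner products.\<close>

definition inner_values :: "'a::real_inner set \<Rightarrow> real set" where
  "inner_values V = {u \<bullet> v | u v. u \<in> V \<and> v \<in> V \<and> u \<noteq> v}"

definition distances :: "'a::metric_space set \<Rightarrow> real set" where
  "distances V = {dist u v | u v. u \<in> V \<and> v \<in> V \<and> u \<noteq> v}"

lemma finite_inner_values: "finite V \<Longrightarrow> finite (inner_values V)"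
proof -
  assume "finite V"
  moreover have "inner_values V \<subseteq> (\<lambda>(u, v). u \<bullet> v) ` (V \<times> V)" by (auto simp: inner_values_def)
  ultimately show ?thesis using finite_surj by (metis finite_SigmaI)
qed

lemma unit_inner_le: "u \<bullet> u = 1 \<Longrightarrow> v \<bullet> v = 1 \<Longrightarrow> u \<bullet> v \<le> 1"
  for u v :: "'a::real_inner"
proof -
  assume "u \<bullet> u = 1" "v \<bullet> v = 1"
  moreover have "0 \<le> (u - v) \<bullet> (u - v)" by simp
  ultimately show ?thesis by (simp add: inner_diff_left inner_diff_right inner_commute)
qed

lemma unit_inner_eq_1: "u \<bullet> u = 1 \<Longrightarrow> v \<bullet> v = 1 \<Longrightarrow> u \<bullet> v = 1 \<Longrightarrow> u = v"
  for u v :: "'a::real_inner"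
proof -
  assume "u \<bullet> u = 1" "v \<bullet> v = 1" "u \<bullet> v = 1"
  then have "(u - v) \<bullet> (u - v) = 0" by (simp add: inner_diff_left inner_diff_right inner_commute)
  then show ?thesis by simp
qed

lemma distances_inner_values:
  assumes unit: "\<And>u. u \<in> V \<Longrightarrow> u \<bullet> u = 1"
  shows "card (distances V) = card (inner_values V)"
    "(\<Sum>t\<in>distances V. t\<^sup>2) = 2 * real (card (inner_values V)) - 2 * \<Sum>(inner_values V)"
proof -
  let ?f = "\<lambda>x. sqrt (2 - 2 * x)"
  have d: "dist u v = ?f (u \<bullet> v)" if "u \<in> V" "v \<in> V" for u v
  proof -
    have "(dist u v)\<^sup>2 = 2 - 2 * (u \<bullet> v)"
      using unit that by (simp add: dist_norm power2_norm_eq_inner inner_diff_left inner_diff_right inner_commute)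
    then show ?thesis by (metis real_sqrt_unique zero_le_dist)
  qed
  have D: "distances V = ?f ` inner_values V"
    unfolding distances_def inner_values_def using d by (force simp: image_iff)
  have le: "x \<le> 1" if "x \<in> inner_values V" for x
    using that unit unit_inner_le by (auto simp: inner_values_def)
  have inj: "inj_on ?f (inner_values V)"
    by (rule inj_onI) (simp add: real_sqrt_eq_iff)
  show "card (distances V) = card (inner_values V)" unfolding D using inj by (rule card_image)
  have "(\<Sum>t\<in>distances V. t\<^sup>2) = (\<Sum>x\<in>inner_values V. (?f x)\<^sup>2)"
    unfolding D by (simp add: sum.reindex[OF inj])
  also have "\<dots> = (\<Sum>x\<in>inner_values V. 2 - 2 * x)" using le by (intro sum.cong) auto
  finally show "(\<Sum>t\<in>distances V. t\<^sup>2) = 2 * real (card (inner_values V)) - 2 * \<Sum>(inner_values V)"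
    by (simp add: sum_subtractf sum_distrib_left)
qed

text \<open>Replacing v by -v negates the inner product, and this pairs off all the values except -1, whose
  partner 1 would belong to equal vectors. So the distinct inner products sum to -1.\<close>

lemma antipodal_distance_sum:
  assumes fin: "finite V" and unit: "\<And>u. u \<in> V \<Longrightarrow> u \<bullet> u = 1" and anti: "\<And>u. u \<in> V \<Longrightarrow> - u \<in> V"
    and ne: "V \<noteq> {}"
  shows "(\<Sum>t\<in>distances V. t\<^sup>2) = 2 * real (card (distances V)) + 2"
proof -
  let ?X = "inner_values V"
  obtain u where u: "u \<in> V" using ne by blast
  have "u \<bullet> - u = -1" using unit[OF u] by simp
  moreover have "u \<noteq> - u" using calculation unit[OF u] by (metis one_neq_neg_one)
  ultimately have m: "-1 \<in> ?X" unfolding inner_values_def using u anti[OF u] by (metis (mono_tags, lifting) mem_Collect_eq)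
  have "\<Sum>(?X - {-1}) = 0"
  proof (rule sum_symmetric_set)
    fix x assume "x \<in> ?X - {-1}"
    then obtain a b where ab: "x = a \<bullet> b" "a \<in> V" "b \<in> V" "a \<noteq> b" "x \<noteq> -1" by (auto simp: inner_values_def)
    have "x \<noteq> 1" using unit_inner_eq_1[of a b] unit ab by auto
    have "a \<noteq> - b" using unit ab by auto
    moreover have "- x = a \<bullet> - b" using ab by simp
    ultimately have "- x \<in> ?X" using ab(2) anti[OF ab(3)] unfolding inner_values_def by blast
    then show "- x \<in> ?X - {-1}" using \<open>x \<noteq> 1\<close> by simp
  qed
  then have "\<Sum>?X = -1" using sum.remove[OF finite_inner_values[OF fin] m, of "\<lambda>x. x"] by simp
  then show ?thesis using distances_inner_values[OF unit] by simp
qed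

section \<open>Facet normals\<close>

text \<open>The vertices of the simplex are the points c - n u m opposite to its facets. The normals form a
  tight frame, which yields the barycentric coordinates of a point of Q; they are nonnegative by
  the inequalities that define Q.\<close>

lemma simplex_from_facet_normals:
  fixes u :: "nat \<Rightarrow> 'a::euclidean_space"
  assumes n: "1 \<le> n" and dimQ: "aff_dim Q = int n" and convex: "convex Q"
    and half: "\<And>x. x \<in> Q \<longleftrightarrow> (\<forall>m\<le>n. (x - c) \<bullet> u m \<le> 1)"
    and kk: "\<And>l m. l \<le> n \<Longrightarrow> m \<le> n \<Longrightarrow> u l \<bullet> u m = (if l = m then 1 else - 1 / real n)"
    and usum: "(\<Sum>m\<le>n. u m) = 0" and total: "\<And>z. (\<And>m. m \<le> n \<Longrightarrow> z \<bullet> u m = 0) \<Longrightarrow> z = 0"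
  shows "int n simplex Q"
proof -
  define p where "p m = c - real n *\<^sub>R u m" for m
  let ?C = "p ` {..n}"
  have "p m \<in> Q" if m: "m \<le> n" for m
    unfolding half
  proof (intro allI impI)
    fix l assume l: "l \<le> n"
    have "(p m - c) \<bullet> u l = - (real n * (u m \<bullet> u l))" by (simp add: p_def)
    also have "\<dots> \<le> 1" using kk[OF m l] n by simp
    finally show "(p m - c) \<bullet> u l \<le> 1" .
  qed
  then have sub1: "convex hull ?C \<subseteq> Q"
    using convex by (intro hull_minimal) auto
  have sub2: "Q \<subseteq> convex hull ?C"
  proof
    fix x assume x: "x \<in> Q"
    define y where "y = x - c"
    have frame: "(\<Sum>m\<le>n. (u m \<bullet> y) *\<^sub>R u m) = ((real n + 1) / real n) *\<^sub>R y"
    proof -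
      define z where "z = (\<Sum>m\<le>n. (u m \<bullet> y) *\<^sub>R u m) - ((real n + 1) / real n) *\<^sub>R y"
      have "z \<bullet> u l = 0" if l: "l \<le> n" for l
      proof -
        have "(\<Sum>m\<le>n. (u m \<bullet> y) *\<^sub>R u m) \<bullet> u l = (\<Sum>m\<le>n. (u m \<bullet> y) * (u m \<bullet> u l))"
          by (simp add: inner_sum_left)
        also have "\<dots> = (\<Sum>m\<le>n. (if m = l then (1 + 1 / real n) * (u l \<bullet> y) else 0) - 1 / real n * (u m \<bullet> y))"
          using l n by (intro sum.cong) (auto simp: kk field_simps)
        also have "\<dots> = (1 + 1 / real n) * (u l \<bullet> y) - 1 / real n * ((\<Sum>m\<le>n. u m) \<bullet> y)"
          using l by (simp add: sum_subtractf sum_distrib_left inner_sum_left)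
        finally have e: "(\<Sum>m\<le>n. (u m \<bullet> y) *\<^sub>R u m) \<bullet> u l = (1 + 1 / real n) * (u l \<bullet> y)"
          by (simp add: usum)
        have "(real n + 1) / real n = 1 + 1 / real n" using n by (simp add: field_simps)
        then show ?thesis unfolding z_def inner_diff_left inner_scaleR_left e by (simp add: inner_commute)
      qed
      then have "z = 0" by (rule total)
      then show ?thesis by (simp add: z_def)
    qed
    define t where "t m = (1 - u m \<bullet> y) / (real n + 1)" for m
    have t0: "0 \<le> t m" if "m \<le> n" for m
      using x that unfolding half t_def y_def by (auto simp: inner_commute intro!: divide_nonneg_pos)
    have "(\<Sum>m\<le>n. u m \<bullet> y) = 0" using usum by (simp add: inner_sum_left[symmetric])
    then have t1: "(\<Sum>m\<le>n. t m) = 1"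
      by (simp add: t_def sum_divide_distrib[symmetric] sum_subtractf)
    have "(\<Sum>m\<le>n. t m *\<^sub>R u m) = (1 / (real n + 1)) *\<^sub>R ((\<Sum>m\<le>n. u m) - (\<Sum>m\<le>n. (u m \<bullet> y) *\<^sub>R u m))"
      unfolding sum_subtractf[symmetric] scaleR_sum_right
      by (intro sum.cong) (auto simp: t_def algebra_simps divide_inverse)
    also have "\<dots> = - ((1 / (real n + 1)) * ((real n + 1) / real n)) *\<^sub>R y" unfolding frame usum by simp
    also have "(1 / (real n + 1)) * ((real n + 1) / real n) = 1 / real n" by simp
    finally have tu: "(\<Sum>m\<le>n. t m *\<^sub>R u m) = - (1 / real n) *\<^sub>R y" .
    have "(\<Sum>m\<le>n. t m *\<^sub>R p m) = (\<Sum>m\<le>n. t m) *\<^sub>R c - real n *\<^sub>R (\<Sum>m\<le>n. t m *\<^sub>R u m)"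
      by (simp add: p_def scaleR_diff_right sum_subtractf scaleR_sum_left scaleR_sum_right mult.commute)
    also have "\<dots> = x" unfolding tu t1 using n by (simp add: y_def)
    finally have xs: "(\<Sum>m\<le>n. t m *\<^sub>R p m) = x" .
    have "(\<Sum>m\<le>n. t m *\<^sub>R p m) \<in> convex hull ?C"
      using t0 t1 by (intro convex_sum) (auto intro: hull_inc)
    then show "x \<in> convex hull ?C" using xs by simp
  qed
  have hull: "Q = convex hull ?C" using sub1 sub2 by blast
  have fin: "finite ?C" by simp
  have d: "aff_dim ?C = int n" using hull dimQ aff_dim_convex_hull by metis
  have "card ?C \<le> n + 1" using card_image_le[of "{..n}" p] by simp
  moreover have "aff_dim ?C \<le> int (card ?C) - 1" using aff_dim_le_card[OF fin] by simp
  ultimately have cc: "int (card ?C) = int n + 1" using d by linarith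
  then have "\<not> affine_dependent ?C" using fin d by (simp add: affine_independent_iff_card)
  then show ?thesis unfolding simplex_def using cc hull by blast
qed

locale unit_flag = flag Q c \<rho> n F
  for Q :: "'a::euclidean_space set" and c \<rho> n F +
  assumes unit_facet: "\<And>F. F facet_of Q \<Longrightarrow> norm (face_center F - c) = 1"
begin

lemma tang: "tangential Q c 1"
proof -
  have "balanced TYPE('a) (aff_dim Q - 1)" using n dimQ by (intro balanced) simp
  then have t: "tangential Q c (\<rho> (aff_dim Q - 1))"
    using balanced_tangential[OF _ Q] n dimQ by simp
  obtain G where "G facet_of Q" using polytope_facet_exists[OF poly] dimQ n by auto
  then have "\<rho> (aff_dim Q - 1) = 1" using tangentialD(4)[OF t] unit_facet by simp
  then show ?thesis using t by simp
qed

definition V :: "'a set" where "V = (\<lambda>F. face_center F - c) ` {F. F facet_of Q}"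

lemma V_finite: "finite V"
  unfolding V_def using finite_polytope_facets[OF poly] by simp

lemma V_unit: "u \<in> V \<Longrightarrow> u \<bullet> u = 1"
  unfolding V_def using unit_facet norm_eq_1 by auto

lemma affQ: "affine hull Q = UNIV"
  using dimQ full aff_dim_eq_full by metis

lemma top_facet: "F (n - 1) facet_of Q"
  using chain[of "n - 1"] n top by simp

lemma w_top: "w (n - 1) \<in> V"
  unfolding V_def w_def using top_facet by blast

lemma V_symmetry: assumes g: "g \<in> symmetries Q c" and u: "u \<in> V" shows "g u \<in> V"
proof -
  obtain H where H: "H facet_of Q" "u = face_center H - c" using u V_def by auto
  then have "H face_of Q" "H \<noteq> {}" by (auto simp: facet_of_def)
  note s = symmetry_face_center[OF g poly this]
  have "(\<lambda>x. c + g (x - c)) ` H facet_of Q" using s H(1) by (auto simp: facet_of_def)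
  then show ?thesis unfolding V_def H(2) s(2)[symmetric] by blast
qed

lemma V_inj: "inj_on (\<lambda>F. face_center F - c) {F. F facet_of Q}"
  using face_center_inj[OF poly] by (auto simp: inj_on_def facet_of_def)

lemma distances_V: "distances V = facet_center_distances Q"
proof -
  have ne: "face_center F \<noteq> face_center G \<longleftrightarrow> F \<noteq> G" if "F facet_of Q" "G facet_of Q" for F G
    using inj_on_eq_iff[OF V_inj, of F G] that by simp
  have "distances V = {dist (face_center F - c) (face_center G - c) | F G.
      F facet_of Q \<and> G facet_of Q \<and> face_center F - c \<noteq> face_center G - c}"
    unfolding distances_def V_def by blast
  also have "\<dots> = facet_center_distances Q"
    unfolding facet_center_distances_def
    using ne by (intro Collect_cong ex_cong1) (simp add: dist_norm, metis)
  finally show ?thesis .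
qed

text \<open>If the facet normal u lies in the closed flag cone, the ray from c along u leaves the polytope
  through the facet F (n - 1) of the flag at distance at most 1. Hence its inner product with the
  normal of F (n - 1) is at least 1, and unit vectors with this property are equal.\<close>

lemma chamber_normal:
  assumes u: "u \<in> V" and dom: "\<And>i. i < n \<Longrightarrow> 0 \<le> u \<bullet> \<alpha> i"
  shows "u = w (n - 1)"
proof -
  define t where "t j = (u \<bullet> \<alpha> j) / (w j \<bullet> \<alpha> j)" for j
  have t0: "0 \<le> t j" if "j < n" for j
    using that dom dual_pos by (auto simp: t_def inner_commute intro!: divide_nonneg_pos)
  have ex: "u = (\<Sum>j<n. t j *\<^sub>R w j)" unfolding t_def by (rule dual_bases.expansion[OF dual_swap])
  define s where "s = (\<Sum>j<n. t j)"
  have "0 \<le> s" unfolding s_def using t0 by (intro sum_nonneg) auto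
  have "s \<noteq> 0"
  proof
    assume "s = 0"
    then have "\<forall>j\<in>{..<n}. t j = 0" using t0 unfolding s_def by (subst (asm) sum_nonneg_eq_0_iff) auto
    then show False using ex V_unit[OF u] by simp
  qed
  then have s: "0 < s" using \<open>0 \<le> s\<close> by simp
  have FQ: "F (n - 1) \<subseteq> Q" using top_facet facet_of_imp_subset by blast
  have "convex (F (n - 1))" by (metis diff_le_self flag_poly polytope_imp_convex)
  then have "(\<Sum>j<n. (t j / s) *\<^sub>R face_center (F j)) \<in> F (n - 1)"
    using t0 s flag_center_in[of _ "n - 1"]
    by (intro convex_sum) (auto simp: s_def sum_divide_distrib[symmetric])
  moreover have "(\<Sum>j<n. (t j / s) *\<^sub>R face_center (F j)) = c + u /\<^sub>R s"
  proof -
    have "(\<Sum>j<n. (t j / s) *\<^sub>R face_center (F j)) = (\<Sum>j<n. (t j / s) *\<^sub>R c + (t j / s) *\<^sub>R w j)"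
      by (simp add: w_def scaleR_diff_right)
    also have "\<dots> = (\<Sum>j<n. t j / s) *\<^sub>R c + (\<Sum>j<n. (t j / s) *\<^sub>R w j)"
      by (simp add: sum.distrib scaleR_sum_left)
    also have "(\<Sum>j<n. t j / s) = 1" using s by (simp add: s_def sum_divide_distrib[symmetric])
    also have "(\<Sum>j<n. (t j / s) *\<^sub>R w j) = u /\<^sub>R s"
      by (subst ex) (simp add: scaleR_sum_right divide_inverse mult.commute)
    finally show ?thesis by simp
  qed
  ultimately have p: "c + u /\<^sub>R s \<in> F (n - 1)" by simp
  have "(c + u /\<^sub>R s - c) \<bullet> w (n - 1) = 1\<^sup>2"
    unfolding w_def using p by (intro tangentialD(5)[OF tang top_facet]) (rule hull_inc)
  then have uw: "u \<bullet> w (n - 1) = s" using s by (simp add: field_simps)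
  obtain H where H: "H facet_of Q" "u = face_center H - c" using u V_def by auto
  have "(c + u /\<^sub>R s - c) \<bullet> u \<le> 1\<^sup>2"
    unfolding H(2) using p FQ H(2) by (intro tangentialD(6)[OF tang H(1)]) auto
  then have "1 \<le> s" using V_unit[OF u] s by (simp add: field_simps)
  moreover have "s \<le> 1" using unit_inner_le[OF V_unit[OF u] V_unit[OF w_top]] uw by simp
  ultimately show ?thesis using unit_inner_eq_1[OF V_unit[OF u] V_unit[OF w_top]] uw by simp
qed

text \<open>The element of S that has the greatest inner product with the interior point w 0 + ... + w
  (n - 1) of the cone cannot be improved by a reflection in a wall, so it lies in the closed cone.\<close>

lemma orbit_contains_top:
  assumes S: "S \<subseteq> V" "S \<noteq> {}" and closed: "\<And>u i. u \<in> S \<Longrightarrow> i < n \<Longrightarrow> reflect (\<alpha> i) u \<in> S"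
  shows "w (n - 1) \<in> S"
proof -
  define v where "v = (\<Sum>j<n. w j)"
  let ?X = "(\<lambda>u. u \<bullet> v) ` S"
  have fin: "finite ?X" using S(1) V_finite finite_subset by blast
  then have "Max ?X \<in> ?X" using S(2) by (intro Max_in) auto
  then obtain u where u: "u \<in> S" "u \<bullet> v = Max ?X" by auto
  have max: "u' \<bullet> v \<le> u \<bullet> v" if "u' \<in> S" for u' unfolding u(2) using fin that by (intro Max_ge) auto
  have "0 \<le> u \<bullet> \<alpha> i" if i: "i < n" for i
  proof -
    have "reflect (\<alpha> i) u \<bullet> v \<le> u \<bullet> v" using max closed u(1) i by blast
    then have "0 \<le> (u \<bullet> \<alpha> i) * (\<alpha> i \<bullet> v)"
      by (simp add: reflect_unit[OF unit[OF i]] inner_diff_left)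
    moreover have "0 < \<alpha> i \<bullet> v" using dual_sum_w[OF i] dual_pos[OF i] by (simp add: v_def)
    ultimately show ?thesis by (simp add: zero_le_mult_iff)
  qed
  then have "u = w (n - 1)" using chamber_normal u(1) S(1) by blast
  then show ?thesis using u(1) by simp
qed

text \<open>Antipodal edges come in pairs: a symmetric edge would contain the center, which is an interior
  point.\<close>

lemma antipodal_even_edges:
  assumes "uminus \<in> symmetries Q c" "2 \<le> n"
  shows "even (card {e. e edge_of Q})"
proof -
  define T where "T = (\<lambda>x. c + - (x - c))"
  have T: "rigid_motion T" "T ` Q = Q" using symmetriesD[OF assms(1)] unfolding T_def by auto
  have TT: "T ` T ` e = e" for e by (simp add: T_def image_image)
  show ?thesis
  proof (rule even_card_involution)
    show "finite {e. e edge_of Q}"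
      using finite_polytope_faces[OF poly] by (rule rev_finite_subset) (auto simp: edge_of_def)
    show "T ` T ` e = e" for e using TT .
    fix e assume e: "e \<in> {e. e edge_of Q}"
    then have ef: "e face_of Q" "aff_dim e = 1" by (auto simp: edge_of_def)
    show "T ` e \<in> {e. e edge_of Q}"
      using rigid_motion_face_of[OF T(1), of e Q] rigid_motion_aff_dim[OF T(1), of e] T(2) ef
      by (simp add: edge_of_def)
    show "T ` e \<noteq> e"
    proof
      assume Te: "T ` e = e"
      obtain x where x: "x \<in> e" using ef(2) by (metis aff_dim_empty_eq all_not_in_conv one_neq_neg_one)
      have "convex e" using ef(1) face_of_imp_convex by blast
      then have "(1/2) *\<^sub>R x + (1/2) *\<^sub>R T x \<in> e" using x Te by (intro convexD) auto
      moreover have "(1/2) *\<^sub>R x + (1/2) *\<^sub>R T x = c" by (simp add: T_def algebra_simps scaleR_2[symmetric])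
      ultimately have "c \<in> e \<inter> rel_interior Q" using tangential_center_interior[OF tang] by simp
      moreover have "e \<noteq> Q" using ef(2) dimQ assms(2) by auto
      ultimately show False using face_of_disjoint_rel_interior[OF ef(1)] by blast
    qed
  qed
qed

lemma antipodal_sum:
  assumes "uminus \<in> symmetries Q c"
  shows "(\<Sum>t\<in>distances V. t\<^sup>2) = 2 * real (card (distances V)) + 2"
  using V_finite V_unit
  by (rule antipodal_distance_sum) (use V_symmetry[OF assms] w_top in auto)

lemma V_transitive: assumes "u \<in> V" obtains g where "g \<in> symmetries Q c" "u = g (w (n - 1))"
proof -
  define S where "S = {u \<in> V. \<nexists>g. g \<in> symmetries Q c \<and> u = g (w (n - 1))}"
  have "reflect (\<alpha> i) u \<in> S" if u: "u \<in> S" and i: "i < n" for u i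
  proof -
    have "reflect (\<alpha> i) u \<in> V" using V_symmetry refl[OF i] u S_def by auto
    moreover have "\<nexists>g. g \<in> symmetries Q c \<and> reflect (\<alpha> i) u = g (w (n - 1))"
    proof
      assume "\<exists>g. g \<in> symmetries Q c \<and> reflect (\<alpha> i) u = g (w (n - 1))"
      then obtain g where g: "g \<in> symmetries Q c" "reflect (\<alpha> i) u = g (w (n - 1))" by blast
      then have "u = (reflect (\<alpha> i) \<circ> g) (w (n - 1))" by (metis comp_apply reflect_reflect)
      moreover have "reflect (\<alpha> i) \<circ> g \<in> symmetries Q c" using comp refl i g by blast
      ultimately show False using u S_def by blast
    qed
    ultimately show ?thesis by (simp add: S_def)
  qed
  moreover have "w (n - 1) \<notin> S"
  proof -
    have "reflect (\<alpha> 0) \<circ> reflect (\<alpha> 0) \<in> symmetries Q c" using comp refl n by simp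
    moreover have "w (n - 1) = (reflect (\<alpha> 0) \<circ> reflect (\<alpha> 0)) (w (n - 1))" by (simp add: reflect_reflect)
    ultimately show ?thesis unfolding S_def by blast
  qed
  ultimately have "S = {}" using orbit_contains_top[of S] by (auto simp: S_def)
  then show ?thesis using that assms S_def by blast
qed

text \<open>The sum of all the facet normals is fixed by the reflections in \<alpha> 0, ..., \<alpha>
  (n - 1), and only 0 is orthogonal to the whole basis.\<close>

lemma V_sum: "\<Sum>V = 0"
proof (rule eq_0_if_perp)
  fix i assume i: "i < n"
  let ?s = "reflect (\<alpha> i)"
  have im: "?s ` V = V"
  proof
    show "?s ` V \<subseteq> V" using V_symmetry[OF refl[OF i]] by blast
    then show "V \<subseteq> ?s ` V" by (metis image_eqI image_subset_iff reflect_reflect subsetI)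
  qed
  have "inj_on ?s V" by (metis inj_onI reflect_reflect)
  then have "\<Sum>(?s ` V) = (\<Sum>v\<in>V. ?s v)" by (simp add: sum.reindex)
  also have "\<dots> = ?s (\<Sum>V)" by (simp add: linear_sum[OF linear_reflect])
  finally have "?s (\<Sum>V) = \<Sum>V" using im by simp
  then show "\<Sum>V \<bullet> \<alpha> i = 0" using \<alpha>_nz[OF i] by (simp add: reflect_unit[OF unit[OF i]])
qed

lemma polygon_card_edges:
  assumes "n = 2" shows "card {e. e edge_of Q} = card V"
proof -
  have "{e. e edge_of Q} = {F. F facet_of Q}"
    using assms dimQ by (auto simp: edge_of_def facet_of_def)
  then show ?thesis unfolding V_def using card_image[OF V_inj] by simp
qed

lemma polygon_antipodal:
  assumes two: "n = 2" and m: "- w 1 \<in> V" and u: "u \<in> V" shows "- u \<in> V"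
proof -
  obtain g where g: "g \<in> symmetries Q c" "u = g (w (n - 1))" using V_transitive[OF u] .
  have "g (- w 1) \<in> V" using V_symmetry[OF g(1) m] .
  then show ?thesis using g two linear_neg[OF symmetriesD(2)[OF g(1)]] by simp
qed

text \<open>In the plane, \<alpha> 0 is orthogonal to the normal w 1, and the reflection in \<alpha> 0
  permutes the normals and fixes only w 1. Therefore each inner product with w 1 other than 1 is
  attained exactly twice. As the normals sum to 0, the distinct inner products sum to -1/2.\<close>

lemma polygon_odd:
  assumes two: "n = 2" and m: "- w 1 \<notin> V"
  shows "card V = 2 * card (distances V) + 1" "(\<Sum>t\<in>distances V. t\<^sup>2) = 2 * real (card (distances V)) + 1"
proof -
  let ?u = "w 1" and ?a = "\<alpha> 0" and ?s = "reflect (\<alpha> 0)"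
  have uV: "?u \<in> V" using w_top two by simp
  have ua: "?u \<bullet> ?a = 0" "?a \<bullet> ?u = 0" using dual[of 0 1] two by (auto simp: inner_commute)
  have aa: "?a \<bullet> ?a = 1" using unit two by (simp add: norm_eq_1)
  have uu: "?u \<bullet> ?u = 1" using V_unit[OF uV] .
  have dec: "v = (v \<bullet> ?u) *\<^sub>R ?u + (v \<bullet> ?a) *\<^sub>R ?a" for v
  proof -
    define z where "z = v - (v \<bullet> ?u) *\<^sub>R ?u - (v \<bullet> ?a) *\<^sub>R ?a"
    have z: "z \<bullet> ?u = 0" "z \<bullet> ?a = 0" using ua aa uu by (auto simp: z_def inner_diff_left)
    have ze: "z = (z \<bullet> w 0 / (\<alpha> 0 \<bullet> w 0)) *\<^sub>R \<alpha> 0"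
      using expansion[of z] z(1) two by (simp add: numeral_2_eq_2)
    have "z \<bullet> ?a = z \<bullet> w 0 / (\<alpha> 0 \<bullet> w 0)" by (subst ze) (simp add: aa)
    then have "z \<bullet> w 0 / (\<alpha> 0 \<bullet> w 0) = 0" using z(2) by simp
    then have "z = 0" using ze by (metis scaleR_zero_left)
    then show ?thesis by (simp add: z_def algebra_simps)
  qed
  have norm_dec: "(v \<bullet> ?u)\<^sup>2 + (v \<bullet> ?a)\<^sup>2 = 1" if v: "v \<in> V" for v
  proof -
    have "v \<bullet> v = (v \<bullet> ?u)\<^sup>2 + (v \<bullet> ?a)\<^sup>2"
      by (subst (2) dec[of v]) (simp add: inner_add_right power2_eq_square)
    then show ?thesis using V_unit[OF v] by simp
  qed
  let ?X = "(\<lambda>v. ?u \<bullet> v) ` (V - {?u})"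
  have X: "inner_values V = ?X"
  proof
    show "?X \<subseteq> inner_values V" unfolding inner_values_def using uV by blast
    show "inner_values V \<subseteq> ?X"
    proof
      fix x assume "x \<in> inner_values V"
      then obtain a b where ab: "x = a \<bullet> b" "a \<in> V" "b \<in> V" "a \<noteq> b" by (auto simp: inner_values_def)
      obtain g where g: "g \<in> symmetries Q c" "a = g ?u" using V_transitive[OF ab(2)] two by auto
      obtain h where h: "h \<in> symmetries Q c" "\<And>x. h (g x) = x" "\<And>x. g (h x) = x" using symmetries_inverse[OF g(1)] by blast
      have "x = ?u \<bullet> h b" using inner_orth[OF g(1), of ?u "h b"] h g ab by simp
      moreover have "h b \<in> V" using V_symmetry h(1) ab(3) by blast
      moreover have "h b \<noteq> ?u" using h g ab by metis
      ultimately show "x \<in> ?X" by blast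
    qed
  qed
  have fib: "card {v \<in> V - {?u}. ?u \<bullet> v = x} = 2" if x: "x \<in> ?X" for x
  proof -
    obtain v where v: "v \<in> V" "v \<noteq> ?u" "x = ?u \<bullet> v" using x by blast
    have ya: "v \<bullet> ?a \<noteq> 0"
    proof
      assume y: "v \<bullet> ?a = 0"
      then have "(v \<bullet> ?u)\<^sup>2 = 1\<^sup>2" using norm_dec[OF v(1)] by simp
      then have "v \<bullet> ?u = 1 \<or> v \<bullet> ?u = -1" by (simp only: power2_eq_iff)
      moreover have "v = (v \<bullet> ?u) *\<^sub>R ?u" using dec[of v] y by simp
      ultimately have "v = ?u \<or> v = - ?u" by (metis scaleR_one scaleR_minus_left)
      then show False using v m by auto
    qed
    have sv: "?s v = v - (2 * (v \<bullet> ?a)) *\<^sub>R ?a" using reflect_unit[OF unit] two by simp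
    have svu: "?u \<bullet> ?s v = x" using ua v by (simp add: sv inner_diff_right)
    have sva: "?s v \<bullet> ?a = - (v \<bullet> ?a)" using aa by (simp add: sv inner_diff_left)
    have "{v \<in> V - {?u}. ?u \<bullet> v = x} = {v, ?s v}"
    proof
      have "?s v \<in> V" using V_symmetry[OF refl v(1)] two by simp
      moreover have "?s v \<noteq> ?u" using sva ya ua by auto
      ultimately show "{v, ?s v} \<subseteq> {v \<in> V - {?u}. ?u \<bullet> v = x}" using v svu by auto
      show "{v \<in> V - {?u}. ?u \<bullet> v = x} \<subseteq> {v, ?s v}"
      proof
        fix z assume z: "z \<in> {v \<in> V - {?u}. ?u \<bullet> v = x}"
        have zu: "z \<bullet> ?u = v \<bullet> ?u" using z v by (simp add: inner_commute)
        then have "(z \<bullet> ?a)\<^sup>2 = (v \<bullet> ?a)\<^sup>2" using norm_dec[of z] norm_dec[OF v(1)] z by auto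
        then have "z \<bullet> ?a = v \<bullet> ?a \<or> z \<bullet> ?a = ?s v \<bullet> ?a" by (simp add: sva power2_eq_iff)
        moreover have "?s v \<bullet> ?u = v \<bullet> ?u" using svu v by (simp add: inner_commute)
        ultimately show "z \<in> {v, ?s v}" using dec[of z] dec[of v] dec[of "?s v"] zu by (metis insertI1 insertI2)
      qed
    qed
    moreover have "v \<noteq> ?s v" using sva ya by auto
    ultimately show ?thesis by simp
  qed
  have fin: "finite (V - {?u})" using V_finite by simp
  have "card (V - {?u}) = (\<Sum>v\<in>V - {?u}. 1)" by simp
  also have "\<dots> = (\<Sum>x\<in>?X. \<Sum>v\<in>{v \<in> V - {?u}. ?u \<bullet> v = x}. 1)" using fin by (rule sum.image_gen)
  also have "\<dots> = (\<Sum>x\<in>?X. 2)" using fib by (intro sum.cong) auto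
  finally have card: "card (V - {?u}) = 2 * card ?X" by simp
  have cV: "card V = card (V - {?u}) + 1" using card.remove[OF V_finite uV] by simp
  have "(\<Sum>v\<in>V - {?u}. ?u \<bullet> v) = (\<Sum>x\<in>?X. \<Sum>v\<in>{v \<in> V - {?u}. ?u \<bullet> v = x}. ?u \<bullet> v)" using fin by (rule sum.image_gen)
  also have "\<dots> = (\<Sum>x\<in>?X. 2 * x)"
  proof (rule sum.cong[OF HOL.refl])
    fix x assume x: "x \<in> ?X"
    have "(\<Sum>v\<in>{v \<in> V - {?u}. ?u \<bullet> v = x}. ?u \<bullet> v) = (\<Sum>v\<in>{v \<in> V - {?u}. ?u \<bullet> v = x}. x)" by (intro sum.cong) auto
    then show "(\<Sum>v\<in>{v \<in> V - {?u}. ?u \<bullet> v = x}. ?u \<bullet> v) = 2 * x" using fib[OF x] by simp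
  qed
  finally have s1: "(\<Sum>v\<in>V - {?u}. ?u \<bullet> v) = 2 * \<Sum>?X" by (simp add: sum_distrib_left)
  have "(\<Sum>v\<in>V. ?u \<bullet> v) = 0" by (simp add: inner_sum_right[symmetric] V_sum)
  then have "2 * \<Sum>?X = -1" using s1 sum.remove[OF V_finite uV, of "\<lambda>v. ?u \<bullet> v"] uu by simp
  moreover note distances_inner_values[OF V_unit]
  ultimately show "card V = 2 * card (distances V) + 1"
    "(\<Sum>t\<in>distances V. t\<^sup>2) = 2 * real (card (distances V)) + 1"
    using card cV X by auto
qed

text \<open>For the diagram of type A the orbit of the facet normal w (n - 1) can be written down: the
  simple reflections act on the n + 1 vectors u 0, ..., u n as the adjacent transpositions. They
  sum to 0 and any two of them have the same inner product -1/n, as for a regular simplex.\<close>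

lemma simplex_if_simply_laced:
  assumes bonds: "\<And>i. Suc i < n \<Longrightarrow> \<alpha> i \<bullet> \<alpha> (Suc i) = - 1/2"
  shows "int n simplex Q"
proof -
  \<comment> \<open>chosen so that the reflection in \<alpha> (n - 1) subtracts A \<alpha> (n - 1) from w
      (n - 1)\<close>
  define A where "A = 2 * (w (n - 1) \<bullet> \<alpha> (n - 1))"
  have A: "0 < A" using dual_pos[of "n - 1"] n by (simp add: A_def inner_commute)
  define u where "u m = w (n - 1) - A *\<^sub>R (\<Sum>j=m..<n. \<alpha> j)" for m
  have u_step: "u m = u (Suc m) - A *\<^sub>R \<alpha> m" if "m < n" for m
    using that by (simp add: u_def sum.atLeast_Suc_lessThan scaleR_add_right)
  have u_top: "u n = w (n - 1)" by (simp add: u_def)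
  have g: "\<alpha> i \<bullet> \<alpha> j = (if i = j then 1 else if j = Suc i \<or> i = Suc j then -1/2 else 0)" if "i < n" "j < n" for i j
    using gram[OF that] bonds[of i] bonds[of j] that by (auto simp: bond_def)
  have ua: "u m \<bullet> \<alpha> i = (if m = Suc i then A/2 else if m = i then - A/2 else 0)" if "i < n" "m \<le> n" for i m
    using that(2)
  proof (induction m rule: inc_induct)
    case base
    then show ?case using that(1) dual[of i "n - 1"] n
      by (auto simp: u_top A_def inner_commute)
  next
    case (step m)
    then show ?case using that(1) A g[of m i]
      by (auto simp: u_step inner_diff_left)
  qed
  have refl_u: "reflect (\<alpha> i) (u m) = u (if m = Suc i then i else if m = i then Suc i else m)"
    if "i < n" "m \<le> n" for i m
    using that ua[OF that] u_step[of i] by (simp add: reflect_unit[OF unit])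
  let ?U = "u ` {..n}"
  have closed: "reflect (\<alpha> i) v \<in> ?U" if "v \<in> ?U" "i < n" for v i
    using that refl_u by auto
  have uV: "u m \<in> V" if "m \<le> n" for m
    using that
  proof (induction m rule: inc_induct)
    case base then show ?case using w_top u_top by simp
  next
    case (step m)
    then show ?case using refl_u[of m "Suc m"] V_symmetry[OF refl[of m]] by (metis Suc_leI)
  qed
  have VU: "V = ?U"
  proof (rule ccontr)
    assume "V \<noteq> ?U"
    then have "V - ?U \<noteq> {}" using uV by auto
    then have "w (n - 1) \<in> V - ?U"
    proof (rule orbit_contains_top[rotated])
      fix v i assume "v \<in> V - ?U" "i < n"
      then show "reflect (\<alpha> i) v \<in> V - ?U"
        using V_symmetry[OF refl] closed[of "reflect (\<alpha> i) v" i] by (auto simp: reflect_reflect)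
    qed auto
    then show False using u_top by (metis DiffD2 atMost_iff image_eqI order_refl)
  qed
  have usum: "(\<Sum>m\<le>n. u m) = 0"
  proof (rule eq_0_if_perp)
    fix i assume i: "i < n"
    have "(\<Sum>m\<le>n. u m) \<bullet> \<alpha> i = (\<Sum>m\<le>n. (if m = Suc i then A/2 else 0) + (if m = i then - A/2 else 0))"
      unfolding inner_sum_left using ua[OF i] by (intro sum.cong) auto
    also have "\<dots> = 0" using i by (simp add: sum.distrib)
    finally show "(\<Sum>m\<le>n. u m) \<bullet> \<alpha> i = 0" .
  qed
  define k where "k = u 0 \<bullet> u n"
  have k1: "u l \<bullet> u n = k" if "l < n" for l
    using that
  proof (induction l)
    case (Suc l)
    have "u n \<bullet> \<alpha> l = 0" using ua[of l n] Suc.prems by auto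
    then show ?case using Suc u_step[of l] by (simp add: inner_diff_left inner_diff_right inner_commute)
  qed (simp add: k_def)
  have k2: "u l \<bullet> u m = k" if "l < m" "m \<le> n" for l m
    using that(2,1)
  proof (induction m rule: inc_induct)
    case base then show ?case using k1 by simp
  next
    case (step m)
    have "u l \<bullet> \<alpha> m = 0" using ua[of m l] step by auto
    then show ?case using step u_step[of m] by (simp add: inner_diff_right)
  qed
  have kk: "u l \<bullet> u m = (if l = m then 1 else k)" if "l \<le> n" "m \<le> n" for l m
    using k2[of l m] k2[of m l] V_unit[OF uV] that by (cases l m rule: linorder_cases) (auto simp: inner_commute)
  have "0 = u n \<bullet> (\<Sum>m\<le>n. u m)" by (simp add: usum)
  also have "\<dots> = u n \<bullet> u n + (\<Sum>m<n. u n \<bullet> u m)"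
    by (simp add: inner_sum_right inner_add_right lessThan_Suc_atMost[symmetric])
  also have "(\<Sum>m<n. u n \<bullet> u m) = (\<Sum>m<n. k)" by (intro sum.cong) (auto simp: kk)
  finally have nk: "real n * k = -1" using kk[of n n] by simp
  have half: "x \<in> Q \<longleftrightarrow> (\<forall>m\<le>n. (x - c) \<bullet> u m \<le> 1)" for x
  proof
    assume x: "x \<in> Q"
    have "(x - c) \<bullet> v \<le> 1" if "v \<in> V" for v
      using that tangentialD(6)[OF tang _ x] by (auto simp: V_def)
    then show "\<forall>m\<le>n. (x - c) \<bullet> u m \<le> 1" using uV by blast
  next
    assume x: "\<forall>m\<le>n. (x - c) \<bullet> u m \<le> 1"
    show "x \<in> Q"
    proof (rule tangential_halfspaces[OF tang])
      show "x \<in> affine hull Q" using affQ by simp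
      fix H assume "H facet_of Q"
      then have "face_center H - c \<in> ?U" using VU V_def by blast
      then show "(x - c) \<bullet> (face_center H - c) \<le> 1\<^sup>2" using x by auto
    qed
  qed
  show ?thesis
  proof (rule simplex_from_facet_normals[where u = u and c = c])
    show "u l \<bullet> u m = (if l = m then 1 else - 1 / real n)" if "l \<le> n" "m \<le> n" for l m
      using kk[OF that] nk n by (simp add: field_simps)
    fix z assume z: "\<And>m. m \<le> n \<Longrightarrow> z \<bullet> u m = 0"
    show "z = 0"
    proof (rule eq_0_if_perp)
      fix i assume i: "i < n"
      have "A * (z \<bullet> \<alpha> i) = z \<bullet> u (Suc i) - z \<bullet> u i" using u_step[OF i] by (simp add: inner_diff_right)
      then show "z \<bullet> \<alpha> i = 0" using z i A by simp
    qed
  qed (use n dimQ poly polytope_imp_convex half usum in auto)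
qed

end

section \<open>The distances of a simplex\<close>

lemma face_center_convex_hull:
  fixes B :: "'a::euclidean_space set"
  assumes "\<not> affine_dependent B"
  shows "face_center (convex hull B) = (\<Sum>v\<in>B. v) /\<^sub>R real (card B)"
proof -
  have "{v. v extreme_point_of (convex hull B)} = B"
    using extreme_point_of_convex_hull_affine_independent[OF assms] by blast
  then show ?thesis by (simp add: face_center_def)
qed

text \<open>A vector on which all vertices agree defines a hyperplane that contains the simplex, unless it
  is 0.\<close>

lemma eq_0_if_perp_simplex:
  fixes s :: "'a::euclidean_space"
  assumes dim: "aff_dim C = int DIM('a)" and s: "\<And>v w. v \<in> C \<Longrightarrow> w \<in> C \<Longrightarrow> v \<bullet> s = w \<bullet> s"
  shows "s = 0"
proof (rule ccontr)
  assume "s \<noteq> 0"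
  have "C \<noteq> {}" using dim by auto
  then obtain v where "v \<in> C" by blast
  then have "C \<subseteq> {x. s \<bullet> x = s \<bullet> v}" using s by (auto simp: inner_commute)
  then have "aff_dim C \<le> aff_dim {x. s \<bullet> x = s \<bullet> v}" by (rule aff_dim_subset)
  then show False using dim \<open>s \<noteq> 0\<close> by (simp add: aff_dim_hyperplane)
qed

text \<open>Equidistance of the vertices and of the edge midpoints makes all inner products of two different
  vertex vectors equal, so the vertex vectors sum to 0. The facet centers are then the points
  opposite to the vertices, scaled by 1/n; as they are unit vectors, the vertices are at distance
  n, and two facet centers are always at squared distance 2 + 2/n.\<close>

lemma simplex_distance_sum:
  fixes Q :: "'a::euclidean_space set"
  assumes Q: "equicentered Q c \<rho>" and t: "tangential Q c 1" and n: "2 \<le> DIM('a)"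
    and simplex: "int DIM('a) simplex Q"
  shows "(\<Sum>t\<in>facet_center_distances Q. t\<^sup>2) = 2 + 2 / real DIM('a)"
proof -
  define n where "n = DIM('a)"
  have n2: "2 \<le> n" using n by (simp add: n_def)
  obtain C where C: "\<not> affine_dependent C" "int (card C) = int n + 1" "Q = convex hull C"
    using simplex unfolding simplex_def n_def by blast
  have fin: "finite C" using C(1) aff_independent_finite by blast
  have cardC: "card C = n + 1" using C(2) by simp
  have dimC: "aff_dim C = int n" using C(1,2) aff_dim_affine_independent by fastforce
  have sub_ind: "\<not> affine_dependent B" if "B \<subseteq> C" for B using that C(1) affine_independent_subset by blast
  have face: "convex hull B face_of Q" if "B \<subseteq> C" for B
    using that face_of_convex_hull_affine_independent[OF C(1)] C(3) by blast
  define R where "R = \<rho> 0"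
  define m where "m = \<rho> 1"
  define k where "k = 2 * m\<^sup>2 - R\<^sup>2"
  have vv: "(v - c) \<bullet> (v - c) = R\<^sup>2" if v: "v \<in> C" for v
  proof -
    have "{v} face_of Q" using face[of "{v}"] v by simp
    then have "dist c (face_center {v}) = R" using equicenteredD(4)[OF Q, of "{v}"] by (simp add: R_def)
    moreover have "face_center {v} = v" by (simp add: face_center_def)
    ultimately have "norm (v - c) = R" by (simp add: dist_norm norm_minus_commute)
    then show ?thesis by (metis power2_norm_eq_inner)
  qed
  have vw: "(v - c) \<bullet> (w - c) = k" if v: "v \<in> C" "w \<in> C" "v \<noteq> w" for v w
  proof -
    have B: "{v, w} \<subseteq> C" using v by simp
    have ne: "convex hull {v, w} \<noteq> {}" by simp
    have "aff_dim (convex hull {v, w}) = 1" using v by (simp add: aff_dim_convex_hull)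
    then have "dist c (face_center (convex hull {v, w})) = m"
      using equicenteredD(4)[OF Q face[OF B] ne] by (simp add: m_def)
    then have nm: "norm (face_center (convex hull {v, w}) - c) = m" by (simp add: dist_norm norm_minus_commute)
    have "face_center (convex hull {v, w}) = (v + w) /\<^sub>R 2"
      using face_center_convex_hull[OF sub_ind[OF B]] v by simp
    then have "face_center (convex hull {v, w}) - c = (1/2) *\<^sub>R ((v - c) + (w - c))"
      by (simp add: algebra_simps scaleR_2[symmetric])
    then have "m\<^sup>2 = ((1/2) *\<^sub>R ((v - c) + (w - c))) \<bullet> ((1/2) *\<^sub>R ((v - c) + (w - c)))"
      using nm by (metis power2_norm_eq_inner)
    also have "\<dots> = (x \<bullet> x + 2 * (x \<bullet> y) + y \<bullet> y) / 4" if "x = v - c" "y = w - c" for x y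
      unfolding that[symmetric] by (simp add: inner_add_left inner_add_right inner_commute)
    finally have "m\<^sup>2 = ((v - c) \<bullet> (v - c) + 2 * ((v - c) \<bullet> (w - c)) + (w - c) \<bullet> (w - c)) / 4" by blast
    then show ?thesis unfolding vv[OF v(1)] vv[OF v(2)] by (simp add: k_def)
  qed
  define f where "f v = convex hull (C - {v})" for v
  define S where "S = (\<Sum>v\<in>C. v - c)"
  have fc: "face_center (f v) = ((\<Sum>v\<in>C. v) - v) /\<^sub>R real n" if "v \<in> C" for v
    using face_center_convex_hull[OF sub_ind[of "C - {v}"]] fin cardC that
    by (simp add: f_def sum_diff1)
  have fcS: "face_center (f v) - c = (S - (v - c)) /\<^sub>R real n" if v: "v \<in> C" for v
  proof -
    have "S = (\<Sum>v\<in>C. v) - (real n + 1) *\<^sub>R c" using fin cardC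
      by (simp add: S_def sum_subtractf sum_constant_scaleR)
    then have "S - (v - c) = ((\<Sum>v\<in>C. v) - v) - real n *\<^sub>R c" by (simp add: algebra_simps)
    then have "(S - (v - c)) /\<^sub>R real n = ((\<Sum>v\<in>C. v) - v) /\<^sub>R real n - (real n *\<^sub>R c) /\<^sub>R real n"
      by (simp only: scaleR_diff_right)
    then show ?thesis using fc[OF v] n2 by simp
  qed
  have facets: "F facet_of Q \<longleftrightarrow> (\<exists>v\<in>C. F = f v)" for F
  proof -
    have "f v \<noteq> {}" if "v \<in> C" for v
    proof -
      have "card (C - {v}) = n" using fin cardC that by simp
      then have "C - {v} \<noteq> {}" using n2 by (metis card.empty not_numeral_le_zero)
      then show ?thesis by (simp add: f_def)
    qed
    then show ?thesis
      unfolding C(3) facet_of_convex_hull_affine_independent[OF C(1)] f_def by blast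
  qed
  have Sw: "(w - c) \<bullet> S = R\<^sup>2 + real n * k" if w: "w \<in> C" for w
  proof -
    have "(w - c) \<bullet> S = (w - c) \<bullet> (w - c) + (\<Sum>v\<in>C - {w}. (w - c) \<bullet> (v - c))"
      unfolding S_def inner_sum_right using fin w by (rule sum.remove)
    also have "(\<Sum>v\<in>C - {w}. (w - c) \<bullet> (v - c)) = (\<Sum>v\<in>C - {w}. k)" using vw w by (intro sum.cong) auto
    finally show ?thesis using vv[OF w] fin cardC w by simp
  qed
  have Sconst: "v \<bullet> S = w \<bullet> S" if "v \<in> C" "w \<in> C" for v w
  proof -
    have "(v - c) \<bullet> S = (w - c) \<bullet> S" using Sw that by simp
    then show ?thesis unfolding inner_diff_left by simp
  qed
  have S0: "S = 0"
    by (rule eq_0_if_perp_simplex[OF _ Sconst]) (simp_all add: dimC n_def[symmetric])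
  have "C \<noteq> {}" using cardC by auto
  then obtain v where v: "v \<in> C" by blast
  have RK: "R\<^sup>2 + real n * k = 0" using Sw[OF v] S0 by simp
  have y: "face_center (f v) - c = - ((v - c) /\<^sub>R real n)" by (simp only: fcS[OF v] S0 diff_0 scaleR_minus_right)
  have "(face_center (f v) - c) \<bullet> (face_center (f v) - c) = 1"
    using tangentialD(4)[OF t] facets v by (metis norm_eq_1)
  moreover have "- (x /\<^sub>R real n) \<bullet> - (x /\<^sub>R real n) = (x \<bullet> x) / (real n)\<^sup>2" for x :: 'a
    by (simp add: power2_eq_square divide_inverse)
  ultimately have "((v - c) \<bullet> (v - c)) / (real n)\<^sup>2 = 1" unfolding y by metis
  then have "(v - c) \<bullet> (v - c) = (real n)\<^sup>2" using n2 by simp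
  then have R: "R\<^sup>2 = (real n)\<^sup>2" using vv[OF v] by simp
  then have "real n * (real n + k) = 0" using RK by (simp add: algebra_simps power2_eq_square)
  then have k: "k = - real n" using n2 by simp
  define l where "l = sqrt (2 + 2 / real n)"
  have dist: "dist (face_center (f v)) (face_center (f w)) = l" if vw': "v \<in> C" "w \<in> C" "v \<noteq> w" for v w
  proof -
    have "face_center (f v) - face_center (f w) = ((w - c) - (v - c)) /\<^sub>R real n"
      using fc vw' by (simp add: scaleR_diff_right)
    then have "(dist (face_center (f v)) (face_center (f w)))\<^sup>2
        = (((w - c) - (v - c)) \<bullet> ((w - c) - (v - c))) / (real n)\<^sup>2"
      by (simp add: dist_norm power2_norm_eq_inner[symmetric] power_mult_distrib divide_inverse power_inverse)
    also have "((w - c) - (v - c)) \<bullet> ((w - c) - (v - c)) = 2 * R\<^sup>2 - 2 * k"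
      unfolding inner_diff_left[of "w - c" "v - c"] inner_diff_right[of _ "w - c" "v - c"]
      using vv vw vw' by simp
    also have "(2 * R\<^sup>2 - 2 * k) / (real n)\<^sup>2 = 2 + 2 / real n"
      unfolding R k using n2 by (simp add: field_simps power2_eq_square)
    finally show ?thesis unfolding l_def by (metis real_sqrt_unique zero_le_dist)
  qed
  have "facet_center_distances Q = {l}"
  proof
    show "facet_center_distances Q \<subseteq> {l}"
    proof
      fix t assume "t \<in> facet_center_distances Q"
      then obtain v w where "v \<in> C" "w \<in> C" "f v \<noteq> f w" "t = dist (face_center (f v)) (face_center (f w))"
        unfolding facet_center_distances_def facets by blast
      then show "t \<in> {l}" using dist[of v w] by auto
    qed
    have "card (C - {v}) = n" using fin cardC v by simp
    then have "C - {v} \<noteq> {}" using n2 by (metis card.empty not_numeral_le_zero)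
    then obtain w where w: "w \<in> C" "w \<noteq> v" by blast
    have "l \<noteq> 0" using n2 by (simp add: l_def add_nonneg_eq_0_iff)
    then have "f v \<noteq> f w" using dist[OF v w(1)] w(2) by auto
    moreover have "l = dist (face_center (f v)) (face_center (f w))" using dist[OF v w(1)] w(2) by simp
    ultimately show "{l} \<subseteq> facet_center_distances Q"
      unfolding facet_center_distances_def facets using v w(1) by blast
  qed
  moreover have "l\<^sup>2 = 2 + 2 / real n" by (simp add: l_def)
  ultimately show ?thesis by (simp add: n_def)
qed

section \<open>The sum of the squared distances\<close>

text \<open>The radius in dimension j is read off from an arbitrary j-face; dimensions j without faces
  receive a meaningless value.\<close>

lemma equicentered_if_center:
  fixes Q :: "'a::euclidean_space set"
  assumes poly: "full_polytope Q" and diamond: "diamond_property Q" and center: "is_center_of c Q"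
  obtains \<rho> where "equicentered Q c \<rho>"
proof -
  have Q: "polytope Q" "aff_dim Q = int DIM('a)" using poly by (auto simp: full_polytope_def)
  define \<rho> where "\<rho> j = dist c (face_center (SOME F. F face_of Q \<and> aff_dim F = j))" for j
  have "equicentered Q c \<rho>"
    unfolding equicentered_def
  proof (intro conjI allI impI)
    show "polytope Q" using Q by simp
    show "c \<in> affine hull Q" using Q aff_dim_eq_full by blast
  next
    fix F G H
    assume a: "F face_of Q \<and> G face_of Q \<and> H face_of Q \<and> F \<subseteq> H \<and> H \<subseteq> G \<and>
        aff_dim H = aff_dim F + 1 \<and> aff_dim G = aff_dim H + 1"
    define B where "B = {H. H face_of Q \<and> aff_dim H = aff_dim G - 1 \<and> F \<subseteq> H \<and> H \<subseteq> G}"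
    have "aff_dim G \<in> {1..int DIM('a)}"
      using a aff_dim_geq[of F] aff_dim_subset[OF face_of_imp_subset, of G Q] Q by auto
    moreover have "aff_dim F = aff_dim G - 2" "F \<subseteq> G" using a by auto
    ultimately have "card B = 2" using diamond a unfolding diamond_property_def B_def by blast
    then obtain X Y where XY: "B = {X, Y}" "X \<noteq> Y" by (meson card_2_iff)
    then obtain H' where H': "H' \<in> B" "H' \<noteq> H" by (metis insertI1 insertI2)
    then have "H' face_of Q" "F \<subseteq> H'" "H' \<subseteq> G" "aff_dim H' = aff_dim G - 1" by (auto simp: B_def)
    with H'(2) show "\<exists>H'. H' \<noteq> H \<and> H' face_of Q \<and> F \<subseteq> H' \<and> H' \<subseteq> G \<and> aff_dim H' = aff_dim H"
      using a by auto
  next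
    fix F assume F: "F face_of Q \<and> F \<noteq> {}"
    define G where "G = (SOME G. G face_of Q \<and> aff_dim G = aff_dim F)"
    have G: "G face_of Q \<and> aff_dim G = aff_dim F" unfolding G_def by (rule someI[of _ F]) (use F in simp)
    have "aff_dim F \<noteq> -1" using F aff_dim_empty by blast
    moreover have "aff_dim F \<le> aff_dim Q" using F face_of_imp_subset aff_dim_subset by metis
    ultimately have "aff_dim F \<in> {0..int DIM('a)}" using aff_dim_geq[of F] Q(2) by simp
    from bspec[OF center[unfolded is_center_of_def] this]
    have "dist c (face_center F) = dist c (face_center G)" using F G by blast
    then show "dist c (face_center F) = \<rho> (aff_dim F)" by (simp add: \<rho>_def G_def)
  qed
  then show ?thesis using that by blast
qed

lemma not_Ints_two_plus:
  assumes "3 \<le> n" shows "2 + 2 / real n \<notin> \<int>"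
proof
  assume "2 + 2 / real n \<in> \<int>"
  then obtain z where z: "2 + 2 / real n = real_of_int z" by (rule Ints_cases)
  have "0 < 2 / real n" "2 / real n < 1" using assms by auto
  then have "2 < real_of_int z" "real_of_int z < 3" using z by linarith+
  then have "2 < z" "z < 3" by simp_all
  then show False by simp
qed

theorem corollary4p4:
  fixes Q :: "'a::euclidean_space set" and c :: 'a and E k :: nat and s :: real
  assumes "DIM('a) \<ge> 2"
    and "regular_polytope Q"
    and "circumscribed_about Q c 1"
  defines "E \<equiv> card {e. e edge_of Q}"
    and "k \<equiv> card (facet_center_distances Q)"
    and "s \<equiv> (\<Sum>t\<in>facet_center_distances Q. t\<^sup>2)"
  shows "(DIM('a) \<ge> 3 \<and> int DIM('a) simplex Q \<longrightarrow> s \<in> \<rat> \<and> s \<notin> \<int>) \<and>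
         (\<not> (DIM('a) \<ge> 3 \<and> int DIM('a) simplex Q) \<longrightarrow>
            s \<in> \<int> \<and>
            (odd E \<longrightarrow> s = 2 * real k + 1) \<and>
            (even E \<longrightarrow> s = 2 * real k + 2))"
proof -
  have full: "full_polytope Q" and diamond: "diamond_property Q"
    using assms(2) by (auto simp: regular_polytope_def)
  have center: "is_center_of c Q" using assms(3) by (simp add: circumscribed_about_def)
  obtain \<rho> where Q: "equicentered Q c \<rho>" by (rule equicentered_if_center[OF full diamond center])
  define n where "n = DIM('a)"
  have two_le: "2 \<le> n" using assms(1) by (simp add: n_def)
  have poly: "polytope Q" "aff_dim Q = int n" using full by (auto simp: full_polytope_def n_def)
  obtain F where F: "F n = Q" "\<And>i. i < n \<Longrightarrow> F i facet_of F (Suc i)"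
    by (rule flag_exists[OF poly]) blast
  have unit: "norm (face_center H - c) = 1" if "H facet_of Q" for H
  proof -
    have "face_center H \<in> sphere c 1" using assms(3) that unfolding circumscribed_about_def by blast
    then show ?thesis by (simp add: dist_norm norm_minus_commute)
  qed
  interpret unit_flag Q c \<rho> n F
    using Q poly F two_le unit by unfold_locales (auto simp: n_def)
  have D: "distances V = facet_center_distances Q" by (rule distances_V)
  show ?thesis
  proof (cases "3 \<le> n \<and> int n simplex Q")
    case True
    then have "s = 2 + 2 / real n"
      using simplex_distance_sum[OF Q tang] two_le unfolding s_def n_def by simp
    moreover have "2 + 2 / real n \<in> \<rat>" by (intro Rats_add Rats_divide Rats_of_nat Rats_number_of)
    ultimately show ?thesis using True not_Ints_two_plus[of n] by (simp add: n_def)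
  next
    case False
    have cases: "(odd E \<and> s = 2 * real k + 1) \<or> (even E \<and> s = 2 * real k + 2)"
    proof (cases "n = 2")
      case two: True
      have E: "E = card V" using polygon_card_edges[OF two] by (simp add: E_def)
      show ?thesis
      proof (cases "- w 1 \<in> V")
        case True
        have anti: "- u \<in> V" if "u \<in> V" for u using polygon_antipodal[OF two True that] .
        have "even (card V)"
        proof (rule even_card_involution[OF V_finite, of uminus])
          show "- u \<noteq> u" if "u \<in> V" for u
          proof
            assume "- u = u"
            then have "u \<bullet> u = - (u \<bullet> u)" by (metis inner_minus_left)
            then show False using V_unit[OF that] by simp
          qed
        qed (use anti in auto)
        moreover have "V \<noteq> {}" using w_top by blast
        ultimately show ?thesis
          using antipodal_distance_sum[OF V_finite V_unit anti] E D by (simp add: s_def k_def)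
      next
        case no: False
        show ?thesis using polygon_odd[OF two no] E D by (simp add: s_def k_def)
      qed
    next
      case n2: False
      then have n3: "3 \<le> n" using two_le by simp
      then have "uminus \<in> symmetries Q c"
        using simplex_if_simply_laced antipodal_or_simplex[OF n3] False by blast
      then show ?thesis
        using antipodal_even_edges[OF _ two_le] antipodal_sum D by (simp add: E_def s_def k_def)
    qed
    then have "s \<in> \<int>" by (auto intro: Ints_add Ints_mult)
    then show ?thesis using cases False by (auto simp: n_def)
  qed
qed

end
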